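(* For any $u\in C([0,t_f],\mathcal H_1)$, $y\in C([0,t_f],\mathbb R^p)$ and $\hat z_0\in\mathcal H$ there exist $\hat z_P\in C([0,t_f],\mathcal H)$ and $P\in C([0,t_f],\mathcal L(\mathcal H))$ which satisfy the following coupled system: for all $t\in[0,t_f]$, $$\hat z_P(t)=T(t)\hat z_0+\int_0^tT(t-s)\big(F(\hat z_P(s),s)+Bu(s)\big)ds+\int_0^tT(t-s)P(s)C^*R^{-1}(s)\big[y(s)-C\hat z_P(s)\big]ds,$$ and, for all $w\in\mathcal H$ and $t\in[0,t_f]$, $$P(t)w=U_P(t,0)P_0U^*(t,0)w+\int_0^tU_P(t,s)W(s)U^*(t,s)w\,ds,$$ where $U(t,s)$ and $U_P(t,s)$, $0\le s\le t\le t_f$, are the evolution operators satisfying, for all $w\in\mathcal H$, $$U(t,s)w=T(t-s)w+\int_s^tT(t-r)\,DF(\hat z_P(r),r)\,U(r,s)w\,dr,$$ $$U_P(t,s)w=U(t,s)w-\int_s^tU(t,r)P(r)C^*R^{-1}(r)C\,U_P(r,s)w\,dr.$$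
   Context: $\mathcal H,\mathcal H_1$ are Hilbert spaces, $t_f>0$ is fixed, $p\ge1$. $\mathcal L(X,Y)$ is the space of bounded linear operators, $\mathcal L(X)=\mathcal L(X,X)$. $C([0,t_f],X)$ denotes continuous functions into the Hilbert space $X$ (norm continuity); $C([0,t_f],\mathcal L(X,Y))$ denotes strongly continuous operator-valued functions. An evolution operator is a map $U:\{(t,s):0\le s\le t\le t_f\}\to\mathcal L(\mathcal H)$ with $U(t,t)=I$, $U(t,r)U(r,s)=U(t,s)$ for $s\le r\le t$, $U(\cdot,s)$ strongly continuous on $[s,t_f]$ and $U(t,\cdot)$ strongly continuous on $[0,t]$. Standing assumptions. $A:\mathcal D(A)\subset\mathcal H\to\mathcal H$ generates a $C_0$-semigroup $T(t)$ on $\mathcal H$. $B\in\mathcal L(\mathcal H_1,\mathcal H)$, $C\in\mathcal L(\mathcal H,\mathbb R^p)$. $F:\mathcal H\times[0,t_f]\to\mathcal H$ is (possibly) nonlinear in its first argument, strongly continuous in time ($t\mapsto F(x,t)$ is continuous for each $x$), and $F(0,t)=0$ for all $t$. $F(\cdot,t)$ has a Fréchet derivative $DF(\cdot,t):\mathcal H\to\mathcal L(\mathcal H)$; there is $\delta_{DF}>0$ with $\|DF(x,t)\|\le\delta_{DF}$ for all $(x,t)\in\mathcal H\times[0,t_f]$; and for every $\delta>0$ there is $\iota_{DF}>0$ such that $\|DF(x,t)-DF(y,t)\|\le\iota_{DF}\|x-y\|$ for all $\|x-y\|<\delta$ and all $t\in[0,t_f]$. $P_0\in\mathcal L(\mathcal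 H)$, $W\in C([0,t_f],\mathcal L(\mathcal H))$, $R\in C([0,t_f],\mathcal L(\mathbb R^p))$ are self-adjoint (for each $t$); $P_0$ is positive definite ($(v,P_0v)>0$ for $v\neq0$); $W(t)$ is nonnegative definite for each $t$; $R(t)$ is uniformly coercive: there is $\delta_0>0$ with $(w,R(t)w)\ge\delta_0\|w\|^2$ for all $w\in\mathbb R^p$, $t\in[0,t_f]$. *)

theory Defs
  imports "HOL-Analysis.Analysis"
begin

text \<open>
  Real Hilbert spaces are types of sort {real_inner, banach}; bounded operators are of type
  blinfun.  The adjoint is the library constant adjoint, and integrals of Hilbert-space-valued
  functions are the library (Henstock-Kurzweil) integrals, which need no separability and
  agree with the Riemann integral for continuous integrands.
\<close>

definition strongly_continuous_on ::
    "real set \<Rightarrow> (real \<Rightarrow> ('a::real_normed_vector \<Rightarrow>\<^sub>L 'b::real_normed_vector)) \<Rightarrow> bool" where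
  "strongly_continuous_on S K \<longleftrightarrow> (\<forall>x. continuous_on S (\<lambda>t. blinfun_apply (K t) x))"

definition C0_semigroup :: "(real \<Rightarrow> ('a::real_normed_vector \<Rightarrow>\<^sub>L 'a)) \<Rightarrow> bool" where
  "C0_semigroup T \<longleftrightarrow>
     T 0 = id_blinfun \<and>
     (\<forall>s\<ge>0. \<forall>t\<ge>0. T (t + s) = T t o\<^sub>L T s) \<and>
     (\<forall>x. ((\<lambda>t. blinfun_apply (T t) x) \<longlongrightarrow> x) (at_right 0))"

text \<open>
  The operator \<open>A\<close> with domain \<open>D\<close> is represented by a total function whose values
  outside \<open>D\<close> are irrelevant.
\<close>

definition generates ::
    "'a set \<Rightarrow> ('a \<Rightarrow> 'a) \<Rightarrow> (real \<Rightarrow> ('a::real_normed_vector \<Rightarrow>\<^sub>L 'a)) \<Rightarrow> bool" where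
  "generates D A T \<longleftrightarrow>
     C0_semigroup T \<and>
     D = {x. \<exists>l. ((\<lambda>h. (blinfun_apply (T h) x - x) /\<^sub>R h) \<longlongrightarrow> l) (at_right 0)} \<and>
     (\<forall>x\<in>D. ((\<lambda>h. (blinfun_apply (T h) x - x) /\<^sub>R h) \<longlongrightarrow> A x) (at_right 0))"

text \<open>Only the values \<open>U t s\<close> with \<open>0 \<le> s \<le> t \<le> tf\<close> are constrained.\<close>

definition evolution_operator ::
    "real \<Rightarrow> (real \<Rightarrow> real \<Rightarrow> ('a::real_normed_vector \<Rightarrow>\<^sub>L 'a)) \<Rightarrow> bool" where
  "evolution_operator tf U \<longleftrightarrow>
     (\<forall>t\<in>{0..tf}. U t t = id_blinfun) \<and>
     (\<forall>s r t. 0 \<le> s \<and> s \<le> r \<and> r \<le> t \<and> t \<le> tf \<longrightarrow> U t r o\<^sub>L U r s = U t s) \<and>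
     (\<forall>s\<in>{0..tf}. strongly_continuous_on {s..tf} (\<lambda>t. U t s)) \<and>
     (\<forall>t\<in>{0..tf}. strongly_continuous_on {0..t} (\<lambda>s. U t s))"

definition self_adjoint :: "('a::real_inner \<Rightarrow>\<^sub>L 'a) \<Rightarrow> bool" where
  "self_adjoint K \<longleftrightarrow> adjoint (blinfun_apply K) = blinfun_apply K"

text \<open>
  The four integral equations.  Since the library integral of a non-integrable function is
  \<open>0\<close>, each equation also asserts that its integrands are integrable.  The inverse
  \<open>R\<inverse>(s)\<close> is the inverse function of the (bijective, as it is coercive) operator \<open>R s\<close>.
\<close>

definition estimator_equation ::
    "real \<Rightarrow> (real \<Rightarrow> ('h \<Rightarrow>\<^sub>L 'h)) \<Rightarrow> ('h \<Rightarrow> real \<Rightarrow> 'h) \<Rightarrow> ('k::{real_inner,banach} \<Rightarrow>\<^sub>L 'h) \<Rightarrow> ('h \<Rightarrow>\<^sub>L (real^'p)) \<Rightarrow>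
     (real \<Rightarrow> ((real^'p) \<Rightarrow>\<^sub>L (real^'p))) \<Rightarrow> (real \<Rightarrow> 'k) \<Rightarrow> (real \<Rightarrow> real^'p) \<Rightarrow> 'h \<Rightarrow>
     (real \<Rightarrow> ('h \<Rightarrow>\<^sub>L 'h)) \<Rightarrow> (real \<Rightarrow> 'h::{real_inner,banach}) \<Rightarrow> bool"
  where
  "estimator_equation tf T F B C R u y z0 P z \<longleftrightarrow>
     (\<forall>t\<in>{0..tf}.
        (\<lambda>s. T (t - s) (F (z s) s + B (u s))) integrable_on {0..t} \<and>
        (\<lambda>s. T (t - s) (P s (adjoint C (inv (R s) (y s - C (z s)))))) integrable_on {0..t} \<and>
        z t = T t z0
          + integral {0..t} (\<lambda>s. T (t - s) (F (z s) s + B (u s)))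
          + integral {0..t} (\<lambda>s. T (t - s) (P s (adjoint C (inv (R s) (y s - C (z s)))))))"

definition covariance_equation ::
    "real \<Rightarrow> ('h \<Rightarrow>\<^sub>L 'h) \<Rightarrow> (real \<Rightarrow> ('h \<Rightarrow>\<^sub>L 'h)) \<Rightarrow> (real \<Rightarrow> real \<Rightarrow> ('h \<Rightarrow>\<^sub>L 'h)) \<Rightarrow>
     (real \<Rightarrow> real \<Rightarrow> ('h \<Rightarrow>\<^sub>L 'h)) \<Rightarrow> (real \<Rightarrow> ('h::{real_inner,banach} \<Rightarrow>\<^sub>L 'h)) \<Rightarrow> bool" where
  "covariance_equation tf P0 W U UP P \<longleftrightarrow>
     (\<forall>w. \<forall>t\<in>{0..tf}.
        (\<lambda>s. UP t s (W s (adjoint (U t s) w))) integrable_on {0..t} \<and>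
        P t w = UP t 0 (P0 (adjoint (U t 0) w))
          + integral {0..t} (\<lambda>s. UP t s (W s (adjoint (U t s) w))))"

definition linearized_evolution_equation ::
    "real \<Rightarrow> (real \<Rightarrow> ('h \<Rightarrow>\<^sub>L 'h)) \<Rightarrow> ('h \<Rightarrow> real \<Rightarrow> ('h \<Rightarrow>\<^sub>L 'h)) \<Rightarrow> (real \<Rightarrow> 'h) \<Rightarrow>
     (real \<Rightarrow> real \<Rightarrow> ('h::{real_inner,banach} \<Rightarrow>\<^sub>L 'h)) \<Rightarrow> bool" where
  "linearized_evolution_equation tf T DF z U \<longleftrightarrow>
     (\<forall>w s t. 0 \<le> s \<and> s \<le> t \<and> t \<le> tf \<longrightarrow>
        (\<lambda>r. T (t - r) (DF (z r) r (U r s w))) integrable_on {s..t} \<and>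
        U t s w = T (t - s) w + integral {s..t} (\<lambda>r. T (t - r) (DF (z r) r (U r s w))))"

definition closed_loop_evolution_equation ::
    "real \<Rightarrow> ('h \<Rightarrow>\<^sub>L (real^'p)) \<Rightarrow> (real \<Rightarrow> ((real^'p) \<Rightarrow>\<^sub>L (real^'p))) \<Rightarrow> (real \<Rightarrow> ('h \<Rightarrow>\<^sub>L 'h)) \<Rightarrow>
     (real \<Rightarrow> real \<Rightarrow> ('h \<Rightarrow>\<^sub>L 'h)) \<Rightarrow>
     (real \<Rightarrow> real \<Rightarrow> ('h::{real_inner,banach} \<Rightarrow>\<^sub>L 'h)) \<Rightarrow> bool" where
  "closed_loop_evolution_equation tf C R P U UP \<longleftrightarrow>
     (\<forall>w s t. 0 \<le> s \<and> s \<le> t \<and> t \<le> tf \<longrightarrow>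
        (\<lambda>r. U t r (P r (adjoint C (inv (R r) (C (UP r s w)))))) integrable_on {s..t} \<and>
        UP t s w = U t s w
          - integral {s..t} (\<lambda>r. U t r (P r (adjoint C (inv (R r) (C (UP r s w)))))))"

end

theory Submission
  imports Defs
begin

text \<open>
  The trajectory \<open>z\<close> determines the linearized family \<open>U\<close>, the family \<open>U\<close> determines \<open>P\<close>
  through a Riccati equation, and \<open>P\<close> drives \<open>z\<close>.  Solving for \<open>U\<close> and \<open>P\<close> first turns the
  coupled system into one fixed point equation for \<open>z\<close>.  All dependences are causal integral
  operators, so in the norm weighted by \<open>exp (- \<kappa> t)\<close> each integration contributes a factor
  \<open>1 / \<kappa>\<close>, and for large \<open>\<kappa>\<close> the map is a contraction on the whole time interval
  (\<open>weighted_fixed_point\<close>).  The Lipschitz constants come from \<open>perturbation_lipschitz\<close> for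
  \<open>z \<mapsto> U\<close> and \<open>riccati_lipschitz\<close> for \<open>U \<mapsto> P\<close>; they are finite because \<open>P\<close> is bounded
  independently of \<open>z\<close>, after which \<open>z\<close> itself stays below a fixed exponential since the
  estimator equation grows only linearly in \<open>z\<close>.

  The uniform bound on \<open>P\<close> rests on positivity.  With \<open>G = C* R\<inverse> C\<close> the covariance equation
  is equivalent to \<open>P = U P0 U* + \<integral> U (W - P G P) U*\<close> (\<open>closed_loop_form\<close>).  Let \<open>Pm\<close> be the
  right-hand side without \<open>P G P\<close>.  For \<open>0 \<le> P \<le> Pm\<close> one has \<open>P G P \<le> l P\<close> with a constant
  \<open>l\<close>, so after adding \<open>l P\<close> to the integrand and damping by \<open>exp (- l t)\<close> the Picard map
  preserves this order interval, and a single contraction yields a solution for all times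
  (\<open>riccati_solution\<close>).

  The adjoints \<open>U*\<close> occur inside integrals and must be strongly continuous, although the
  adjoints of the derivatives of \<open>F\<close> may fail to be.  In a Hilbert space the adjoint semigroup
  is strongly continuous (\<open>C0_semigroup_adj\<close>), and this is inherited by \<open>U*\<close> because \<open>U\<close> and the
  semigroup differ by \<open>O(t - s)\<close> in norm (\<open>scont_adj_perturbation\<close>).
\<close>

section \<open>Adjoints in Hilbert space\<close>

text \<open>By the parallelogram law a sequence minimizing the distance to a point outside \<open>Y\<close> is Cauchy,
  so completeness replaces local compactness in finding a nearest point.\<close>

lemma closed_subspace_orthogonal:
  fixes Y :: "'a::{real_inner,banach} set"
  assumes Y: "closed Y" "subspace Y" and b: "b \<notin> Y"
  shows "\<exists>x. x \<noteq> 0 \<and> (\<forall>y\<in>Y. x \<bullet> y = 0)"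
proof -
  have ne: "Y \<noteq> {}" and cv: "convex Y"
    using Y(2) subspace_0 subspace_imp_convex by blast+
  define d where "d = infdist b Y"
  have d_le: "d \<le> dist b v" if "v \<in> Y" for v
    unfolding d_def by (rule infdist_le[OF that])
  have d0: "d \<ge> 0" unfolding d_def by (rule infdist_nonneg)
  have "\<exists>v\<in>Y. dist b v < d + 1 / real (Suc n)" for n
  proof (rule ccontr)
    assume "\<not> (\<exists>v\<in>Y. dist b v < d + 1 / real (Suc n))"
    then have "d + 1 / real (Suc n) \<le> (INF v\<in>Y. dist b v)"
      using ne by (intro cINF_greatest) (auto simp: not_less)
    also have "\<dots> = d" unfolding d_def infdist_def using ne by simp
    finally show False by (simp add: field_simps)
  qed
  then obtain v where v: "\<And>n. v n \<in> Y" "\<And>n. dist b (v n) < d + 1 / real (Suc n)" by metis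
  have par: "(norm (v m - v n))\<^sup>2 \<le> 2 * (dist b (v m))\<^sup>2 + 2 * (dist b (v n))\<^sup>2 - 4 * d\<^sup>2" for m n
  proof -
    have "(1/2) *\<^sub>R (v m + v n) \<in> Y"
      using Y(2) v(1) by (simp add: subspace_add subspace_scale)
    from d_le[OF this] have "d\<^sup>2 \<le> (dist b ((1/2) *\<^sub>R (v m + v n)))\<^sup>2"
      using d0 by (intro power_mono) auto
    then show ?thesis
      unfolding dist_norm power2_norm_eq_inner
      by (simp add: inner_diff_left inner_diff_right inner_add_left inner_add_right inner_commute
          algebra_simps) 
  qed
  have lim_n: "(\<lambda>n. d + 1 / real (Suc n)) \<longlonglongrightarrow> d"
    using tendsto_add[OF tendsto_const lim_inverse_n'[THEN LIMSEQ_Suc], of d] by simp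
  have lim: "(\<lambda>n. dist b (v n)) \<longlonglongrightarrow> d"
    by (rule tendsto_sandwich[OF _ _ tendsto_const lim_n])
      (use d_le[OF v(1)] v(2) in \<open>auto intro!: eventuallyI less_imp_le\<close>)
  have "Cauchy v"
  proof (rule metric_CauchyI)
    fix e :: real assume e: "e > 0"
    have "(\<lambda>n. (dist b (v n))\<^sup>2) \<longlonglongrightarrow> d\<^sup>2" by (intro tendsto_intros lim)
    then have "eventually (\<lambda>n. (dist b (v n))\<^sup>2 < d\<^sup>2 + e\<^sup>2/4) sequentially"
      using e by (intro order_tendstoD) auto
    then obtain N where N: "\<And>n. n \<ge> N \<Longrightarrow> (dist b (v n))\<^sup>2 < d\<^sup>2 + e\<^sup>2/4"
      by (auto simp: eventually_sequentially)
    show "\<exists>M. \<forall>m\<ge>M. \<forall>n\<ge>M. dist (v m) (v n) < e"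
    proof (intro exI allI impI)
      fix m n assume "N \<le> m" "N \<le> n"
      then have "(norm (v m - v n))\<^sup>2 < e\<^sup>2"
        using par[of m n] N[of m] N[of n] by simp
      then show "dist (v m) (v n) < e"
        unfolding dist_norm using e by (meson less_imp_le power2_less_imp_less)
    qed
  qed
  then obtain l where l: "v \<longlonglongrightarrow> l" using convergent_eq_Cauchy by (auto simp: convergent_def)
  have lY: "l \<in> Y" using closed_sequentially[OF Y(1) _ l] v(1) by blast
  have "dist b l = d"
    by (rule LIMSEQ_unique[OF tendsto_dist[OF tendsto_const l] lim])
  then have near: "\<forall>z\<in>Y. dist b l \<le> dist b z" using d_le by simp
  have le: "(b - l) \<bullet> y \<le> 0" if "y \<in> Y" for y
    using any_closest_point_dot[OF cv Y(1) lY _ near, of "l + y"] subspace_add[OF Y(2) lY that]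
    by simp
  have "(b - l) \<bullet> y = 0" if "y \<in> Y" for y
    using le[OF that] le[OF subspace_neg[OF Y(2) that]] by simp
  moreover have "b - l \<noteq> 0" using b lY by auto
  ultimately show ?thesis by blast
qed

lemma riesz_representation:
  fixes f :: "'a::{real_inner,banach} \<Rightarrow> real"
  assumes f: "bounded_linear f"
  shows "\<exists>a. \<forall>x. f x = x \<bullet> a"
proof (cases "\<forall>x. f x = 0")
  case True then show ?thesis by (intro exI[of _ 0]) simp
next
  case False
  interpret bounded_linear f by fact
  let ?Y = "{x. f x = 0}"
  have "closed ?Y"
    by (intro closed_Collect_eq continuous_intros linear_continuous_on f)
  moreover have "subspace ?Y" by (auto simp: subspace_def add scaleR zero)
  ultimately obtain x where x: "x \<noteq> 0" "\<And>y. f y = 0 \<Longrightarrow> x \<bullet> y = 0"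
    using closed_subspace_orthogonal[of ?Y] False by auto
  have fx: "f x \<noteq> 0" using x(2)[of x] x(1) by auto
  have "f v = v \<bullet> ((f x / (x \<bullet> x)) *\<^sub>R x)" for v
  proof -
    have "f (f x *\<^sub>R v - f v *\<^sub>R x) = 0" by (simp add: diff scaleR)
    from x(2)[OF this] have "f x * (x \<bullet> v) = f v * (x \<bullet> x)" by (simp add: inner_diff_right)
    then show ?thesis using x(1) by (simp add: field_simps inner_commute)
  qed
  then show ?thesis by blast
qed

text \<open>The function \<open>adjoint\<close> is a Hilbert choice; Riesz representation shows that it is a genuine
  bounded adjoint, and \<open>adj\<close> makes it available as an operator.\<close>

definition adj :: "('a::{real_inner,banach} \<Rightarrow>\<^sub>L 'b::real_inner) \<Rightarrow> ('b \<Rightarrow>\<^sub>L 'a)" where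
  "adj K = Blinfun (adjoint (blinfun_apply K))"

lemma adjoint_exists:
  fixes K :: "'a::{real_inner,banach} \<Rightarrow>\<^sub>L 'b::real_inner"
  shows "\<exists>f. \<forall>x y. K x \<bullet> y = x \<bullet> f y"
proof -
  have "\<exists>a. \<forall>x. K x \<bullet> y = x \<bullet> a" for y
    by (rule riesz_representation) (auto intro!: bounded_linear_intros
        bounded_linear_compose[OF bounded_linear_inner_left, unfolded o_def])
  then show ?thesis by metis
qed

lemma adj_apply:
  fixes K :: "'a::{real_inner,banach} \<Rightarrow>\<^sub>L 'b::real_inner"
  shows "blinfun_apply (adj K) = adjoint (blinfun_apply K)"
    and adj_inner: "K x \<bullet> y = x \<bullet> adj K y"
    and norm_adj_le: "norm (adj K) \<le> norm K"
proof -
  define f where "f = adjoint (blinfun_apply K)"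
  have f: "K x \<bullet> y = x \<bullet> f y" for x y
    unfolding f_def adjoint_def by (rule someI2_ex[OF adjoint_exists]) blast
  have bnd: "norm (f y) \<le> norm y * norm K" for y
  proof (cases "f y = 0")
    case False
    have "norm (f y) * norm (f y) = K (f y) \<bullet> y" by (simp add: f norm_eq_sqrt_inner)
    also have "\<dots> \<le> norm (K (f y)) * norm y" by (rule norm_cauchy_schwarz)
    also have "\<dots> \<le> (norm K * norm (f y)) * norm y" by (intro mult_right_mono norm_blinfun) auto
    finally show ?thesis using False by (simp add: field_simps)
  qed simp
  have bl: "bounded_linear f"
  proof (rule bounded_linear_intro[OF _ _ bnd])
    show "f (a + b) = f a + f b" for a b
      by (rule vector_eq_ldot[THEN iffD1]) (auto simp: f[symmetric] inner_add_right)
    show "f (c *\<^sub>R a) = c *\<^sub>R f a" for a c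
      by (rule vector_eq_ldot[THEN iffD1]) (auto simp: f[symmetric])
  qed
  have adjf: "blinfun_apply (adj K) = f"
    unfolding adj_def f_def[symmetric] by (rule bounded_linear_Blinfun_apply[OF bl])
  show "blinfun_apply (adj K) = adjoint (blinfun_apply K)" by (simp add: adjf f_def)
  show "K x \<bullet> y = x \<bullet> adj K y" by (simp add: adjf f)
  show "norm (adj K) \<le> norm K"
    by (rule norm_blinfun_bound) (use bnd in \<open>auto simp: adjf mult.commute\<close>)
qed

lemma adj_unique:
  fixes K :: "'a::{real_inner,banach} \<Rightarrow>\<^sub>L 'b::real_inner" and L :: "'b \<Rightarrow>\<^sub>L 'a"
  shows "(\<And>x y. K x \<bullet> y = x \<bullet> L y) \<Longrightarrow> adj K = L"
  by (rule blinfun_eqI, rule vector_eq_ldot[THEN iffD1]) (metis adj_inner)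

lemma adj_inner': "adj K y \<bullet> x = y \<bullet> K x"
  by (metis adj_inner inner_commute)

lemma adj_compose: "adj (K o\<^sub>L L) = adj L o\<^sub>L adj K"
  by (rule adj_unique) (simp add: adj_inner)

lemma adj_diff: "adj (K - L) = adj K - adj L"
  by (rule adj_unique) (simp add: adj_inner blinfun.diff_left inner_diff_left inner_diff_right)

lemma adj_id: "adj id_blinfun = id_blinfun"
  by (rule adj_unique) simp

lemma self_adjoint_iff: "self_adjoint K \<longleftrightarrow> (\<forall>x y. K x \<bullet> y = x \<bullet> K y)"
  for K :: "'a::{real_inner,banach} \<Rightarrow>\<^sub>L 'a"
  unfolding self_adjoint_def by (metis adj_apply adj_inner adjoint_unique)

text \<open>The polynomial \<open>K (r x + y) \<bullet> (r x + y)\<close> in \<open>r\<close> is nonnegative; if its leading coefficient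
  vanishes, so must the linear one.\<close>

lemma nonneg_operator_cauchy_schwarz:
  fixes K :: "'a::{real_inner,banach} \<Rightarrow>\<^sub>L 'a"
  assumes sa: "self_adjoint K" and pos: "\<And>x. 0 \<le> K x \<bullet> x"
  shows "(K x \<bullet> y)\<^sup>2 \<le> (K x \<bullet> x) * (K y \<bullet> y)"
proof -
  have sym: "K y \<bullet> x = K x \<bullet> y" using sa by (metis inner_commute self_adjoint_iff)
  have q: "0 \<le> K x \<bullet> x * r\<^sup>2 + 2 * (K x \<bullet> y) * r + K y \<bullet> y" for r
    using pos[of "r *\<^sub>R x + y"] sym
    by (simp add: blinfun.add_right blinfun.scaleR_right inner_add_left inner_add_right
        power2_eq_square algebra_simps)
  show ?thesis
  proof (cases "K x \<bullet> x = 0")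
    case True
    have "K x \<bullet> y = 0"
    proof (rule ccontr)
      assume ne: "K x \<bullet> y \<noteq> 0"
      have "0 \<le> 2 * (K x \<bullet> y) * (- (K y \<bullet> y + 1) / (2 * (K x \<bullet> y))) + K y \<bullet> y"
        using q[of "- (K y \<bullet> y + 1) / (2 * (K x \<bullet> y))"] True by simp
      then show False using ne by simp
    qed
    then show ?thesis using True by simp
  next
    case False
    then have p: "K x \<bullet> x > 0" using pos[of x] by simp
    have "0 \<le> (K x \<bullet> x) * (K x \<bullet> x * (- (K x \<bullet> y) / (K x \<bullet> x))\<^sup>2
        + 2 * (K x \<bullet> y) * (- (K x \<bullet> y) / (K x \<bullet> x)) + K y \<bullet> y)"
      by (rule mult_nonneg_nonneg[OF less_imp_le[OF p] q])
    also have "\<dots> = (K x \<bullet> x) * (K y \<bullet> y) - (K x \<bullet> y)\<^sup>2"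
      using p by (simp add: field_simps power2_eq_square)
    finally show ?thesis by simp
  qed
qed

text \<open>This is the Cauchy-Schwarz inequality above at \<open>y = K x\<close>.\<close>

lemma nonneg_operator_square_le:
  fixes K :: "'a::{real_inner,banach} \<Rightarrow>\<^sub>L 'a"
  assumes sa: "self_adjoint K" and pos: "\<And>x. 0 \<le> K x \<bullet> x"
    and m: "\<And>x. K x \<bullet> x \<le> m * (norm x)\<^sup>2"
  shows "(norm (K x))\<^sup>2 \<le> m * (K x \<bullet> x)"
proof (cases "K x = 0")
  case False
  have "((norm (K x))\<^sup>2)\<^sup>2 = (K x \<bullet> K x)\<^sup>2" by (simp add: power2_norm_eq_inner)
  also have "\<dots> \<le> (K x \<bullet> x) * (K (K x) \<bullet> K x)"
    by (rule nonneg_operator_cauchy_schwarz[OF sa pos])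
  also have "\<dots> \<le> (K x \<bullet> x) * (m * (norm (K x))\<^sup>2)"
    by (intro mult_left_mono m pos)
  finally have "(norm (K x))\<^sup>2 * (norm (K x))\<^sup>2 \<le> (m * (K x \<bullet> x)) * (norm (K x))\<^sup>2"
    by (simp add: power2_eq_square algebra_simps)
  then show ?thesis by (rule mult_right_le_imp_le) (use False in simp)
qed simp

lemma nonneg_operator_norm_le:
  fixes K :: "'a::{real_inner,banach} \<Rightarrow>\<^sub>L 'a"
  assumes sa: "self_adjoint K" and pos: "\<And>x. 0 \<le> K x \<bullet> x"
    and m: "\<And>x. K x \<bullet> x \<le> m * (norm x)\<^sup>2" and m0: "0 \<le> m"
  shows "norm K \<le> m"
proof (rule norm_blinfun_bound[OF m0])
  fix x
  have "(norm (K x))\<^sup>2 \<le> m * (m * (norm x)\<^sup>2)"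
    using nonneg_operator_square_le[OF sa pos m, of x] mult_left_mono[OF m[of x] m0] by simp
  also have "\<dots> = (m * norm x)\<^sup>2"
    by (simp add: power2_eq_square mult_ac)
  finally show "norm (K x) \<le> m * norm x"
    by (rule power2_le_imp_le) (simp add: m0)
qed

section \<open>Uniform boundedness\<close>

text \<open>By Baire, one of the closed sets on which the family is bounded by \<open>n\<close> contains a ball.\<close>

lemma uniform_boundedness:
  fixes K :: "'i \<Rightarrow> ('a::banach \<Rightarrow>\<^sub>L 'b::real_normed_vector)"
  assumes pw: "\<And>x. \<exists>b. \<forall>i\<in>I. norm (K i x) \<le> b"
  shows "\<exists>b\<ge>0. \<forall>i\<in>I. norm (K i) \<le> b"
proof -
  define E where "E n = {x. \<forall>i\<in>I. norm (K i x) \<le> real n}" for n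
  have cl: "closed (E n)" for n
  proof -
    have "E n = (\<Inter>i\<in>I. {x. norm (K i x) \<le> real n})" by (auto simp: E_def)
    then show ?thesis
      by (auto intro!: closed_Collect_le continuous_intros)
  qed
  have un: "\<Union> (range E) = UNIV"
  proof -
    have "\<exists>n. x \<in> E n" for x
    proof -
      obtain b where b: "\<And>i. i \<in> I \<Longrightarrow> norm (K i x) \<le> b" using pw by blast
      obtain n where "b \<le> real n" using real_arch_simple by blast
      then have "x \<in> E n" using b unfolding E_def by (blast intro: order_trans)
      then show ?thesis ..
    qed
    then show ?thesis by blast
  qed
  have "\<exists>n. interior (E n) \<noteq> {}"
  proof (rule ccontr)
    assume a: "\<not> ?thesis"
    have "euclidean interior_of \<Union> (range E) = {}"
      using Met_TC.metric_Baire_category_alt[where 'a='a, of "range E"] a cl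
      by (auto simp: complete_UNIV)
    then show False unfolding un by simp
  qed
  then obtain n x where "x \<in> interior (E n)" by blast
  then obtain e where e: "e > 0" "cball x e \<subseteq> E n" by (metis mem_interior_cball)
  have "norm (K i) \<le> 2 * real n / e" if i: "i \<in> I" for i
  proof (rule norm_blinfun_bound)
    fix v
    show "norm (K i v) \<le> 2 * real n / e * norm v"
    proof (cases "v = 0")
      case False
      let ?c = "e / norm v"
      have c: "?c > 0" using e False by simp
      have "x + ?c *\<^sub>R v \<in> E n" "x \<in> E n" using e False by (auto simp: subset_eq dist_norm)
      then have "norm (K i (x + ?c *\<^sub>R v)) \<le> n" "norm (K i x) \<le> n" using i by (auto simp: E_def)
      then have "norm (K i (x + ?c *\<^sub>R v) - K i x) \<le> real n + real n"
        using norm_triangle_ineq4[of "K i (x + ?c *\<^sub>R v)" "K i x"] by linarith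
      then have "?c * norm (K i v) \<le> 2 * real n"
        using c e by (simp add: blinfun.add_right blinfun.scaleR_right)
      then show ?thesis using False e by (simp add: field_simps abs_of_pos)
    qed simp
  qed (use e in auto)
  then show ?thesis using e by (intro exI[of _ "2 * real n / e"]) auto
qed

section \<open>Fixed points and bounds in a weighted supremum norm\<close>

text \<open>A Gronwall inequality: the best constant \<open>c\<close> in \<open>f \<le> c \<omega>\<close> satisfies \<open>c \<le> a + c / 2\<close>.
  The bound \<open>b\<close> only ensures that this \<open>c\<close> is finite.\<close>

lemma weighted_bound:
  fixes f \<omega> :: "'i \<Rightarrow> real"
  assumes w: "\<And>i. i \<in> I \<Longrightarrow> \<omega> i > 0" and b: "\<And>i. i \<in> I \<Longrightarrow> f i \<le> b * \<omega> i"
    and step: "\<And>c. 0 \<le> c \<Longrightarrow> (\<And>i. i \<in> I \<Longrightarrow> f i \<le> c * \<omega> i) \<Longrightarrow> (\<And>i. i \<in> I \<Longrightarrow> f i \<le> (a + c / 2) * \<omega> i)"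
    and a: "0 \<le> a" and i: "i \<in> I"
  shows "f i \<le> 2 * a * \<omega> i"
proof -
  define g where "g i = f i / \<omega> i" for i
  have iff: "f i \<le> c * \<omega> i \<longleftrightarrow> g i \<le> c" if "i \<in> I" for i c
    using w[OF that] by (simp add: g_def field_simps)
  define s where "s = max 0 (Sup (g ` I))"
  have bdd: "bdd_above (g ` I)" using b iff by (intro bdd_aboveI[of _ b]) auto
  have up: "g i \<le> s" if "i \<in> I" for i
    unfolding s_def using cSUP_upper[OF that bdd] by simp
  have "g j \<le> a + s / 2" if "j \<in> I" for j
    using step[of s j] up that by (simp add: iff s_def)
  then have "Sup (g ` I) \<le> a + s / 2" using i by (intro cSUP_least) auto
  then have "s \<le> 2 * a" using a unfolding s_def by (auto simp: max_def split: if_splits)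
  then show ?thesis using up[OF i] by (simp add: iff[OF i])
qed

text \<open>Distances are compared pointwise with multiples of \<open>\<omega>\<close>, so that norms of strongly continuous
  operator families, which may be badly behaved functions of time, are never integrated.
  The upper bound on \<open>\<omega>\<close> makes weighted convergence imply uniform convergence.\<close>

lemma weighted_fixed_point:
  fixes \<Phi> :: "('i \<Rightarrow> 'e::banach) \<Rightarrow> ('i \<Rightarrow> 'e)" and \<omega> :: "'i \<Rightarrow> real"
  assumes w: "\<And>i. i \<in> I \<Longrightarrow> \<omega> i > 0" "\<And>i. i \<in> I \<Longrightarrow> \<omega> i \<le> \<Omega>"
    and f0: "f0 \<in> S" and maps: "\<And>f. f \<in> S \<Longrightarrow> \<Phi> f \<in> S"
    and bnd: "\<And>f g i. f \<in> S \<Longrightarrow> g \<in> S \<Longrightarrow> \<exists>b. \<forall>i\<in>I. norm (f i - g i) \<le> b * \<omega> i"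
    and contr: "\<And>f g c i. f \<in> S \<Longrightarrow> g \<in> S \<Longrightarrow> 0 \<le> c \<Longrightarrow> (\<And>i. i \<in> I \<Longrightarrow> norm (f i - g i) \<le> c * \<omega> i)
        \<Longrightarrow> i \<in> I \<Longrightarrow> norm (\<Phi> f i - \<Phi> g i) \<le> (c / 2) * \<omega> i"
    and closed: "\<And>F f. (\<And>n::nat. F n \<in> S) \<Longrightarrow> uniform_limit I F f sequentially \<Longrightarrow> f \<in> S"
  shows "\<exists>f\<in>S. \<forall>i\<in>I. \<Phi> f i = f i"
proof -
  define F where "F n = (\<Phi> ^^ n) f0" for n
  have FS: "F n \<in> S" for n unfolding F_def by (induction n) (auto simp: f0 maps)
  have F_Suc: "F (Suc n) = \<Phi> (F n)" for n by (simp add: F_def)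
  obtain b0 where "\<forall>i\<in>I. norm (F 1 i - F 0 i) \<le> b0 * \<omega> i" using bnd[OF FS FS] by blast
  then have "norm (F 1 i - F 0 i) \<le> max 0 b0 * \<omega> i" if "i \<in> I" for i
    using w(1)[OF that] that by (metis less_imp_le max.cobounded2 mult_right_mono order_trans)
  then obtain b where b: "b \<ge> 0" "\<And>i. i \<in> I \<Longrightarrow> norm (F 1 i - F 0 i) \<le> b * \<omega> i"
    using max.cobounded1 by blast
  have step: "norm (F (Suc n) i - F n i) \<le> b / 2^n * \<omega> i" if "i \<in> I" for n i
    using that
  proof (induction n arbitrary: i)
    case 0 then show ?case using b by simp
  next
    case (Suc n)
    have "norm (\<Phi> (F (Suc n)) i - \<Phi> (F n) i) \<le> (b / 2^n / 2) * \<omega> i"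
      by (rule contr[OF FS FS _ Suc.IH Suc.prems]) (use b in auto)
    then show ?case by (simp add: F_Suc mult.commute)
  qed
  have W0: "\<Omega> \<ge> 0" if "i \<in> I" for i using w[OF that] by simp
  have step': "norm (F (Suc n) i - F n i) \<le> b * \<Omega> * (1/2)^n" if "i \<in> I" for n i
  proof -
    have "b / 2^n * \<omega> i \<le> b / 2^n * \<Omega>" using w(2)[OF that] b by (intro mult_left_mono) auto
    then show ?thesis using step[OF that, of n] by (simp add: power_divide field_simps)
  qed
  have "uniform_limit I (\<lambda>n i. \<Sum>k<n. F (Suc k) i - F k i) (\<lambda>i. \<Sum>k. F (Suc k) i - F k i) sequentially"
    by (rule Weierstrass_m_test[OF step']) (auto intro!: summable_mult summable_geometric)
  then have ul: "uniform_limit I (\<lambda>n i. F n i - F 0 i) (\<lambda>i. \<Sum>k. F (Suc k) i - F k i) sequentially"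
    by (simp add: sum_lessThan_telescope[where f="\<lambda>k. F k _"])
  define f where "f i = F 0 i + (\<Sum>k. F (Suc k) i - F k i)" for i
  have lim: "uniform_limit I F f sequentially"
  proof -
    have "uniform_limit I (\<lambda>n i. F 0 i + (F n i - F 0 i)) f sequentially"
      unfolding f_def by (intro uniform_limit_intros ul)
    then show ?thesis by simp
  qed
  have fS: "f \<in> S" by (rule closed[OF FS lim])
  have "\<Phi> f i = f i" if i: "i \<in> I" for i
  proof -
    have tail: "norm (F n j - f j) \<le> (2 * b / 2^n) * \<omega> j" if j: "j \<in> I" for n j
    proof -
      have lj: "(\<lambda>m. F m j) \<longlonglongrightarrow> f j" by (rule tendsto_uniform_limitI[OF lim j])
      have "norm (F n j - F (n + m) j) \<le> (2 * b / 2^n - 2 * b / 2^(n+m)) * \<omega> j" for m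
      proof (induction m)
        case (Suc m)
        have "norm (F n j - F (n + Suc m) j) \<le> norm (F n j - F (n + m) j) + norm (F (Suc (n + m)) j - F (n+m) j)"
          by (metis add_Suc_right norm_minus_commute norm_triangle_sub order_refl norm_diff_triangle_le)
        also have "\<dots> \<le> (2 * b / 2^n - 2 * b / 2^(n+m)) * \<omega> j + b / 2^(n+m) * \<omega> j"
          by (intro add_mono Suc step j)
        also have "\<dots> = (2 * b / 2^n - 2 * b / 2^(n+Suc m)) * \<omega> j"
          by (simp add: field_simps)
        finally show ?case .
      qed simp
      moreover have "(2 * b / 2^n - 2 * b / 2^(n+m)) * \<omega> j \<le> (2 * b / 2^n) * \<omega> j" for m
        using b w(1)[OF j] by (intro mult_right_mono) auto
      ultimately have le: "norm (F n j - F (n + m) j) \<le> (2 * b / 2^n) * \<omega> j" for m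
        using order_trans by blast
      have "(\<lambda>m. norm (F n j - F (n + m) j)) \<longlonglongrightarrow> norm (F n j - f j)"
        using LIMSEQ_ignore_initial_segment[OF lj, of n] by (intro tendsto_intros) (simp add: add.commute)
      then show ?thesis by (rule LIMSEQ_le_const2) (use le in blast)
    qed
    have le: "norm (F (Suc n) i - \<Phi> f i) \<le> b / 2^n * \<omega> i" for n
      using contr[OF FS[of n] fS _ tail i] b by (simp add: F_Suc)
    have lim0: "(\<lambda>n. b / 2^n * \<omega> i) \<longlonglongrightarrow> 0"
      using tendsto_mult_right_zero[OF LIMSEQ_power_zero[of "1/2::real"], of "b * \<omega> i"]
      by (simp add: power_divide field_simps)
    have "(\<lambda>n. F (Suc n) i - \<Phi> f i) \<longlonglongrightarrow> 0"
      by (rule Lim_null_comparison[OF _ lim0]) (use le in \<open>intro eventuallyI\<close>)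
    then have "(\<lambda>n. F (Suc n) i) \<longlonglongrightarrow> \<Phi> f i" by (simp add: LIM_zero_iff)
    moreover have "(\<lambda>n. F (Suc n) i) \<longlonglongrightarrow> f i" using tendsto_uniform_limitI[OF lim i] by (rule LIMSEQ_Suc)
    ultimately show ?thesis by (rule LIMSEQ_unique)
  qed
  then show ?thesis using fS by blast
qed

section \<open>Strongly continuous operator families and their integrals\<close>

text \<open>The uniform bound makes compositions of strongly continuous families strongly continuous;
  on compact sets it is automatic by \<open>scont_of_compact\<close> below.\<close>

definition scont :: "'x::topological_space set \<Rightarrow> ('x \<Rightarrow> ('a::real_normed_vector \<Rightarrow>\<^sub>L 'b::real_normed_vector)) \<Rightarrow> bool" where
  "scont X K \<longleftrightarrow> (\<forall>w. continuous_on X (\<lambda>x. K x w)) \<and> (\<exists>k. \<forall>x\<in>X. norm (K x) \<le> k)"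

lemma scontI:
  fixes K :: "'x::topological_space \<Rightarrow> ('a::real_normed_vector \<Rightarrow>\<^sub>L 'b::real_normed_vector)"
  shows "(\<And>w. continuous_on X (\<lambda>x. K x w)) \<Longrightarrow> (\<And>x. x \<in> X \<Longrightarrow> norm (K x) \<le> k) \<Longrightarrow> scont X K"
  unfolding scont_def by blast

lemma scont_bound:
  fixes K :: "'x::topological_space \<Rightarrow> ('a::real_normed_vector \<Rightarrow>\<^sub>L 'b::real_normed_vector)"
  assumes "scont X K"
  obtains k where "k \<ge> 0" "\<And>x. x \<in> X \<Longrightarrow> norm (K x) \<le> k"
proof -
  obtain k where "\<forall>x\<in>X. norm (K x) \<le> k" using assms unfolding scont_def by blast
  then show ?thesis using that[of "max 0 k"] by fastforce
qed

lemma scont_cont: "scont X K \<Longrightarrow> continuous_on X (\<lambda>x. K x w)"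
  by (simp add: scont_def)

lemma scont_apply:
  assumes K: "scont X K" and v: "continuous_on X v"
  shows "continuous_on X (\<lambda>x. K x (v x))"
  unfolding continuous_on_def
proof
  fix x0 assume x0: "x0 \<in> X"
  obtain k where k: "k \<ge> 0" "\<And>x. x \<in> X \<Longrightarrow> norm (K x) \<le> k" using scont_bound[OF K] by blast
  have inX: "eventually (\<lambda>x. x \<in> X) (at x0 within X)"
    by (simp add: eventually_at_filter)
  have vlim: "(v \<longlongrightarrow> v x0) (at x0 within X)" using v x0 by (auto simp: continuous_on_def)
  have "((\<lambda>x. K x (v x - v x0)) \<longlongrightarrow> 0) (at x0 within X)"
  proof (rule Lim_null_comparison)
    show "eventually (\<lambda>x. norm (K x (v x - v x0)) \<le> k * norm (v x - v x0)) (at x0 within X)"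
      using inX
    proof (eventually_elim)
      case (elim x)
      show ?case
        by (rule order_trans[OF norm_blinfun]) (use k(2)[OF elim] in \<open>auto intro: mult_right_mono\<close>)
    qed
    have "((\<lambda>x. k * norm (v x - v x0)) \<longlongrightarrow> k * norm (v x0 - v x0)) (at x0 within X)"
      by (intro tendsto_intros vlim)
    then show "((\<lambda>x. k * norm (v x - v x0)) \<longlongrightarrow> 0) (at x0 within X)" by simp
  qed
  moreover have "((\<lambda>x. K x (v x0)) \<longlongrightarrow> K x0 (v x0)) (at x0 within X)"
    using scont_cont[OF K] x0 by (auto simp: continuous_on_def)
  ultimately have "((\<lambda>x. K x (v x - v x0) + K x (v x0)) \<longlongrightarrow> 0 + K x0 (v x0)) (at x0 within X)"
    by (rule tendsto_add)
  then show "((\<lambda>x. K x (v x)) \<longlongrightarrow> K x0 (v x0)) (at x0 within X)"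
    by (simp add: blinfun.diff_right)
qed

lemma scont_compose:
  assumes K: "scont X K" and L: "scont X L"
  shows "scont X (\<lambda>x. K x o\<^sub>L L x)"
proof -
  obtain k where k: "k \<ge> 0" "\<And>x. x \<in> X \<Longrightarrow> norm (K x) \<le> k" using scont_bound[OF K] by blast
  obtain l where l: "l \<ge> 0" "\<And>x. x \<in> X \<Longrightarrow> norm (L x) \<le> l" using scont_bound[OF L] by blast
  show ?thesis
  proof (rule scontI)
    show "continuous_on X (\<lambda>x. (K x o\<^sub>L L x) w)" for w
      by (simp add: scont_apply[OF K scont_cont[OF L]])
    show "norm (K x o\<^sub>L L x) \<le> k * l" if "x \<in> X" for x
      by (rule order_trans[OF norm_blinfun_compose]) (use k l that in \<open>auto intro!: mult_mono\<close>)
  qed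
qed

lemma scont_add:
  assumes K: "scont X K" and L: "scont X L"
  shows "scont X (\<lambda>x. K x + L x)"
proof -
  obtain k where k: "k \<ge> 0" "\<And>x. x \<in> X \<Longrightarrow> norm (K x) \<le> k" using scont_bound[OF K] by blast
  obtain l where l: "l \<ge> 0" "\<And>x. x \<in> X \<Longrightarrow> norm (L x) \<le> l" using scont_bound[OF L] by blast
  show ?thesis
  proof (rule scontI)
    show "continuous_on X (\<lambda>x. (K x + L x) w)" for w
      by (simp add: blinfun.add_left continuous_on_add scont_cont K L)
    show "norm (K x + L x) \<le> k + l" if "x \<in> X" for x
      by (rule norm_triangle_le) (intro add_mono k l that)
  qed
qed

lemma scont_scaleR:
  assumes K: "scont X K" and c: "continuous_on X c" "\<And>x. x \<in> X \<Longrightarrow> \<bar>c x\<bar> \<le> b"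
  shows "scont X (\<lambda>x. c x *\<^sub>R K x)"
proof -
  obtain k where k: "k \<ge> 0" "\<And>x. x \<in> X \<Longrightarrow> norm (K x) \<le> k" using scont_bound[OF K] by blast
  show ?thesis
  proof (rule scontI)
    show "continuous_on X (\<lambda>x. (c x *\<^sub>R K x) w)" for w
      by (simp add: blinfun.scaleR_left continuous_on_scaleR scont_cont K c)
    show "norm (c x *\<^sub>R K x) \<le> \<bar>b\<bar> * k" if "x \<in> X" for x
      using c(2)[OF that] k(2)[OF that] k(1) by (simp add: mult_mono)
  qed
qed

lemma scont_minus: "scont X K \<Longrightarrow> scont X (\<lambda>x. - K x)"
  using scont_scaleR[of X K "\<lambda>_. -1" 1] by simp

lemma scont_diff: "scont X K \<Longrightarrow> scont X L \<Longrightarrow> scont X (\<lambda>x. K x - L x)"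
  using scont_add[of X K "\<lambda>x. - L x"] scont_minus[of X L] by simp

lemma scont_const: "scont X (\<lambda>x. K)"
  by (rule scontI[where k = "norm K"]) auto

lemma scont_reparam:
  assumes "scont X K" "continuous_on Y h" "\<And>y. y \<in> Y \<Longrightarrow> h y \<in> X"
  shows "scont Y (\<lambda>y. K (h y))"
proof -
  obtain k where k: "\<And>x. x \<in> X \<Longrightarrow> norm (K x) \<le> k" using scont_bound[OF assms(1)] by blast
  show ?thesis
  proof (rule scontI)
    show "continuous_on Y (\<lambda>y. K (h y) w)" for w
      by (rule continuous_on_compose2[OF scont_cont[OF assms(1)] assms(2)]) (use assms(3) in auto)
    show "norm (K (h y)) \<le> k" if "y \<in> Y" for y using k assms(3)[OF that] by blast
  qed
qed

lemma scont_subset: "scont X K \<Longrightarrow> Y \<subseteq> X \<Longrightarrow> scont Y K"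
  using scont_reparam[of X K Y id] by auto

lemma scont_reparam2:
  assumes "scont X (\<lambda>p. U (fst p) (snd p))" "continuous_on Y f" "continuous_on Y g"
    "\<And>y. y \<in> Y \<Longrightarrow> (f y, g y) \<in> X"
  shows "scont Y (\<lambda>y. U (f y) (g y))"
  using scont_reparam[OF assms(1) continuous_on_Pair[OF assms(2,3)]] assms(4) by simp

lemma scont_of_compact:
  fixes K :: "'x::topological_space \<Rightarrow> ('a::banach \<Rightarrow>\<^sub>L 'b::real_normed_vector)"
  assumes X: "compact X" and c: "\<And>w. continuous_on X (\<lambda>x. K x w)"
  shows "scont X K"
proof -
  have "\<exists>b. \<forall>x\<in>X. norm (K x w) \<le> b" for w
    using compact_imp_bounded[OF compact_continuous_image[OF c X]] by (auto simp: bounded_iff)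
  then show ?thesis using uniform_boundedness[of X K] c unfolding scont_def by blast
qed

lemma scont_uniform_limit:
  fixes F :: "nat \<Rightarrow> 'x::topological_space \<Rightarrow> ('a::real_normed_vector \<Rightarrow>\<^sub>L 'b::real_normed_vector)"
  assumes F: "\<And>n. scont X (F n)" and lim: "uniform_limit X F f sequentially"
  shows "scont X f"
proof -
  have "continuous_on X (\<lambda>x. f x w)" for w
  proof (rule uniform_limit_theorem)
    show "uniform_limit X (\<lambda>n x. F n x w) (\<lambda>x. f x w) sequentially"
      by (rule bounded_linear.uniform_limit[OF bounded_linear_apply_blinfun lim])
  qed (use scont_cont[OF F] in auto)
  moreover
  have "eventually (\<lambda>n. \<forall>x\<in>X. dist (F n x) (f x) < 1) sequentially"
    using lim by (rule uniform_limitD) simp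
  then obtain n where n: "\<And>x. x \<in> X \<Longrightarrow> dist (F n x) (f x) < 1"
    by (auto simp: eventually_sequentially)
  obtain k where k: "\<And>x. x \<in> X \<Longrightarrow> norm (F n x) \<le> k" using scont_bound[OF F[of n]] by blast
  have "norm (f x) \<le> k + 1" if "x \<in> X" for x
    using n[OF that] k[OF that] norm_triangle_ineq2[of "f x" "F n x"] by (simp add: dist_norm norm_minus_commute)
  ultimately show ?thesis by (intro scontI)
qed

lemma scont_integrable:
  fixes K :: "real \<Rightarrow> ('a::real_normed_vector \<Rightarrow>\<^sub>L 'b::banach)"
  assumes "scont {a..b} K" "continuous_on {a..b} v"
  shows "(\<lambda>r. K r (v r)) integrable_on {a..b}"
  by (intro integrable_continuous_real scont_apply assms)

lemma integral_norm_le_const: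
  fixes f :: "real \<Rightarrow> 'a::banach"
  assumes "continuous_on {a..b} f" "\<And>r. r \<in> {a..b} \<Longrightarrow> norm (f r) \<le> c" "a \<le> b"
  shows "norm (integral {a..b} f) \<le> c * (b - a)"
  using integral_bound[OF assms(3) assms(1)] assms(2) by blast

lemma integral_norm_le_exp:
  fixes f :: "real \<Rightarrow> 'a::banach"
  assumes f: "continuous_on {a..b} f" "\<And>r. r \<in> {a..b} \<Longrightarrow> norm (f r) \<le> c * exp (\<kappa> * r)"
    and ab: "a \<le> b" and l: "\<kappa> > 0" and c: "c \<ge> 0"
  shows "norm (integral {a..b} f) \<le> c / \<kappa> * exp (\<kappa> * b)"
proof -
  have "((\<lambda>r. c * exp (\<kappa> * r)) has_integral (c / \<kappa> * exp (\<kappa> * b) - c / \<kappa> * exp (\<kappa> * a))) {a..b}"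
    by (rule fundamental_theorem_of_calculus[OF ab])
      (use l in \<open>auto intro!: derivative_eq_intros
        simp: has_real_derivative_iff_has_vector_derivative[symmetric]\<close>)
  then have "norm (integral {a..b} f) \<le> c / \<kappa> * exp (\<kappa> * b) - c / \<kappa> * exp (\<kappa> * a)"
    by (metis integral_norm_bound_integral[OF integrable_continuous_real[OF f(1)] _ f(2)]
        has_integral_integrable integral_unique)
  also have "\<dots> \<le> c / \<kappa> * exp (\<kappa> * b)" using l c by simp
  finally show ?thesis .
qed

text \<open>Rescaling to the unit interval reduces moving endpoints to a fixed domain of integration.\<close>

lemma integral_continuous_moving:
  fixes f :: "'x::topological_space \<Rightarrow> real \<Rightarrow> 'b::banach"
  assumes a: "continuous_on X a" and b: "continuous_on X b" and ab: "\<And>x. x \<in> X \<Longrightarrow> a x \<le> b x"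
    and f: "continuous_on {(x, r). x \<in> X \<and> a x \<le> r \<and> r \<le> b x} (\<lambda>(x, r). f x r)"
  shows "continuous_on X (\<lambda>x. integral {a x..b x} (f x))"
proof -
  have *: "integral {a x..b x} (f x) = (b x - a x) *\<^sub>R integral (cbox 0 1) (\<lambda>s. f x (a x + s * (b x - a x)))"
    if x: "x \<in> X" for x
  proof (cases "a x = b x")
    case False
    then have m: "b x - a x > 0" using ab[OF x] by simp
    have "f x integrable_on {a x..b x}"
    proof (rule integrable_continuous_real)
      show "continuous_on {a x..b x} (f x)"
        using continuous_on_compose2[OF f continuous_on_Pair[OF continuous_on_const[of _ x] continuous_on_id],
            of "{a x..b x}"] x by (simp add: image_subset_iff)
    qed
    then have "(f x has_integral integral {a x..b x} (f x)) (cbox (a x) (b x))"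
      by (simp add: integrable_integral)
    from has_integral_affinity'[OF this m, of "a x"]
    have "((\<lambda>s. f x (a x + s * (b x - a x))) has_integral (integral {a x..b x} (f x) /\<^sub>R (b x - a x))) (cbox 0 1)"
      using m by (simp add: field_simps)
    then have "integral (cbox 0 1) (\<lambda>s. f x (a x + s * (b x - a x))) = integral {a x..b x} (f x) /\<^sub>R (b x - a x)"
      by (rule integral_unique)
    then show ?thesis using m by simp
  qed simp
  have seg: "a x + s * (b x - a x) \<le> b x" "a x \<le> a x + s * (b x - a x)" if "x \<in> X" "s \<in> cbox 0 1" for x s
  proof -
    have "s * (b x - a x) \<le> 1 * (b x - a x)" using that ab[of x] by (intro mult_right_mono) auto
    then show "a x + s * (b x - a x) \<le> b x" by simp
    show "a x \<le> a x + s * (b x - a x)" using that ab[of x] by simp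
  qed
  have "continuous_on X (\<lambda>x. integral (cbox 0 1) (\<lambda>s. f x (a x + s * (b x - a x))))"
  proof (rule integral_continuous_on_param)
    have ca: "continuous_on (X \<times> cbox 0 1) (\<lambda>p. a (fst p))" "continuous_on (X \<times> cbox 0 1) (\<lambda>p. b (fst p))"
      by (rule continuous_on_compose2[OF a] continuous_on_compose2[OF b]; auto intro!: continuous_intros)+
    have "continuous_on (X \<times> cbox 0 1) (\<lambda>p. (fst p, a (fst p) + snd p * (b (fst p) - a (fst p))))"
      by (intro continuous_intros ca)
    moreover have "(\<lambda>p. (fst p, a (fst p) + snd p * (b (fst p) - a (fst p)))) ` (X \<times> cbox 0 1)
        \<subseteq> {(x, r). x \<in> X \<and> a x \<le> r \<and> r \<le> b x}"
      using seg by force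
    ultimately show "continuous_on (X \<times> cbox 0 1) (\<lambda>(x, s). f x (a x + s * (b x - a x)))"
      using continuous_on_compose2[OF f, of "X \<times> cbox 0 1"
        "\<lambda>p. (fst p, a (fst p) + snd p * (b (fst p) - a (fst p)))"] by (simp add: case_prod_unfold)
  qed
  then have "continuous_on X (\<lambda>x. (b x - a x) *\<^sub>R integral (cbox 0 1) (\<lambda>s. f x (a x + s * (b x - a x))))"
    by (intro continuous_intros a b)
  then show ?thesis using * by (simp cong: continuous_on_cong)
qed

text \<open>The strong integral, taken vector by vector because \<open>K\<close> is in general discontinuous in the
  operator norm.\<close>

definition sint :: "real \<Rightarrow> real \<Rightarrow> (real \<Rightarrow> ('a::real_normed_vector \<Rightarrow>\<^sub>L 'b::banach)) \<Rightarrow> ('a \<Rightarrow>\<^sub>L 'b)" where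
  "sint a b K = Blinfun (\<lambda>w. integral {a..b} (\<lambda>r. K r w))"

lemma sint_apply:
  fixes K :: "real \<Rightarrow> ('a::real_normed_vector \<Rightarrow>\<^sub>L 'b::banach)"
  assumes K: "scont {a..b} K"
  shows "sint a b K w = integral {a..b} (\<lambda>r. K r w)"
proof -
  obtain k where k: "k \<ge> 0" "\<And>x. x \<in> {a..b} \<Longrightarrow> norm (K x) \<le> k" using scont_bound[OF K] by blast
  have i: "(\<lambda>r. K r w) integrable_on {a..b}" for w
    by (rule scont_integrable[OF K]) auto
  have "bounded_linear (\<lambda>w. integral {a..b} (\<lambda>r. K r w))"
  proof (rule bounded_linear_intro)
    show "integral {a..b} (\<lambda>r. K r (x + y)) = integral {a..b} (\<lambda>r. K r x) + integral {a..b} (\<lambda>r. K r y)" for x y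
      by (simp add: blinfun.add_right integral_add i)
    show "integral {a..b} (\<lambda>r. K r (c *\<^sub>R x)) = c *\<^sub>R integral {a..b} (\<lambda>r. K r x)" for c x
      by (simp add: blinfun.scaleR_right)
    show "norm (integral {a..b} (\<lambda>r. K r x)) \<le> norm x * (k * \<bar>b - a\<bar>)" for x
    proof (cases "a \<le> b")
      case True
      have "norm (integral {a..b} (\<lambda>r. K r x)) \<le> (k * norm x) * (b - a)"
        by (rule integral_norm_le_const[OF scont_cont[OF K] _ True])
          (meson k(2) mult_right_mono norm_blinfun norm_ge_zero order_trans)
      then show ?thesis using True by (simp add: mult_ac)
    qed (use k in simp)
  qed
  then show ?thesis unfolding sint_def by (simp add: bounded_linear_Blinfun_apply)
qed

lemma sint_norm_le_const:
  fixes K :: "real \<Rightarrow> ('a::real_normed_vector \<Rightarrow>\<^sub>L 'b::banach)"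
  assumes K: "scont {a..b} K" and k: "\<And>r. r \<in> {a..b} \<Longrightarrow> norm (K r) \<le> c" and ab: "a \<le> b"
  shows "norm (sint a b K) \<le> c * (b - a)"
proof (rule norm_blinfun_bound)
  have "0 \<le> c" using k[of a] ab norm_ge_zero[of "K a"] by (meson atLeastAtMost_iff order_refl order_trans)
  then show "0 \<le> c * (b - a)" using ab by simp
  show "norm (sint a b K w) \<le> c * (b - a) * norm w" for w
  proof -
    have "norm (integral {a..b} (\<lambda>r. K r w)) \<le> (c * norm w) * (b - a)"
      by (rule integral_norm_le_const[OF scont_cont[OF K] _ ab])
        (meson k mult_right_mono norm_blinfun norm_ge_zero order_trans)
    then show ?thesis by (simp add: sint_apply[OF K] mult_ac)
  qed
qed

lemma sint_norm_le_exp: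
  fixes K :: "real \<Rightarrow> ('a::real_normed_vector \<Rightarrow>\<^sub>L 'b::banach)"
  assumes K: "scont {a..b} K" and k: "\<And>r. r \<in> {a..b} \<Longrightarrow> norm (K r) \<le> c * exp (\<kappa> * r)"
    and ab: "a \<le> b" and l: "\<kappa> > 0" and c: "c \<ge> 0"
  shows "norm (sint a b K) \<le> c / \<kappa> * exp (\<kappa> * b)"
proof (rule norm_blinfun_bound)
  show "0 \<le> c / \<kappa> * exp (\<kappa> * b)" using l c by simp
  fix w
  have "norm (integral {a..b} (\<lambda>r. K r w)) \<le> (c * norm w) / \<kappa> * exp (\<kappa> * b)"
  proof (rule integral_norm_le_exp[OF scont_cont[OF K] _ ab l])
    show "norm (K r w) \<le> c * norm w * exp (\<kappa> * r)" if "r \<in> {a..b}" for r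
      using order_trans[OF norm_blinfun mult_right_mono[OF k[OF that] norm_ge_zero]]
      by (simp add: mult_ac)
  qed (use c in simp)
  then show "norm (sint a b K w) \<le> c / \<kappa> * exp (\<kappa> * b) * norm w"
    by (simp add: sint_apply[OF K] mult_ac)
qed

lemma sint_cong: "(\<And>r. r \<in> {a..b} \<Longrightarrow> K r = L r) \<Longrightarrow> sint a b K = sint a b L"
  unfolding sint_def by (metis (no_types, lifting) integral_cong)

lemma sint_diff:
  assumes "scont {a..b} K" "scont {a..b} L"
  shows "sint a b K - sint a b L = sint a b (\<lambda>r. K r - L r)"
proof (rule blinfun_eqI)
  fix w
  have "(\<lambda>r. K r w) integrable_on {a..b}" "(\<lambda>r. L r w) integrable_on {a..b}"
    using assms by (auto intro!: scont_integrable)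
  then show "(sint a b K - sint a b L) w = sint a b (\<lambda>r. K r - L r) w"
    by (simp add: blinfun.diff_left sint_apply assms scont_diff integral_diff)
qed

lemma sint_combine:
  assumes "a \<le> c" "c \<le> b" "scont {a..b} K"
  shows "sint a b K = sint a c K + sint c b K"
proof (rule blinfun_eqI)
  fix w
  have "(\<lambda>r. K r w) integrable_on {a..b}" using assms(3) by (auto intro!: scont_integrable)
  from Henstock_Kurzweil_Integration.integral_combine[OF assms(1,2) this]
  show "sint a b K w = (sint a c K + sint c b K) w"
    using assms by (simp add: blinfun.add_left sint_apply scont_subset[OF assms(3)])
qed

lemma sint_compose_left:
  fixes L :: "'b::banach \<Rightarrow>\<^sub>L 'c::banach"
  assumes "scont {a..b} K"
  shows "L o\<^sub>L sint a b K = sint a b (\<lambda>r. L o\<^sub>L K r)"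
proof (rule blinfun_eqI)
  fix w
  have "(\<lambda>r. K r w) integrable_on {a..b}" using assms by (auto intro!: scont_integrable)
  from integral_linear[OF this blinfun.bounded_linear_right[of L]]
  show "(L o\<^sub>L sint a b K) w = sint a b (\<lambda>r. L o\<^sub>L K r) w"
    by (simp add: sint_apply assms scont_compose scont_const o_def)
qed

lemma sint_compose_right:
  assumes "scont {a..b} K"
  shows "sint a b K o\<^sub>L L = sint a b (\<lambda>r. K r o\<^sub>L L)"
  by (rule blinfun_eqI) (simp add: sint_apply assms scont_compose scont_const)

lemma scont_sint:
  fixes K :: "'x::topological_space \<Rightarrow> real \<Rightarrow> ('a::real_normed_vector \<Rightarrow>\<^sub>L 'b::banach)"
  assumes a: "continuous_on X a" and b: "continuous_on X b" and ab: "\<And>x. x \<in> X \<Longrightarrow> a x \<le> b x"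
    and len: "\<And>x. x \<in> X \<Longrightarrow> b x - a x \<le> l"
    and K: "scont {(x, r). x \<in> X \<and> a x \<le> r \<and> r \<le> b x} (\<lambda>p. K (fst p) (snd p))"
  shows "scont X (\<lambda>x. sint (a x) (b x) (K x))"
proof -
  obtain k where k: "k \<ge> 0"
      "\<And>p. p \<in> {(x, r). x \<in> X \<and> a x \<le> r \<and> r \<le> b x} \<Longrightarrow> norm (K (fst p) (snd p)) \<le> k"
    using scont_bound[OF K] by blast
  have Kx: "scont {a x..b x} (K x)" if "x \<in> X" for x
    using scont_reparam2[OF K continuous_on_const continuous_on_id, of "{a x..b x}" x] that by auto
  show ?thesis
  proof (rule scontI)
    show "continuous_on X (\<lambda>x. sint (a x) (b x) (K x) w)" for w
      using integral_continuous_moving[OF a b ab, of "\<lambda>x r. K x r w"] scont_cont[OF K, of w]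
      by (simp add: sint_apply[OF Kx] case_prod_unfold cong: continuous_on_cong)
    show "norm (sint (a x) (b x) (K x)) \<le> k * l" if "x \<in> X" for x
    proof -
      have "norm (sint (a x) (b x) (K x)) \<le> k * (b x - a x)"
        by (rule sint_norm_le_const[OF Kx[OF that] _ ab[OF that]]) (use k(2)[of "(x, _)"] that in simp)
      also have "\<dots> \<le> k * l" using k(1) len[OF that] by (rule mult_left_mono[rotated])
      finally show ?thesis .
    qed
  qed
qed

lemma sint_inner:
  fixes K :: "real \<Rightarrow> ('a::real_normed_vector \<Rightarrow>\<^sub>L 'b::{real_inner,banach})"
  assumes "scont {a..b} K"
  shows "sint a b K w \<bullet> v = integral {a..b} (\<lambda>r. K r w \<bullet> v)"
proof -
  have "(\<lambda>r. K r w) integrable_on {a..b}" using assms by (auto intro!: scont_integrable)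
  from integral_linear[OF this bounded_linear_inner_left[of v]]
  show ?thesis by (simp add: sint_apply assms o_def)
qed

lemma sint_shift:
  fixes K :: "real \<Rightarrow> ('a::real_normed_vector \<Rightarrow>\<^sub>L 'b::banach)"
  assumes "scont {a+h..b+h} K"
  shows "sint a b (\<lambda>r. K (r + h)) = sint (a+h) (b+h) K"
proof (rule blinfun_eqI)
  fix w
  have s: "scont {a..b} (\<lambda>r. K (r + h))"
    by (rule scont_reparam[OF assms]) (auto intro!: continuous_intros)
  show "sint a b (\<lambda>r. K (r + h)) w = sint (a+h) (b+h) K w"
    using integral_shift_Icc_real[of a b "\<lambda>r. K r w" h]
    by (simp add: sint_apply s assms o_def add.commute)
qed

section \<open>Strongly continuous semigroups\<close>

lemma C0_semigroup_near_0:
  assumes T: "C0_semigroup T" and e: "e > 0"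
  shows "\<exists>d>0. \<forall>h. 0 \<le> h \<and> h < d \<longrightarrow> norm (T h x - x) < e"
proof -
  have "((\<lambda>t. T t x) \<longlongrightarrow> x) (at_right 0)" and T0: "T 0 x = x" using T by (auto simp: C0_semigroup_def)
  then have "eventually (\<lambda>t. dist (T t x) x < e) (at_right 0)" using e by (simp add: tendstoD)
  then obtain d where d: "d > 0" "\<And>t. 0 < t \<Longrightarrow> t < d \<Longrightarrow> dist (T t x) x < e"
    by (auto simp: eventually_at_right_field)
  have "norm (T h x - x) < e" if "0 \<le> h" "h < d" for h
    using d(2)[of h] T0 that e by (cases "h = 0") (auto simp: dist_norm)
  then show ?thesis using d(1) by blast
qed

text \<open>If the semigroup were unbounded near \<open>0\<close>, uniform boundedness would contradict convergence along
  a sequence of times tending to \<open>0\<close>.  Boundedness spreads to \<open>[0, \<tau>]\<close> by the semigroup law, and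
  then \<open>norm (T t x - T s x)\<close> is controlled by \<open>norm (T (t - s) x - x)\<close>.\<close>

lemma C0_semigroup_scont:
  fixes T :: "real \<Rightarrow> ('a::banach \<Rightarrow>\<^sub>L 'a)"
  assumes T: "C0_semigroup T"
  shows "scont {0..\<tau>} T"
proof -
  have T0: "T 0 = id_blinfun" and Tadd: "\<And>s t. s \<ge> 0 \<Longrightarrow> t \<ge> 0 \<Longrightarrow> T (t + s) = T t o\<^sub>L T s"
    using T by (auto simp: C0_semigroup_def)
  have "\<exists>\<delta>>0. \<exists>M. \<forall>t. 0 \<le> t \<and> t \<le> \<delta> \<longrightarrow> norm (T t) \<le> M"
  proof (rule ccontr)
    assume neg: "\<not> ?thesis"
    have "\<exists>t. 0 \<le> t \<and> t \<le> 1 / real (Suc n) \<and> norm (T t) > real n" for n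
    proof (rule ccontr)
      assume "\<not> (\<exists>t. 0 \<le> t \<and> t \<le> 1 / real (Suc n) \<and> norm (T t) > real n)"
      then have "\<forall>t. 0 \<le> t \<and> t \<le> 1 / real (Suc n) \<longrightarrow> norm (T t) \<le> real n" by (meson not_less)
      moreover have "1 / real (Suc n) > 0" by simp
      ultimately show False using neg by blast
    qed
    then obtain t where t: "\<And>n. 0 \<le> t n" "\<And>n. t n \<le> 1 / real (Suc n)" "\<And>n. norm (T (t n)) > real n"
      by metis
    have tl: "t \<longlonglongrightarrow> 0"
      by (rule tendsto_sandwich[OF _ _ tendsto_const lim_inverse_n'[THEN LIMSEQ_Suc]])
        (use t in \<open>auto intro!: eventuallyI\<close>)
    have "\<exists>b. \<forall>n\<in>UNIV. norm (T (t n) x) \<le> b" for x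
    proof -
      have "(\<lambda>n. T (t n) x) \<longlonglongrightarrow> x"
      proof (rule LIMSEQ_I)
        fix e :: real assume e: "e > 0"
        obtain d where d: "d > 0" "\<And>h. 0 \<le> h \<Longrightarrow> h < d \<Longrightarrow> norm (T h x - x) < e"
          using C0_semigroup_near_0[OF T e] by blast
        have "eventually (\<lambda>n. t n < d) sequentially" using order_tendstoD(2)[OF tl d(1)] .
        then show "\<exists>no. \<forall>n\<ge>no. norm (T (t n) x - x) < e"
          using d t(1) by (auto simp: eventually_sequentially)
      qed
      then have "Bseq (\<lambda>n. T (t n) x)" by (intro convergent_imp_Bseq convergentI)
      then show ?thesis by (auto simp: Bseq_def)
    qed
    then obtain b where "\<And>n. norm (T (t n)) \<le> b" using uniform_boundedness[of UNIV "\<lambda>n. T (t n)"] by auto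
    moreover obtain n where "b \<le> real n" using real_arch_simple by blast
    ultimately show False using t(3)[of n] by (meson less_le_trans not_less order_trans)
  qed
  then obtain \<delta> M0 where d: "\<delta> > 0" "\<And>t. 0 \<le> t \<Longrightarrow> t \<le> \<delta> \<Longrightarrow> norm (T t) \<le> M0" by blast
  define M where "M = max 1 M0"
  have M: "M \<ge> 1" "\<And>t. 0 \<le> t \<Longrightarrow> t \<le> \<delta> \<Longrightarrow> norm (T t) \<le> M"
    using d(2) by (auto simp: M_def intro: max.coboundedI2)
  have bn: "norm (T t) \<le> M ^ Suc n" if "0 \<le> t" "t \<le> real (Suc n) * \<delta>" for n t
    using that
  proof (induction n arbitrary: t)
    case 0 then show ?case using M(2)[of t] by simp
  next
    case (Suc n)
    show ?case
    proof (cases "t \<le> \<delta>")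
      case True
      have "norm (T t) \<le> M ^ 1" using M(2)[OF Suc.prems(1) True] by simp
      also have "\<dots> \<le> M ^ Suc (Suc n)" by (rule power_increasing) (use M in auto)
      finally show ?thesis .
    next
      case False
      have "T t = T \<delta> o\<^sub>L T (t - \<delta>)" using Tadd[of "t - \<delta>" \<delta>] False d(1) by simp
      then have "norm (T t) \<le> norm (T \<delta>) * norm (T (t - \<delta>))" by (simp add: norm_blinfun_compose)
      also have "\<dots> \<le> M * M ^ Suc n"
      proof (rule mult_mono)
        show "norm (T \<delta>) \<le> M" using M(2) d(1) by simp
        have "t - \<delta> \<le> real (Suc n) * \<delta>" using Suc.prems(2) by (simp add: algebra_simps)
        then show "norm (T (t - \<delta>)) \<le> M ^ Suc n" using Suc.IH[of "t - \<delta>"] False by simp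
      qed (use M in auto)
      finally show ?thesis by simp
    qed
  qed
  obtain n where n: "\<tau> / \<delta> \<le> real n" using real_arch_simple by blast
  define k where "k = M ^ Suc n"
  have kb: "norm (T t) \<le> k" if "t \<in> {0..\<tau>}" for t
  proof -
    have "\<tau> \<le> real n * \<delta>" using n d(1) by (simp add: field_simps)
    also have "\<dots> \<le> real (Suc n) * \<delta>" using d(1) by simp
    finally show ?thesis using bn[of t n] that unfolding k_def by auto
  qed
  have k0: "k > 0" unfolding k_def using M by simp
  show ?thesis
  proof (rule scontI[OF _ kb])
    fix x
    have diff: "norm (T t x - T s x) \<le> k * norm (T (t - s) x - x)" if "0 \<le> s" "s \<le> t" "t \<le> \<tau>" for s t
    proof -
      have "T t = T s o\<^sub>L T (t - s)" using Tadd[of "t - s" s] that by simp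
      then have "norm (T t x - T s x) = norm (T s (T (t - s) x - x))" by (simp add: blinfun.diff_right)
      also have "\<dots> \<le> norm (T s) * norm (T (t - s) x - x)" by (rule norm_blinfun)
      also have "\<dots> \<le> k * norm (T (t - s) x - x)" by (intro mult_right_mono kb) (use that in auto)
      finally show ?thesis .
    qed
    show "continuous_on {0..\<tau>} (\<lambda>t. T t x)"
      unfolding continuous_on_iff
    proof (intro ballI allI impI)
      fix t e :: real assume t: "t \<in> {0..\<tau>}" and e: "e > 0"
      obtain d where d: "d > 0" "\<And>h. 0 \<le> h \<Longrightarrow> h < d \<Longrightarrow> norm (T h x - x) < e / k"
        using C0_semigroup_near_0[OF T divide_pos_pos[OF e k0]] by blast
      have "dist (T s x) (T t x) < e" if s: "s \<in> {0..\<tau>}" "dist s t < d" for s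
      proof -
        have *: "norm (T (max s t) x - T (min s t) x) \<le> k * norm (T (max s t - min s t) x - x)"
          by (rule diff) (use s t in auto)
        have "norm (T (max s t - min s t) x - x) < e / k"
          by (rule d(2)) (use s in \<open>auto simp: dist_real_def\<close>)
        then have "k * norm (T (max s t - min s t) x - x) < e" using k0 by (simp add: field_simps)
        with * have "norm (T (max s t) x - T (min s t) x) < e" by linarith
        then show ?thesis by (auto simp: dist_norm max_def min_def norm_minus_commute split: if_splits)
      qed
      then show "\<exists>d>0. \<forall>s\<in>{0..\<tau>}. dist s t < d \<longrightarrow> dist (T s x) (T t x) < e" using d(1) by blast
    qed
  qed
qed

text \<open>Let \<open>J\<close> be the integral of \<open>T\<close> over \<open>[0, \<epsilon>]\<close>.  Then \<open>J T h - J\<close> is \<open>O(h)\<close> in norm, so the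
  adjoint semigroup is continuous at \<open>0\<close> on the range of \<open>J*\<close>.  A vector \<open>x\<close> orthogonal to all
  these ranges satisfies \<open>J x \<bullet> x = 0\<close> for every \<open>\<epsilon>\<close>, which forces \<open>x = 0\<close> as \<open>J x / \<epsilon>\<close> tends to
  \<open>x\<close>.\<close>

lemma C0_semigroup_adj:
  fixes T :: "real \<Rightarrow> ('a::{real_inner,banach} \<Rightarrow>\<^sub>L 'a)"
  assumes T: "C0_semigroup T"
  shows "C0_semigroup (\<lambda>t. adj (T t))"
proof -
  have T0: "T 0 = id_blinfun" and Tadd: "\<And>s t. s \<ge> 0 \<Longrightarrow> t \<ge> 0 \<Longrightarrow> T (t + s) = T t o\<^sub>L T s"
    using T by (auto simp: C0_semigroup_def)
  define Y where "Y = {x. ((\<lambda>t. adj (T t) x) \<longlongrightarrow> x) (at_right 0)}"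
  have sub: "subspace Y"
    unfolding subspace_def Y_def
    by (auto simp: blinfun.add_right blinfun.scaleR_right intro!: tendsto_intros)
  obtain M where M: "M \<ge> 0" "\<And>t. t \<in> {0..1} \<Longrightarrow> norm (T t) \<le> M"
    using scont_bound[OF C0_semigroup_scont[OF T, of 1]] by blast
  have ev1: "eventually (\<lambda>t. t \<in> {0..1}) (at_right (0::real))"
    unfolding eventually_at_right_field by (intro exI[of _ 1]) auto
  have clos: "closed Y"
    unfolding closed_sequential_limits
  proof (intro allI impI)
    fix y x assume y: "(\<forall>n. y n \<in> Y) \<and> y \<longlonglongrightarrow> x"
    have "((\<lambda>t. adj (T t) x) \<longlongrightarrow> x) (at_right 0)"
    proof (rule tendstoI)
      fix e :: real assume e: "e > 0"
      have "eventually (\<lambda>n. dist (y n) x < e / (2 * (M + 1))) sequentially"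
        using y e M(1) by (auto dest!: tendstoD[of y x sequentially "e / (2 * (M + 1))"])
      then obtain n where n: "dist (y n) x < e / (2 * (M + 1))" by (auto simp: eventually_sequentially)
      have "((\<lambda>t. adj (T t) (y n)) \<longlongrightarrow> y n) (at_right 0)" using y by (simp add: Y_def)
      then have "eventually (\<lambda>t. dist (adj (T t) (y n)) (y n) < e / 2) (at_right 0)"
        by (rule tendstoD) (use e in simp)
      with ev1 show "eventually (\<lambda>t. dist (adj (T t) x) x < e) (at_right 0)"
      proof eventually_elim
        case (elim t)
        have "adj (T t) x - x = adj (T t) (x - y n) + (adj (T t) (y n) - y n) + (y n - x)"
          by (simp add: blinfun.diff_right)
        then have "norm (adj (T t) x - x) \<le> norm (adj (T t) (x - y n)) + norm (adj (T t) (y n) - y n) + norm (y n - x)"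
          using norm_triangle_ineq[of "adj (T t) (x - y n) + (adj (T t) (y n) - y n)" "y n - x"]
            norm_triangle_ineq[of "adj (T t) (x - y n)" "adj (T t) (y n) - y n"] by simp
        moreover have "norm (adj (T t) (x - y n)) \<le> M * norm (y n - x)"
        proof -
          have "norm (adj (T t) (x - y n)) \<le> norm (adj (T t)) * norm (y n - x)"
            by (metis norm_blinfun norm_minus_commute)
          also have "\<dots> \<le> M * norm (y n - x)"
            by (intro mult_right_mono order_trans[OF norm_adj_le M(2)] elim norm_ge_zero)
          finally show ?thesis .
        qed
        moreover have "(M + 1) * norm (y n - x) < e / 2"
          using n M(1) by (simp add: dist_norm field_simps)
        ultimately show ?case using elim(2) by (simp add: dist_norm algebra_simps)
      qed
    qed
    then show "x \<in> Y" by (simp add: Y_def)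
  qed
  have avg: "adj (sint 0 \<epsilon> T) x \<in> Y" if eps: "\<epsilon> > 0" for \<epsilon> x
  proof -
    have sc: "scont {a..b} T" if "0 \<le> a" for a b
      by (rule scont_subset[OF C0_semigroup_scont[OF T, of b]]) (use that in auto)
    obtain k where k: "k \<ge> 0" "\<And>t. t \<in> {0..\<epsilon>+1} \<Longrightarrow> norm (T t) \<le> k"
      using scont_bound[OF C0_semigroup_scont[OF T, of "\<epsilon>+1"]] by blast
    define J where "J = sint 0 \<epsilon> T"
    have est: "norm ((J o\<^sub>L T h) - J) \<le> 2 * k * h" if h: "0 \<le> h" "h \<le> 1" for h
    proof -
      have "J o\<^sub>L T h = sint 0 \<epsilon> (\<lambda>r. T r o\<^sub>L T h)" unfolding J_def by (rule sint_compose_right[OF sc]) simp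
      also have "\<dots> = sint 0 \<epsilon> (\<lambda>r. T (r + h))" by (rule sint_cong) (use Tadd h in auto)
      also have "\<dots> = sint h (\<epsilon> + h) T" using sint_shift[of 0 h \<epsilon> T] sc[of h] h by simp
      finally have 1: "J o\<^sub>L T h = sint h (\<epsilon> + h) T" .
      have "sint 0 (\<epsilon>+h) T = sint 0 h T + sint h (\<epsilon>+h) T" "sint 0 (\<epsilon>+h) T = J + sint \<epsilon> (\<epsilon>+h) T"
        unfolding J_def by (rule sint_combine; use sc h eps in auto)+
      then have "(J o\<^sub>L T h) - J = sint \<epsilon> (\<epsilon>+h) T - sint 0 h T" unfolding 1 by (simp add: algebra_simps)
      moreover have "norm (sint \<epsilon> (\<epsilon>+h) T) \<le> k * (\<epsilon> + h - \<epsilon>)"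
        by (rule sint_norm_le_const) (use sc k eps h in auto)
      moreover have "norm (sint 0 h T) \<le> k * (h - 0)"
        by (rule sint_norm_le_const) (use sc k eps h in auto)
      ultimately show ?thesis using norm_triangle_ineq4[of "sint \<epsilon> (\<epsilon>+h) T" "sint 0 h T"] by simp
    qed
    have "((\<lambda>h. adj (T h) (adj J x) - adj J x) \<longlongrightarrow> 0) (at_right 0)"
    proof (rule Lim_null_comparison)
      show "eventually (\<lambda>h. norm (adj (T h) (adj J x) - adj J x) \<le> 2 * k * h * norm x) (at_right 0)"
        using ev1
      proof eventually_elim
        case (elim h)
        have "norm (adj (T h) (adj J x) - adj J x) = norm (adj ((J o\<^sub>L T h) - J) x)"
          by (simp add: adj_diff adj_compose blinfun.diff_left)
        also have "\<dots> \<le> norm ((J o\<^sub>L T h) - J) * norm x"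
          by (meson mult_right_mono norm_adj_le norm_blinfun norm_ge_zero order_trans)
        also have "\<dots> \<le> 2 * k * h * norm x" by (intro mult_right_mono est) (use elim in auto)
        finally show ?case .
      qed
      have "((\<lambda>h. 2 * k * h * norm x) \<longlongrightarrow> 2 * k * 0 * norm x) (at_right 0)" by (intro tendsto_intros)
      then show "((\<lambda>h. 2 * k * h * norm x) \<longlongrightarrow> 0) (at_right 0)" by simp
    qed
    then show ?thesis unfolding Y_def J_def by (simp add: LIM_zero_iff)
  qed
  have "Y = UNIV"
  proof (rule ccontr)
    assume "Y \<noteq> UNIV"
    then obtain x where x: "x \<noteq> 0" "\<And>y. y \<in> Y \<Longrightarrow> x \<bullet> y = 0"
      using closed_subspace_orthogonal[OF clos sub] by blast
    obtain d where d: "d > 0" "\<And>h. 0 \<le> h \<Longrightarrow> h < d \<Longrightarrow> norm (T h x - x) < norm x / 2"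
      using C0_semigroup_near_0[OF T half_gt_zero[of "norm x"]] x(1) by (metis zero_less_norm_iff)
    define \<epsilon> where "\<epsilon> = d / 2"
    have eps: "\<epsilon> > 0" "\<epsilon> < d" using d(1) by (auto simp: \<epsilon>_def)
    have low: "(norm x)\<^sup>2 / 2 \<le> T h x \<bullet> x" if "h \<in> {0..\<epsilon>}" for h
    proof -
      have "\<bar>(T h x - x) \<bullet> x\<bar> \<le> norm (T h x - x) * norm x" by (rule Cauchy_Schwarz_ineq2)
      also have "\<dots> \<le> norm x / 2 * norm x"
        by (intro mult_right_mono less_imp_le[OF d(2)]) (use that eps in auto)
      finally have "\<bar>T h x \<bullet> x - (norm x)\<^sup>2\<bar> \<le> (norm x)\<^sup>2 / 2"
        by (simp add: inner_diff_left power2_norm_eq_inner power2_eq_square norm_eq_sqrt_inner)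
      then show ?thesis by linarith
    qed
    have sc: "scont {0..\<epsilon>} T" by (rule C0_semigroup_scont[OF T])
    have "\<epsilon> * ((norm x)\<^sup>2 / 2) = integral {0..\<epsilon>} (\<lambda>h. (norm x)\<^sup>2 / 2)" using eps by simp
    also have "\<dots> \<le> integral {0..\<epsilon>} (\<lambda>h. T h x \<bullet> x)"
      by (rule integral_le[OF _ integrable_continuous_real low])
        (auto intro!: continuous_intros scont_cont[OF sc])
    also have "\<dots> = sint 0 \<epsilon> T x \<bullet> x" by (simp add: sint_inner sc)
    also have "\<dots> = 0" using x(2)[OF avg[OF eps(1)]] by (simp add: adj_inner)
    finally have "\<epsilon> * (norm x)\<^sup>2 \<le> 0" by simp
    then show False using eps x(1) by (simp add: mult_le_0_iff)
  qed
  then have "((\<lambda>t. adj (T t) x) \<longlongrightarrow> x) (at_right 0)" for x by (auto simp: Y_def)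
  moreover have "adj (T (t + s)) = adj (T t) o\<^sub>L adj (T s)" if "s \<ge> 0" "t \<ge> 0" for s t
    using Tadd[OF that(2,1)] by (simp add: add.commute adj_compose)
  ultimately show ?thesis by (simp add: C0_semigroup_def T0 adj_id)
qed

section \<open>Evolution operators and their bounded perturbations\<close>

definition tri :: "real \<Rightarrow> (real \<times> real) set" where
  "tri tf = {(t, s). 0 \<le> s \<and> s \<le> t \<and> t \<le> tf}"

lemma mem_tri [simp]: "(t, s) \<in> tri tf \<longleftrightarrow> 0 \<le> s \<and> s \<le> t \<and> t \<le> tf"
  by (simp add: tri_def)

abbreviation joint_scont ::
    "real \<Rightarrow> (real \<Rightarrow> real \<Rightarrow> ('a::real_normed_vector \<Rightarrow>\<^sub>L 'b::real_normed_vector)) \<Rightarrow> bool" where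
  "joint_scont tf U \<equiv> scont (tri tf) (\<lambda>p. U (fst p) (snd p))"

lemma compact_tri: "compact (tri tf)"
proof -
  have "tri tf = (({0..tf} \<times> {0..tf}) \<inter> {p. snd p \<le> fst p})" by (auto simp: tri_def)
  moreover have "closed {p :: real \<times> real. snd p \<le> fst p}"
    by (intro closed_Collect_le continuous_intros)
  ultimately show ?thesis by (metis compact_Int_closed compact_Times compact_Icc)
qed

text \<open>The joint strong continuity in both times is what makes every integrand below continuous.\<close>

definition evol :: "real \<Rightarrow> (real \<Rightarrow> real \<Rightarrow> ('a::real_normed_vector \<Rightarrow>\<^sub>L 'a)) \<Rightarrow> bool" where
  "evol tf U \<longleftrightarrow> (\<forall>t\<in>{0..tf}. U t t = id_blinfun) \<and>
     (\<forall>s r t. 0 \<le> s \<and> s \<le> r \<and> r \<le> t \<and> t \<le> tf \<longrightarrow> U t r o\<^sub>L U r s = U t s) \<and>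
     joint_scont tf U"

lemma evolD:
  assumes "evol tf U"
  shows "\<And>t. 0 \<le> t \<Longrightarrow> t \<le> tf \<Longrightarrow> U t t = id_blinfun"
    and "\<And>s r t. 0 \<le> s \<Longrightarrow> s \<le> r \<Longrightarrow> r \<le> t \<Longrightarrow> t \<le> tf \<Longrightarrow> U t r o\<^sub>L U r s = U t s"
    and "joint_scont tf U"
  using assms by (auto simp: evol_def)

lemma evol_apply:
  assumes "evol tf U" "0 \<le> s" "s \<le> r" "r \<le> t" "t \<le> tf"
  shows "U t r (U r s w) = U t s w"
  using evolD(2)[OF assms] by (metis blinfun_apply_blinfun_compose)

lemma scont_tri:
  assumes "joint_scont tf U" "continuous_on Y f" "continuous_on Y g"
    "\<And>y. y \<in> Y \<Longrightarrow> 0 \<le> g y \<and> g y \<le> f y \<and> f y \<le> tf"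
  shows "scont Y (\<lambda>y. U (f y) (g y))"
  by (rule scont_reparam2[OF assms(1-3)]) (simp add: assms(4))

lemma evol_evolution_operator:
  assumes U: "evol tf U"
  shows "evolution_operator tf U"
proof -
  note sc = scont_tri[OF evolD(3)[OF U]]
  have "strongly_continuous_on {s..tf} (\<lambda>t. U t s)" if "s \<in> {0..tf}" for s
    unfolding strongly_continuous_on_def
    by (intro allI scont_cont sc) (use that in \<open>auto intro!: continuous_intros\<close>)
  moreover have "strongly_continuous_on {0..t} (\<lambda>s. U t s)" if "t \<in> {0..tf}" for t
    unfolding strongly_continuous_on_def
    by (intro allI scont_cont sc) (use that in \<open>auto intro!: continuous_intros\<close>)
  ultimately show ?thesis using U unfolding evol_def evolution_operator_def by blast
qed

lemma evol_semigroup: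
  fixes T :: "real \<Rightarrow> ('a::banach \<Rightarrow>\<^sub>L 'a)"
  assumes T: "C0_semigroup T"
  shows "evol tf (\<lambda>t s. T (t - s))"
proof -
  have T0: "T 0 = id_blinfun" and Tadd: "\<And>s t. s \<ge> 0 \<Longrightarrow> t \<ge> 0 \<Longrightarrow> T (t + s) = T t o\<^sub>L T s"
    using T by (auto simp: C0_semigroup_def)
  have "T (t - r) o\<^sub>L T (r - s) = T (t - s)" if "s \<le> r" "r \<le> t" for s r t
    using Tadd[of "r - s" "t - r"] that by simp
  moreover have "scont (tri tf) (\<lambda>p. T (fst p - snd p))"
    by (rule scont_reparam[OF C0_semigroup_scont[OF T, of tf]])
      (auto simp: tri_def intro!: continuous_intros)
  ultimately show ?thesis by (simp add: evol_def T0)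
qed

lemma scont_section_kernel:
  assumes "joint_scont tf E" "scont {0..tf} D"
    "joint_scont tf V" "0 \<le> s" "t \<le> tf"
  shows "scont {s..t} (\<lambda>r. E t r o\<^sub>L D r o\<^sub>L V r s)"
  by (intro scont_compose scont_tri[OF assms(1)] scont_tri[OF assms(3)] scont_subset[OF assms(2)])
    (use assms(4,5) in \<open>auto intro!: continuous_intros\<close>)

lemma sint_refl: "sint a a K = 0"
  by (rule blinfun_eqI) (simp add: sint_def bounded_linear_Blinfun_apply)

lemma norm_compose3_le:
  fixes A :: "'b::real_normed_vector \<Rightarrow>\<^sub>L 'c::real_normed_vector" and D :: "'d::real_normed_vector \<Rightarrow>\<^sub>L 'b"
    and V :: "'a::real_normed_vector \<Rightarrow>\<^sub>L 'd"
  assumes "norm A \<le> a" "norm D \<le> d" "norm V \<le> v"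
  shows "norm (A o\<^sub>L D o\<^sub>L V) \<le> a * d * v"
proof -
  have nn: "0 \<le> a" "0 \<le> d" "0 \<le> v" using assms norm_ge_zero order_trans by blast+
  have "norm (A o\<^sub>L D) \<le> a * d"
    by (rule order_trans[OF norm_blinfun_compose]) (use nn assms in \<open>auto intro!: mult_mono\<close>)
  then show ?thesis
    by (intro order_trans[OF norm_blinfun_compose]) (use nn assms in \<open>auto intro!: mult_mono\<close>)
qed

text \<open>In the weighted norm the Volterra integral contributes at most half of what it is fed as soon as
  \<open>\<kappa> \<ge> 2 M d\<close>.  A priori bounds, uniqueness and Lipschitz dependence are instances with
  different inhomogeneities \<open>Y\<close>.\<close>

lemma volterra_bound:
  fixes E :: "real \<Rightarrow> real \<Rightarrow> ('a::banach \<Rightarrow>\<^sub>L 'a)" and X Y :: "real \<Rightarrow> ('b::real_normed_vector \<Rightarrow>\<^sub>L 'a)"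
  assumes E: "joint_scont tf E" and D: "scont {0..tf} D" and X: "scont {s..tf} X"
    and M: "M \<ge> 0" "\<And>s t. 0 \<le> s \<Longrightarrow> s \<le> t \<Longrightarrow> t \<le> tf \<Longrightarrow> norm (E t s) \<le> M"
    and d: "d \<ge> 0" "\<And>r. 0 \<le> r \<Longrightarrow> r \<le> tf \<Longrightarrow> norm (D r) \<le> d"
    and eq: "\<And>t. s \<le> t \<Longrightarrow> t \<le> tf \<Longrightarrow> X t = Y t + sint s t (\<lambda>r. E t r o\<^sub>L D r o\<^sub>L X r)"
    and Y: "b \<ge> 0" "\<And>t. s \<le> t \<Longrightarrow> t \<le> tf \<Longrightarrow> norm (Y t) \<le> b * exp (\<kappa> * t)"
    and \<kappa>: "\<kappa> > 0" "2 * M * d \<le> \<kappa>" and s: "0 \<le> s" "s \<le> t" "t \<le> tf"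
  shows "norm (X t) \<le> 2 * b * exp (\<kappa> * t)"
proof -
  obtain B where B: "B \<ge> 0" "\<And>r. r \<in> {s..tf} \<Longrightarrow> norm (X r) \<le> B" using scont_bound[OF X] by blast
  show ?thesis
  proof (rule weighted_bound[where I = "{s..tf}" and f = "\<lambda>t. norm (X t)" and \<omega> = "\<lambda>t. exp (\<kappa> * t)"
        and i = t and b = B])
    show "norm (X r) \<le> B * exp (\<kappa> * r)" if r: "r \<in> {s..tf}" for r
    proof -
      have "B * 1 \<le> B * exp (\<kappa> * r)" by (rule mult_left_mono) (use B \<kappa> r s in auto)
      then show ?thesis using B(2)[OF r] by simp
    qed
    fix c r assume c: "0 \<le> c" and h: "\<And>q. q \<in> {s..tf} \<Longrightarrow> norm (X q) \<le> c * exp (\<kappa> * q)"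
      and r: "r \<in> {s..tf}"
    have sc: "scont {s..r} (\<lambda>q. E r q o\<^sub>L D q o\<^sub>L X q)"
      by (intro scont_compose scont_tri[OF E] scont_subset[OF D] scont_subset[OF X])
        (use s r in \<open>auto intro!: continuous_intros\<close>)
    have "norm (sint s r (\<lambda>q. E r q o\<^sub>L D q o\<^sub>L X q)) \<le> M * d * c / \<kappa> * exp (\<kappa> * r)"
    proof (rule sint_norm_le_exp[OF sc _ _ \<kappa>(1)])
      fix q assume q: "q \<in> {s..r}"
      have "norm (E r q o\<^sub>L D q o\<^sub>L X q) \<le> M * d * (c * exp (\<kappa> * q))"
        by (rule norm_compose3_le) (use M d h q r s in auto)
      then show "norm (E r q o\<^sub>L D q o\<^sub>L X q) \<le> M * d * c * exp (\<kappa> * q)" by (simp add: mult_ac)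
    qed (use M d c r in auto)
    moreover have "M * d * c / \<kappa> * exp (\<kappa> * r) \<le> c / 2 * exp (\<kappa> * r)"
    proof (rule mult_right_mono)
      have "2 * M * d * c \<le> \<kappa> * c" by (rule mult_right_mono[OF \<kappa>(2) c])
      then show "M * d * c / \<kappa> \<le> c / 2" using \<kappa>(1) by (simp add: field_simps)
    qed simp
    moreover have "norm (Y r) \<le> b * exp (\<kappa> * r)" using Y(2) r by simp
    ultimately have "norm (Y r + sint s r (\<lambda>q. E r q o\<^sub>L D q o\<^sub>L X q)) \<le> b * exp (\<kappa> * r) + c / 2 * exp (\<kappa> * r)"
      by (meson norm_triangle_mono order_trans)
    then show "norm (X r) \<le> (b + c / 2) * exp (\<kappa> * r)" using eq[of r] r by (simp add: distrib_right)
  qed (use Y s in auto)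
qed

lemma volterra_zero:
  fixes E :: "real \<Rightarrow> real \<Rightarrow> ('a::banach \<Rightarrow>\<^sub>L 'a)" and X :: "real \<Rightarrow> ('b::real_normed_vector \<Rightarrow>\<^sub>L 'a)"
  assumes E: "joint_scont tf E" and D: "scont {0..tf} D" and X: "scont {s..tf} X"
    and s: "0 \<le> s" "s \<le> t" "t \<le> tf"
    and eq: "\<And>t. s \<le> t \<Longrightarrow> t \<le> tf \<Longrightarrow> X t = sint s t (\<lambda>r. E t r o\<^sub>L D r o\<^sub>L X r)"
  shows "X t = 0"
proof -
  obtain M where M: "M \<ge> 0" "\<And>p. p \<in> tri tf \<Longrightarrow> norm (E (fst p) (snd p)) \<le> M" using scont_bound[OF E] by blast
  obtain d where d: "d \<ge> 0" "\<And>r. r \<in> {0..tf} \<Longrightarrow> norm (D r) \<le> d" using scont_bound[OF D] by blast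
  have Mts: "norm (E t s) \<le> M" if "0 \<le> s" "s \<le> t" "t \<le> tf" for s t using M(2)[of "(t, s)"] that by simp
  have "norm (X t) \<le> 2 * 0 * exp ((2 * M * d + 1) * t)"
    by (rule volterra_bound[where Y = "\<lambda>_. 0", OF E D X M(1) Mts d(1) _ _ _ _ _ _ s])
      (use M(1) d eq[symmetric] in \<open>auto simp: add_nonneg_pos\<close>)
  then show ?thesis by simp
qed

definition perturbed ::
    "real \<Rightarrow> (real \<Rightarrow> real \<Rightarrow> ('a::banach \<Rightarrow>\<^sub>L 'a)) \<Rightarrow> (real \<Rightarrow> ('a \<Rightarrow>\<^sub>L 'a)) \<Rightarrow> (real \<Rightarrow> real \<Rightarrow> ('a \<Rightarrow>\<^sub>L 'a)) \<Rightarrow> bool" where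
  "perturbed tf E D V \<longleftrightarrow> (\<forall>s t. 0 \<le> s \<and> s \<le> t \<and> t \<le> tf \<longrightarrow>
     V t s = E t s + sint s t (\<lambda>r. E t r o\<^sub>L D r o\<^sub>L V r s))"

lemma perturbedD:
  "perturbed tf E D V \<Longrightarrow> 0 \<le> s \<Longrightarrow> s \<le> t \<Longrightarrow> t \<le> tf \<Longrightarrow>
    V t s = E t s + sint s t (\<lambda>r. E t r o\<^sub>L D r o\<^sub>L V r s)"
  by (simp add: perturbed_def)

text \<open>For a fixed initial time both sides of the composition law solve the same Volterra equation
  in the final time, so they agree.\<close>

lemma evol_perturbation:
  fixes E :: "real \<Rightarrow> real \<Rightarrow> ('a::banach \<Rightarrow>\<^sub>L 'a)"
  assumes E: "evol tf E" and D: "scont {0..tf} D"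
  shows "\<exists>V. evol tf V \<and> perturbed tf E D V"
proof -
  note scE = evolD(3)[OF E]
  obtain M where M: "M \<ge> 0" "\<And>p. p \<in> tri tf \<Longrightarrow> norm (E (fst p) (snd p)) \<le> M" using scont_bound[OF scE] by blast
  obtain d where d: "d \<ge> 0" "\<And>r. r \<in> {0..tf} \<Longrightarrow> norm (D r) \<le> d" using scont_bound[OF D] by blast
  \<comment> \<open>Bounds for \<open>U\<close> and \<open>P\<close> that do not depend on the trajectory.\<close>
  define k where "k = 2 * M * d + 1"
  have k: "k > 0" using M d unfolding k_def by (simp add: add_nonneg_pos)
  define \<Phi> where "\<Phi> V p = E (fst p) (snd p)
      + sint (snd p) (fst p) (\<lambda>r. E (fst p) r o\<^sub>L D r o\<^sub>L V (r, snd p))" for V :: "real \<times> real \<Rightarrow> ('a \<Rightarrow>\<^sub>L 'a)" and p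
  have ker: "scont {s..t} (\<lambda>r. E t r o\<^sub>L D r o\<^sub>L V (r, s))" if "scont (tri tf) V" "0 \<le> s" "t \<le> tf" for V s t
    using scont_section_kernel[OF scE D, of "\<lambda>t s. V (t, s)" s t] that by simp
  have "\<exists>V\<in>{V. scont (tri tf) V}. \<forall>p\<in>tri tf. \<Phi> V p = V p"
  proof (rule weighted_fixed_point[where \<omega> = "\<lambda>p. exp (k * fst p)" and \<Omega> = "exp (k * tf)"])
    show "exp (k * fst p) \<le> exp (k * tf)" if "p \<in> tri tf" for p using that k by (auto simp: tri_def)
    show "(\<lambda>_. 0) \<in> {V. scont (tri tf) V}" by (simp add: scont_const)
    show "\<Phi> V \<in> {V. scont (tri tf) V}" if "V \<in> {V. scont (tri tf) V}" for V
    proof -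
      have V: "scont (tri tf) (\<lambda>p. V (fst p, snd p))" using that by simp
      have "scont (tri tf) (\<lambda>p. sint (snd p) (fst p) (\<lambda>r. E (fst p) r o\<^sub>L D r o\<^sub>L V (r, snd p)))"
      proof (rule scont_sint[where l = tf])
        let ?X = "{(x, r). x \<in> tri tf \<and> snd x \<le> r \<and> r \<le> fst x}"
        have "scont ?X (\<lambda>y. E (fst (fst y)) (snd y))"
          by (rule scont_tri[OF scE]) (auto intro!: continuous_intros)
        moreover have "scont ?X (\<lambda>y. D (snd y))"
          by (rule scont_reparam[OF D]) (auto intro!: continuous_intros)
        moreover have "scont ?X (\<lambda>y. V (snd y, snd (fst y)))"
          by (rule scont_tri[of tf "\<lambda>t s. V (t, s)", OF V]) (auto intro!: continuous_intros)
        ultimately show "scont ?X (\<lambda>y. E (fst (fst y)) (snd y) o\<^sub>L D (snd y) o\<^sub>L V (snd y, snd (fst y)))"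
          by (intro scont_compose)
      qed (auto intro!: continuous_intros)
      then show ?thesis unfolding \<Phi>_def by (auto intro!: scont_add scE)
    qed
    show "\<exists>b. \<forall>p\<in>tri tf. norm (V p - V' p) \<le> b * exp (k * fst p)"
      if VV: "V \<in> {V. scont (tri tf) V}" "V' \<in> {V. scont (tri tf) V}" for V V'
    proof -
      have "scont (tri tf) (\<lambda>p. V p - V' p)" using VV by (simp add: scont_diff)
      from scont_bound[OF this] obtain b where b: "b \<ge> 0" "\<And>p. p \<in> tri tf \<Longrightarrow> norm (V p - V' p) \<le> b" by blast
      have "norm (V p - V' p) \<le> b * exp (k * fst p)" if p: "p \<in> tri tf" for p
      proof -
        have "b * 1 \<le> b * exp (k * fst p)" by (rule mult_left_mono) (use p k b in \<open>auto simp: tri_def\<close>)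
        then show ?thesis using b(2)[OF p] by simp
      qed
      then show ?thesis by blast
    qed
    show "norm (\<Phi> V p - \<Phi> V' p) \<le> c / 2 * exp (k * fst p)"
      if V: "V \<in> {V. scont (tri tf) V}" "V' \<in> {V. scont (tri tf) V}" and c: "0 \<le> c"
        and h: "\<And>i. i \<in> tri tf \<Longrightarrow> norm (V i - V' i) \<le> c * exp (k * fst i)" and p: "p \<in> tri tf" for V V' c p
    proof -
      obtain t s where pt: "p = (t, s)" by force
      have ts: "0 \<le> s" "s \<le> t" "t \<le> tf" using p by (auto simp: pt)
      have sc: "scont {s..t} (\<lambda>r. E t r o\<^sub>L D r o\<^sub>L V (r, s))" "scont {s..t} (\<lambda>r. E t r o\<^sub>L D r o\<^sub>L V' (r, s))"
        using V ts by (auto intro!: ker)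
      have "\<Phi> V p - \<Phi> V' p = sint s t (\<lambda>r. (E t r o\<^sub>L D r o\<^sub>L V (r, s)) - (E t r o\<^sub>L D r o\<^sub>L V' (r, s)))"
        by (simp add: \<Phi>_def pt sint_diff[OF sc])
      also have "norm \<dots> \<le> M * d * c / k * exp (k * t)"
      proof (rule sint_norm_le_exp[OF scont_diff[OF sc] _ ts(2) k])
        fix r assume r: "r \<in> {s..t}"
        have "norm (E t r o\<^sub>L D r o\<^sub>L (V (r, s) - V' (r, s))) \<le> M * d * (c * exp (k * r))"
          by (rule norm_compose3_le) (use M(2)[of "(t, r)"] d h[of "(r, s)"] r ts in auto)
        then show "norm ((E t r o\<^sub>L D r o\<^sub>L V (r, s)) - (E t r o\<^sub>L D r o\<^sub>L V' (r, s))) \<le> M * d * c * exp (k * r)"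
          by (simp add: bounded_bilinear.diff_right[OF bounded_bilinear_blinfun_compose] mult_ac)
      qed (use M d c in auto)
      also have "\<dots> \<le> c / 2 * exp (k * t)"
        by (rule mult_right_mono) (use c M d k in \<open>auto simp: k_def field_simps\<close>)
      finally show ?thesis by (simp add: pt)
    qed
    show "f \<in> {V. scont (tri tf) V}"
      if "\<And>n. F n \<in> {V. scont (tri tf) V}" "uniform_limit (tri tf) F f sequentially" for F f
      using scont_uniform_limit[of "tri tf" F f] that by simp
  qed auto
  then obtain V0 where V0: "scont (tri tf) V0" "\<And>p. p \<in> tri tf \<Longrightarrow> \<Phi> V0 p = V0 p" by blast
  define V where "V t s = V0 (t, s)" for t s
  have scV: "joint_scont tf V" using V0(1) by (simp add: V_def)
  have eq: "V t s = E t s + sint s t (\<lambda>r. E t r o\<^sub>L D r o\<^sub>L V r s)" if "0 \<le> s" "s \<le> t" "t \<le> tf" for s t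
    using V0(2)[of "(t, s)"] that by (simp add: V_def \<Phi>_def)
  note kerV = scont_section_kernel[OF scE D scV]
  have diag: "V t t = id_blinfun" if "0 \<le> t" "t \<le> tf" for t
    using eq[of t t] evolD(1)[OF E that] that by (simp add: sint_refl)
  have comp: "V t r o\<^sub>L V r s = V t s" if tsr: "0 \<le> s" "s \<le> r" "r \<le> t" "t \<le> tf" for s r t
  proof -
    define X where "X t = (V t r o\<^sub>L V r s) - V t s" for t
    have "X t = 0"
    proof (rule volterra_zero[OF scE D, of r])
      show "scont {r..tf} X" unfolding X_def
        by (intro scont_diff scont_compose scont_const scont_tri[OF scV]) (use tsr in \<open>auto intro!: continuous_intros\<close>)
      show "X t = sint r t (\<lambda>q. E t q o\<^sub>L D q o\<^sub>L X q)" if t: "r \<le> t" "t \<le> tf" for t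
      proof -
        have k1: "scont {r..t} (\<lambda>q. E t q o\<^sub>L D q o\<^sub>L V q r)" and k2: "scont {s..t} (\<lambda>q. E t q o\<^sub>L D q o\<^sub>L V q s)"
          and k3: "scont {s..r} (\<lambda>q. E r q o\<^sub>L D q o\<^sub>L V q s)"
          using t tsr by (auto intro!: kerV)
        have "V t r o\<^sub>L V r s = (E t r o\<^sub>L V r s) + (sint r t (\<lambda>q. E t q o\<^sub>L D q o\<^sub>L V q r) o\<^sub>L V r s)"
          using eq[of r t] t tsr by (simp add: bounded_bilinear.add_left[OF bounded_bilinear_blinfun_compose])
        also have "E t r o\<^sub>L V r s = (E t r o\<^sub>L E r s) + (E t r o\<^sub>L sint s r (\<lambda>q. E r q o\<^sub>L D q o\<^sub>L V q s))"
          using eq[of s r] t tsr by (simp add: bounded_bilinear.add_right[OF bounded_bilinear_blinfun_compose])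
        also have "E t r o\<^sub>L E r s = E t s" using evolD(2)[OF E] t tsr by simp
        also have "E t r o\<^sub>L sint s r (\<lambda>q. E r q o\<^sub>L D q o\<^sub>L V q s) = sint s r (\<lambda>q. E t q o\<^sub>L D q o\<^sub>L V q s)"
          unfolding sint_compose_left[OF k3]
          by (rule sint_cong) (use t tsr in \<open>auto intro!: blinfun_eqI simp: evol_apply[OF E]\<close>)
        finally have 1: "V t r o\<^sub>L V r s = E t s + sint s r (\<lambda>q. E t q o\<^sub>L D q o\<^sub>L V q s)
            + (sint r t (\<lambda>q. E t q o\<^sub>L D q o\<^sub>L V q r) o\<^sub>L V r s)" .
        have 2: "V t s = E t s + (sint s r (\<lambda>q. E t q o\<^sub>L D q o\<^sub>L V q s) + sint r t (\<lambda>q. E t q o\<^sub>L D q o\<^sub>L V q s))"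
          using eq[of s t] sint_combine[OF tsr(2) t(1) k2] t tsr by simp
        have "X t = (sint r t (\<lambda>q. E t q o\<^sub>L D q o\<^sub>L V q r) o\<^sub>L V r s) - sint r t (\<lambda>q. E t q o\<^sub>L D q o\<^sub>L V q s)"
          unfolding X_def 1 2 by simp
        also have "\<dots> = sint r t (\<lambda>q. (E t q o\<^sub>L D q o\<^sub>L V q r o\<^sub>L V r s) - (E t q o\<^sub>L D q o\<^sub>L V q s))"
          unfolding sint_compose_right[OF k1]
          by (rule sint_diff) (use k1 scont_subset[OF k2] tsr in \<open>auto intro!: scont_compose scont_const\<close>)
        also have "\<dots> = sint r t (\<lambda>q. E t q o\<^sub>L D q o\<^sub>L X q)"
          by (rule sint_cong) (auto intro!: blinfun_eqI simp: X_def blinfun.diff_left blinfun.diff_right)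
        finally show ?thesis .
      qed
    qed (use tsr in auto)
    then show ?thesis by (simp add: X_def)
  qed
  have "evol tf V" unfolding evol_def using diag comp scV by auto
  then show ?thesis using eq unfolding perturbed_def by blast
qed

lemma small_near_diagonal:
  fixes g :: "real \<times> real \<Rightarrow> 'b::real_normed_vector"
  assumes g: "continuous_on (tri tf) g" and diag: "\<And>s. 0 \<le> s \<Longrightarrow> s \<le> tf \<Longrightarrow> g (s, s) = 0" and e: "e > 0"
  shows "\<exists>d>0. \<forall>t s. 0 \<le> s \<and> s \<le> t \<and> t \<le> tf \<and> t - s < d \<longrightarrow> norm (g (t, s)) < e"
proof -
  have "uniformly_continuous_on (tri tf) g" by (rule compact_uniformly_continuous[OF g compact_tri])
  then obtain d where d: "d > 0" "\<And>x x'. x \<in> tri tf \<Longrightarrow> x' \<in> tri tf \<Longrightarrow> dist x' x < d \<Longrightarrow> dist (g x') (g x) < e"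
    using e unfolding uniformly_continuous_on_def by metis
  have "norm (g (t, s)) < e" if "0 \<le> s" "s \<le> t" "t \<le> tf" "t - s < d" for t s
    using d(2)[of "(s, s)" "(t, s)"] that diag[of s] by (simp add: dist_Pair_Pair dist_real_def)
  then show ?thesis using d(1) by blast
qed

text \<open>Over a time step the two families differ in norm by at most \<open>c\<close> times its length.  Hence the
  perturbed adjoint is, up to an arbitrarily small error, a fixed vector propagated by the
  adjoint of \<open>E\<close>.  An integral equation for the adjoint family would be of no use, since it
  contains the adjoints of the perturbing operators, which may be discontinuous.\<close>

lemma scont_adj_perturbation:
  fixes E V :: "real \<Rightarrow> real \<Rightarrow> ('a::{real_inner,banach} \<Rightarrow>\<^sub>L 'a)"
  assumes E1: "\<And>t. 0 \<le> t \<Longrightarrow> t \<le> tf \<Longrightarrow> E t t = id_blinfun"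
    and E: "joint_scont tf (\<lambda>t s. adj (E t s))"
    and V: "evol tf V" and c: "c \<ge> 0"
    and diff: "\<And>s t. 0 \<le> s \<Longrightarrow> s \<le> t \<Longrightarrow> t \<le> tf \<Longrightarrow> norm (V t s - E t s) \<le> c * (t - s)"
  shows "joint_scont tf (\<lambda>t s. adj (V t s))"
proof -
  obtain k where k: "k \<ge> 0" "\<And>p. p \<in> tri tf \<Longrightarrow> norm (V (fst p) (snd p)) \<le> k"
    using scont_bound[OF evolD(3)[OF V]] by blast
  define A where "A t s = adj (V t s)" for t s
  have Ak: "norm (A t s x) \<le> k * norm x" if "0 \<le> s" "s \<le> t" "t \<le> tf" for t s x
  proof -
    have "norm (A t s) \<le> k" unfolding A_def using norm_adj_le k(2)[of "(t, s)"] that order_trans by fastforce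
    then show ?thesis by (meson mult_right_mono norm_blinfun norm_ge_zero order_trans)
  qed
  have Acomp: "A t s x = A r s (A t r x)" if "0 \<le> s" "s \<le> r" "r \<le> t" "t \<le> tf" for s r t x
    unfolding A_def evolD(2)[OF V that, symmetric] by (simp add: adj_compose)
  have Adiff: "norm (A t s x - adj (E t s) x) \<le> c * (t - s) * norm x" if "0 \<le> s" "s \<le> t" "t \<le> tf" for t s x
  proof -
    have "norm (A t s x - adj (E t s) x) = norm (adj (V t s - E t s) x)"
      by (simp add: A_def adj_diff blinfun.diff_left)
    also have "\<dots> \<le> norm (V t s - E t s) * norm x"
      by (meson mult_right_mono norm_adj_le norm_blinfun norm_ge_zero order_trans)
    also have "\<dots> \<le> c * (t - s) * norm x" by (intro mult_right_mono diff that norm_ge_zero)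
    finally show ?thesis .
  qed
  have A1: "A t t x = x" if "0 \<le> t" "t \<le> tf" for t x
    unfolding A_def using evolD(1)[OF V that] by (simp add: adj_id)
  \<comment> \<open>Continuity at the diagonal is uniform, hence gives continuity in \<open>t\<close> uniformly in \<open>s\<close>
    through \<open>A t s = A t0 s A t t0\<close>; continuity in \<open>s\<close> away from the diagonal is \<open>cont_s\<close>.\<close>
  have near: "\<exists>d>0. \<forall>t s. 0 \<le> s \<and> s \<le> t \<and> t \<le> tf \<and> t - s < d \<longrightarrow> norm (A t s w - w) < e" if e: "e > 0" for e w
  proof -
    have "\<exists>d>0. \<forall>t s. 0 \<le> s \<and> s \<le> t \<and> t \<le> tf \<and> t - s < d \<longrightarrow> norm (adj (E (fst (t, s)) (snd (t, s))) w - w) < e / 2"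
      by (rule small_near_diagonal[where g = "\<lambda>p. adj (E (fst p) (snd p)) w - w"])
        (use e E1 in \<open>auto intro!: continuous_intros scont_cont[OF E] simp: adj_id\<close>)
    then obtain d where d: "d > 0" "\<And>t s. 0 \<le> s \<Longrightarrow> s \<le> t \<Longrightarrow> t \<le> tf \<Longrightarrow> t - s < d \<Longrightarrow> norm (adj (E t s) w - w) < e / 2"
      by auto
    define b where "b = c * norm w + 1"
    have b: "b > 0" using c by (simp add: b_def add_nonneg_pos)
    have "norm (A t s w - w) < e" if ts: "0 \<le> s" "s \<le> t" "t \<le> tf" "t - s < min d (e / (2 * b))" for t s
    proof -
      have "norm (A t s w - adj (E t s) w) \<le> (t - s) * (c * norm w)" using Adiff[OF ts(1-3), of w] by (simp add: mult_ac)
      also have "\<dots> \<le> (t - s) * b" using ts by (intro mult_left_mono) (auto simp: b_def)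
      also have "\<dots> < e / 2" using ts b by (simp add: field_simps)
      finally show ?thesis using d(2)[OF ts(1-3)] ts(4)
        norm_triangle_ineq[of "A t s w - adj (E t s) w" "adj (E t s) w - w"] by simp
    qed
    then show ?thesis using d(1) e b by (intro exI[of _ "min d (e / (2 * b))"]) auto
  qed
  have cont_s: "\<exists>d>0. \<forall>s. 0 \<le> s \<and> s \<le> t \<and> \<bar>s - s0\<bar> < d \<longrightarrow> norm (A t s w - A t s0 w) < e"
    if t: "0 \<le> s0" "s0 < t" "t \<le> tf" and e: "e > 0" for t s0 w e
  proof -
    define b where "b = c * (k * norm w) + 1"
    have b: "b > 0" using c k by (simp add: b_def add_nonneg_pos)
    define h where "h = min (t - s0) (e / (8 * b))"
    have h: "h > 0" "s0 + h \<le> t" "8 * (b * h) \<le> e" using t e b by (auto simp: h_def min_def field_simps)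
    define q where "q = s0 + h"
    define v where "v = A t q w"
    have v: "norm v \<le> k * norm w" unfolding v_def by (rule Ak) (use t h in \<open>auto simp: q_def\<close>)
    have app: "norm (A t s w - adj (E q s) v) < e / 3" if s: "0 \<le> s" "s \<le> q" "q - s < 2 * h" for s
    proof -
      have "norm (A t s w - adj (E q s) v) = norm (A q s v - adj (E q s) v)"
        unfolding v_def using Acomp[of s q t w] s h t by (simp add: q_def)
      also have "\<dots> \<le> c * (q - s) * norm v" by (rule Adiff) (use s h t in \<open>auto simp: q_def\<close>)
      also have "\<dots> \<le> c * (q - s) * (k * norm w)" by (rule mult_left_mono[OF v]) (use s c in auto)
      also have "\<dots> = (q - s) * (c * (k * norm w))" by (simp add: mult_ac)
      also have "\<dots> \<le> (2 * h) * b"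
        using s c k by (intro mult_mono) (auto simp: b_def)
      also have "\<dots> < e / 3" using h e by (simp add: mult_ac)
      finally show ?thesis .
    qed
    have "continuous_on {0..q} (\<lambda>s. adj (E q s) v)"
      by (rule scont_cont[OF scont_tri[OF E]]) (use h t in \<open>auto simp: q_def intro!: continuous_intros\<close>)
    then obtain d where d: "d > 0" "\<And>s. s \<in> {0..q} \<Longrightarrow> dist s s0 < d \<Longrightarrow> dist (adj (E q s) v) (adj (E q s0) v) < e / 3"
      unfolding continuous_on_iff using e t h
      by (metis atLeastAtMost_iff divide_pos_pos less_add_same_cancel1 less_imp_le q_def zero_less_numeral)
    have "norm (A t s w - A t s0 w) < e" if s: "0 \<le> s" "s \<le> t" "\<bar>s - s0\<bar> < min d h" for s
    proof -
      have "s \<le> q" "q - s < 2 * h" using s by (auto simp: q_def)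
      from app[OF s(1) this] have "norm (A t s w - adj (E q s) v) < e / 3" .
      moreover have "norm (A t s0 w - adj (E q s0) v) < e / 3" by (rule app) (use t h in \<open>auto simp: q_def\<close>)
      moreover have "norm (adj (E q s) v - adj (E q s0) v) < e / 3"
        using d(2)[of s] s \<open>s \<le> q\<close> by (simp add: dist_norm)
      moreover have "norm (A t s w - A t s0 w) = norm ((A t s w - adj (E q s) v)
          + (adj (E q s) v - adj (E q s0) v) - (A t s0 w - adj (E q s0) v))" by simp
      ultimately show ?thesis
        using norm_triangle_ineq4[of "(A t s w - adj (E q s) v) + (adj (E q s) v - adj (E q s0) v)" "A t s0 w - adj (E q s0) v"]
          norm_triangle_ineq[of "A t s w - adj (E q s) v" "adj (E q s) v - adj (E q s0) v"] by linarith
    qed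
    then show ?thesis using d(1) h(1) by (intro exI[of _ "min d h"]) auto
  qed
  show ?thesis
  proof (rule scontI[where k = k])
    show "norm (adj (V (fst p) (snd p))) \<le> k" if "p \<in> tri tf" for p
      using norm_adj_le k(2)[OF that] order_trans by blast
    fix w
    show "continuous_on (tri tf) (\<lambda>p. adj (V (fst p) (snd p)) w)"
      unfolding continuous_on_iff A_def[symmetric]
    proof (intro ballI allI impI)
      fix p e assume p: "p \<in> tri tf" and e: "(e::real) > 0"
      obtain t0 s0 where p0: "p = (t0, s0)" by force
      have ts0: "0 \<le> s0" "s0 \<le> t0" "t0 \<le> tf" using p by (auto simp: p0)
      have dd: "\<bar>t - t0\<bar> < d" "\<bar>s - s0\<bar> < d" if "dist (t, s) p < d" for t s d
        using that dist_fst_le[of "(t,s)" p] dist_snd_le[of "(t,s)" p] by (auto simp: p0 dist_real_def)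
      obtain d1 where d1: "d1 > 0" "\<And>t s. 0 \<le> s \<Longrightarrow> s \<le> t \<Longrightarrow> t \<le> tf \<Longrightarrow> t - s < d1 \<Longrightarrow> norm (A t s w - w) < e / (2 * (k + 1))"
        using near[of "e / (2 * (k + 1))" w] e k by (metis add_nonneg_pos divide_pos_pos mult_pos_pos zero_less_numeral zero_less_one)
      have small: "k * norm (A t s w - w) < e / 2" "norm (A t s w - w) < e"
        if "0 \<le> s" "s \<le> t" "t \<le> tf" "t - s < d1" for t s
      proof -
        have "(k + 1) * norm (A t s w - w) < e / 2" using d1(2)[OF that] k by (simp add: field_simps)
        then have "k * norm (A t s w - w) + norm (A t s w - w) < e / 2" by (simp add: distrib_right)
        then show "k * norm (A t s w - w) < e / 2" "norm (A t s w - w) < e"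
          using e mult_nonneg_nonneg[OF k(1) norm_ge_zero[of "A t s w - w"]]
            norm_ge_zero[of "A t s w - w"] by linarith+
      qed
      show "\<exists>d>0. \<forall>q\<in>tri tf. dist q p < d \<longrightarrow> dist (A (fst q) (snd q) w) (A (fst p) (snd p) w) < e"
      proof (cases "s0 = t0")
        case True
        have "dist (A (fst q) (snd q) w) (A (fst p) (snd p) w) < e" if q: "q \<in> tri tf" "dist q p < d1 / 2" for q
        proof -
          obtain t s where qq: "q = (t, s)" by force
          have "\<bar>t - t0\<bar> < d1 / 2" "\<bar>s - t0\<bar> < d1 / 2" using q dd[of t s "d1 / 2"] True by (simp_all add: qq)
          then have "t - s < d1" unfolding abs_less_iff by linarith
          then have "norm (A t s w - w) < e" by (intro small(2)) (use q in \<open>auto simp: qq\<close>)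
          then show ?thesis using True A1[of t0 w] ts0 by (simp add: qq p0 dist_norm)
        qed
        then show ?thesis using d1(1) by (intro exI[of _ "d1 / 2"]) auto
      next
        case False
        then have lt: "s0 < t0" using ts0 by simp
        obtain d2 where d2: "d2 > 0" "\<And>s. 0 \<le> s \<Longrightarrow> s \<le> t0 \<Longrightarrow> \<bar>s - s0\<bar> < d2 \<Longrightarrow> norm (A t0 s w - A t0 s0 w) < e / 2"
          using cont_s[OF ts0(1) lt ts0(3), of "e / 2" w] e by (metis half_gt_zero)
        define d where "d = min d1 (min d2 (t0 - s0))"
        have "dist (A (fst q) (snd q) w) (A (fst p) (snd p) w) < e" if q: "q \<in> tri tf" "dist q p < d" for q
        proof -
          obtain t s where qq: "q = (t, s)" by force
          have ts: "0 \<le> s" "s \<le> t" "t \<le> tf" using q by (auto simp: qq)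
          have cl: "\<bar>t - t0\<bar> < d1" "\<bar>s - s0\<bar> < d2" "s \<le> t0"
            using dd[of t s d] q by (auto simp: qq d_def)
          have "norm (A t s w - A t0 s w) < e / 2"
          proof (cases "t0 \<le> t")
            case True
            have "norm (A t s w - A t0 s w) = norm (A t0 s (A t t0 w - w))"
              using Acomp[of s t0 t w] ts cl True by (simp add: blinfun.diff_right)
            also have "\<dots> \<le> k * norm (A t t0 w - w)" by (rule Ak) (use ts cl ts0 in auto)
            also have "\<dots> < e / 2" by (rule small(1)) (use ts ts0 True cl in auto)
            finally show ?thesis .
          next
            case F: False
            have "norm (A t s w - A t0 s w) = norm (A t s (A t0 t w - w))"
              using Acomp[of s t t0 w] ts cl F ts0 by (simp add: blinfun.diff_right norm_minus_commute)
            also have "\<dots> \<le> k * norm (A t0 t w - w)" by (rule Ak) (use ts cl ts0 in auto)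
            also have "\<dots> < e / 2" by (rule small(1)) (use ts ts0 F cl in auto)
            finally show ?thesis .
          qed
          moreover have "norm (A t0 s w - A t0 s0 w) < e / 2" by (rule d2(2)) (use ts cl in auto)
          ultimately show ?thesis
            using norm_triangle_ineq[of "A t s w - A t0 s w" "A t0 s w - A t0 s0 w"] by (simp add: qq p0 dist_norm)
        qed
        then show ?thesis using d1(1) d2(1) lt by (intro exI[of _ d]) (auto simp: d_def)
      qed
    qed
  qed
qed

lemma scont_adj_semigroup:
  fixes T :: "real \<Rightarrow> ('a::{real_inner,banach} \<Rightarrow>\<^sub>L 'a)"
  assumes T: "C0_semigroup T"
  shows "scont (tri tf) (\<lambda>p. adj (T (fst p - snd p)))"
  using evolD(3)[OF evol_semigroup[OF C0_semigroup_adj[OF T]]] .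

lemma perturbation_bound:
  fixes E V :: "real \<Rightarrow> real \<Rightarrow> ('a::banach \<Rightarrow>\<^sub>L 'a)"
  assumes E: "joint_scont tf E" and D: "scont {0..tf} D" and V: "joint_scont tf V"
    and M: "M \<ge> 0" "\<And>s t. 0 \<le> s \<Longrightarrow> s \<le> t \<Longrightarrow> t \<le> tf \<Longrightarrow> norm (E t s) \<le> M"
    and d: "d \<ge> 0" "\<And>r. 0 \<le> r \<Longrightarrow> r \<le> tf \<Longrightarrow> norm (D r) \<le> d"
    and eq: "perturbed tf E D V"
    and s: "0 \<le> s" "s \<le> t" "t \<le> tf"
  shows "norm (V t s) \<le> 2 * M * exp ((2 * M * d + 1) * tf)"
proof -
  let ?k = "2 * M * d + 1"
  have k: "?k > 0" using M(1) d(1) by (simp add: add_nonneg_pos)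
  have "norm (V t s) \<le> 2 * M * exp (?k * t)"
  proof (rule volterra_bound[where X = "\<lambda>r. V r s" and Y = "\<lambda>r. E r s", OF E D _ M d _ M(1) _ k _ s])
    show "scont {s..tf} (\<lambda>r. V r s)"
      by (rule scont_tri[OF V]) (use s in \<open>auto intro!: continuous_intros\<close>)
    show "norm (E r s) \<le> M * exp (?k * r)" if "s \<le> r" "r \<le> tf" for r
    proof -
      have "M * 1 \<le> M * exp (?k * r)" by (rule mult_left_mono) (use M(1) k that s in auto)
      then show ?thesis using M(2)[of s r] that s by simp
    qed
  qed (use perturbedD[OF eq s(1)] s in auto)
  also have "\<dots> \<le> 2 * M * exp (?k * tf)" using M(1) s k by (intro mult_left_mono) auto
  finally show ?thesis .
qed

lemma perturbation_close:
  fixes E V :: "real \<Rightarrow> real \<Rightarrow> ('a::banach \<Rightarrow>\<^sub>L 'a)"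
  assumes E: "joint_scont tf E" and D: "scont {0..tf} D"
    and V: "joint_scont tf V"
    and eq: "perturbed tf E D V"
  shows "\<exists>c\<ge>0. \<forall>s t. 0 \<le> s \<and> s \<le> t \<and> t \<le> tf \<longrightarrow> norm (V t s - E t s) \<le> c * (t - s)"
proof -
  obtain M where M: "M \<ge> 0" "\<And>p. p \<in> tri tf \<Longrightarrow> norm (E (fst p) (snd p)) \<le> M" using scont_bound[OF E] by blast
  obtain d where d: "d \<ge> 0" "\<And>r. r \<in> {0..tf} \<Longrightarrow> norm (D r) \<le> d" using scont_bound[OF D] by blast
  obtain B where B: "B \<ge> 0" "\<And>p. p \<in> tri tf \<Longrightarrow> norm (V (fst p) (snd p)) \<le> B" using scont_bound[OF V] by blast
  have "norm (V t s - E t s) \<le> M * d * B * (t - s)" if ts: "0 \<le> s" "s \<le> t" "t \<le> tf" for s t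
  proof -
    have "norm (sint s t (\<lambda>r. E t r o\<^sub>L D r o\<^sub>L V r s)) \<le> M * d * B * (t - s)"
    proof (rule sint_norm_le_const[OF scont_section_kernel[OF E D V ts(1,3)] _ ts(2)])
      show "norm (E t r o\<^sub>L D r o\<^sub>L V r s) \<le> M * d * B" if "r \<in> {s..t}" for r
        by (rule norm_compose3_le) (use M(2)[of "(t, r)"] d B(2)[of "(r, s)"] that ts in auto)
    qed
    then show ?thesis using perturbedD[OF eq ts] by simp
  qed
  then show ?thesis using M d B by (intro exI[of _ "M * d * B"]) auto
qed

text \<open>The factor \<open>1 / \<kappa>\<close> turns Lipschitz dependence into a contraction for large \<open>\<kappa>\<close>.\<close>

lemma perturbation_lipschitz:
  fixes E V V' :: "real \<Rightarrow> real \<Rightarrow> ('a::banach \<Rightarrow>\<^sub>L 'a)"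
  assumes E: "joint_scont tf E"
    and D: "scont {0..tf} D" "scont {0..tf} D'"
    and V: "joint_scont tf V" "joint_scont tf V'"
    and M: "M \<ge> 0" "\<And>s t. 0 \<le> s \<Longrightarrow> s \<le> t \<Longrightarrow> t \<le> tf \<Longrightarrow> norm (E t s) \<le> M"
    and d: "d \<ge> 0" "\<And>r. 0 \<le> r \<Longrightarrow> r \<le> tf \<Longrightarrow> norm (D' r) \<le> d"
    and K: "K \<ge> 0" "\<And>s t. 0 \<le> s \<Longrightarrow> s \<le> t \<Longrightarrow> t \<le> tf \<Longrightarrow> norm (V t s) \<le> K"
    and eq: "perturbed tf E D V"
    and eq': "perturbed tf E D' V'"
    and c: "c \<ge> 0" "\<And>r. 0 \<le> r \<Longrightarrow> r \<le> tf \<Longrightarrow> norm (D r - D' r) \<le> c * exp (\<kappa> * r)"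
    and kap: "\<kappa> > 0" "2 * M * d \<le> \<kappa>"
    and s: "0 \<le> s" "s \<le> t" "t \<le> tf"
  shows "norm (V t s - V' t s) \<le> 2 * (M * K * c / \<kappa>) * exp (\<kappa> * t)"
proof -
  have k: "scont {s..t} (\<lambda>q. E t q o\<^sub>L (D q - D' q) o\<^sub>L V q s)" "scont {s..t} (\<lambda>q. E t q o\<^sub>L D' q o\<^sub>L (V q s - V' q s))"
    if "s \<le> t" "t \<le> tf" for t
    using s that by (auto intro!: scont_section_kernel[OF E scont_diff[OF D] V(1)]
        scont_section_kernel[OF E D(2) scont_diff[OF V], simplified])
  have ker: "scont {s..t} (\<lambda>q. E t q o\<^sub>L D q o\<^sub>L V q s)" "scont {s..t} (\<lambda>q. E t q o\<^sub>L D' q o\<^sub>L V' q s)"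
    if "s \<le> t" "t \<le> tf" for t
    using s that by (auto intro!: scont_section_kernel[OF E D(1) V(1)] scont_section_kernel[OF E D(2) V(2)])
  show ?thesis
  proof (rule volterra_bound[where X = "\<lambda>r. V r s - V' r s" and Y = "\<lambda>t. sint s t (\<lambda>q. E t q o\<^sub>L (D q - D' q) o\<^sub>L V q s)",
        OF E D(2) _ M d _ _ _ kap s])
    show "scont {s..tf} (\<lambda>r. V r s - V' r s)"
      by (intro scont_diff scont_tri[OF V(1)] scont_tri[OF V(2)]) (use s in \<open>auto intro!: continuous_intros\<close>)
    fix r assume r: "s \<le> r" "r \<le> tf"
    have "V r s - V' r s = sint s r (\<lambda>q. (E r q o\<^sub>L D q o\<^sub>L V q s) - (E r q o\<^sub>L D' q o\<^sub>L V' q s))"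
      using r s by (simp add: perturbedD[OF eq, of s r] perturbedD[OF eq', of s r] sint_diff[OF ker[OF r]])
    also have "\<dots> = sint s r (\<lambda>q. (E r q o\<^sub>L (D q - D' q) o\<^sub>L V q s) - - (E r q o\<^sub>L D' q o\<^sub>L (V q s - V' q s)))"
      by (rule sint_cong, rule blinfun_eqI) (simp add: blinfun.diff_left blinfun.diff_right blinfun.add_left)
    also have "\<dots> = sint s r (\<lambda>q. E r q o\<^sub>L (D q - D' q) o\<^sub>L V q s) - sint s r (\<lambda>q. - (E r q o\<^sub>L D' q o\<^sub>L (V q s - V' q s)))"
      by (rule sint_diff[symmetric]) (intro k scont_minus r)+
    also have "sint s r (\<lambda>q. - (E r q o\<^sub>L D' q o\<^sub>L (V q s - V' q s))) = - sint s r (\<lambda>q. E r q o\<^sub>L D' q o\<^sub>L (V q s - V' q s))"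
      by (rule blinfun_eqI) (simp add: sint_apply[OF k(2)[OF r]] sint_apply[OF scont_minus[OF k(2)[OF r]]] blinfun.minus_left)
    finally show "V r s - V' r s = sint s r (\<lambda>q. E r q o\<^sub>L (D q - D' q) o\<^sub>L V q s)
        + sint s r (\<lambda>q. E r q o\<^sub>L D' q o\<^sub>L (V q s - V' q s))" by simp
    show "norm (sint s r (\<lambda>q. E r q o\<^sub>L (D q - D' q) o\<^sub>L V q s)) \<le> M * K * c / \<kappa> * exp (\<kappa> * r)"
    proof (rule sint_norm_le_exp[OF k(1)[OF r] _ r(1) kap(1)])
      fix q assume q: "q \<in> {s..r}"
      have "norm (E r q o\<^sub>L (D q - D' q) o\<^sub>L V q s) \<le> M * (c * exp (\<kappa> * q)) * K"
        by (rule norm_compose3_le) (use M c K q r s in auto)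
      then show "norm (E r q o\<^sub>L (D q - D' q) o\<^sub>L V q s) \<le> M * K * c * exp (\<kappa> * q)" by (simp add: mult_ac)
    qed (use M K c in auto)
  qed (use M K c kap in auto)
qed

section \<open>The Riccati equation\<close>

text \<open>This lemma and the next say that \<open>\<phi>' = q\<close> and \<open>\<phi>' = - l \<phi> + (l \<phi> + q)\<close> have the same
  integrated form, the second solved by the damping factor \<open>exp (- l t)\<close>.\<close>

lemma exp_weight_remove:
  fixes \<phi> q :: "real \<Rightarrow> 'b::banach"
  assumes phi: "continuous_on {0..t} \<phi>" and q: "continuous_on {0..t} q" and t: "0 \<le> t"
    and eq: "\<And>s. s \<in> {0..t} \<Longrightarrow>
      \<phi> s = exp (- l * s) *\<^sub>R (\<phi>0 + integral {0..s} (\<lambda>r. exp (l * r) *\<^sub>R (l *\<^sub>R \<phi> r + q r)))"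
  shows "\<phi> t = \<phi>0 + integral {0..t} q"
proof -
  let ?h = "\<lambda>r. exp (l * r) *\<^sub>R (l *\<^sub>R \<phi> r + q r)"
  let ?\<psi> = "\<lambda>s. \<phi>0 + integral {0..s} ?h"
  have h: "continuous_on {0..t} ?h" by (intro continuous_intros phi q)
  have "((\<lambda>s. exp (- l * s) *\<^sub>R ?\<psi> s) has_vector_derivative q s) (at s within {0..t})" if s: "s \<in> {0..t}" for s
  proof -
    have 1: "(?\<psi> has_vector_derivative (0 + ?h s)) (at s within {0..t})"
      by (intro has_vector_derivative_add has_vector_derivative_const integral_has_vector_derivative h s)
    have 2: "((\<lambda>s. exp (- l * s)) has_field_derivative (exp (- l * s) * (- l))) (at s within {0..t})"
      by (auto intro!: derivative_eq_intros)
    have "((\<lambda>s. exp (- l * s) *\<^sub>R ?\<psi> s) has_vector_derivative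
        (exp (- l * s) *\<^sub>R (0 + ?h s) + (exp (- l * s) * (- l)) *\<^sub>R ?\<psi> s)) (at s within {0..t})"
      by (rule has_vector_derivative_scaleR[OF 2 1])
    also have "exp (- l * s) *\<^sub>R (0 + ?h s) + (exp (- l * s) * (- l)) *\<^sub>R ?\<psi> s
        = (exp (- l * s) * exp (l * s)) *\<^sub>R (l *\<^sub>R \<phi> s + q s) - l *\<^sub>R (exp (- l * s) *\<^sub>R ?\<psi> s)"
      by (simp add: mult.commute)
    also have "\<dots> = q s" using eq[OF s] by (simp add: exp_minus)
    finally show ?thesis .
  qed
  from fundamental_theorem_of_calculus[OF t this]
  have "(q has_integral (exp (- l * t) *\<^sub>R ?\<psi> t - exp (- l * 0) *\<^sub>R ?\<psi> 0)) {0..t}" .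
  then have "integral {0..t} q = \<phi> t - \<phi>0" using eq[of t] t by (simp add: integral_unique)
  then show ?thesis by simp
qed

lemma exp_weight_insert:
  fixes \<phi> q :: "real \<Rightarrow> 'b::banach"
  assumes q: "continuous_on {0..t} q" and t: "0 \<le> t"
    and eq: "\<And>s. s \<in> {0..t} \<Longrightarrow> \<phi> s = \<phi>0 + integral {0..s} q"
  shows "\<phi> t = exp (- l * t) *\<^sub>R (\<phi>0 + integral {0..t} (\<lambda>r. exp (l * r) *\<^sub>R (l *\<^sub>R \<phi> r + q r)))"
proof -
  let ?\<psi> = "\<lambda>s. \<phi>0 + integral {0..s} q"
  have "((\<lambda>s. exp (l * s) *\<^sub>R ?\<psi> s) has_vector_derivative (exp (l * s) *\<^sub>R (l *\<^sub>R \<phi> s + q s))) (at s within {0..t})"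
    if s: "s \<in> {0..t}" for s
  proof -
    have 1: "(?\<psi> has_vector_derivative (0 + q s)) (at s within {0..t})"
      by (intro has_vector_derivative_add has_vector_derivative_const integral_has_vector_derivative q s)
    have 2: "((\<lambda>s. exp (l * s)) has_field_derivative (exp (l * s) * l)) (at s within {0..t})"
      by (auto intro!: derivative_eq_intros)
    have "((\<lambda>s. exp (l * s) *\<^sub>R ?\<psi> s) has_vector_derivative
        (exp (l * s) *\<^sub>R (0 + q s) + (exp (l * s) * l) *\<^sub>R ?\<psi> s)) (at s within {0..t})"
      by (rule has_vector_derivative_scaleR[OF 2 1])
    moreover have "exp (l * s) *\<^sub>R (0 + q s) + (exp (l * s) * l) *\<^sub>R ?\<psi> s
        = exp (l * s) *\<^sub>R (l *\<^sub>R \<phi> s + q s)"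
      using eq[OF s] by (simp add: scaleR_add_right)
    ultimately show ?thesis by simp
  qed
  from fundamental_theorem_of_calculus[OF t this]
  have "integral {0..t} (\<lambda>r. exp (l * r) *\<^sub>R (l *\<^sub>R \<phi> r + q r)) = exp (l * t) *\<^sub>R \<phi> t - \<phi>0"
    using eq[of t] t by (simp add: integral_unique)
  then show ?thesis by (simp add: exp_minus)
qed

abbreviation conj_by :: "('a::{real_inner,banach} \<Rightarrow>\<^sub>L 'a) \<Rightarrow> ('a \<Rightarrow>\<^sub>L 'a) \<Rightarrow> ('a \<Rightarrow>\<^sub>L 'a)" where
  "conj_by A Q \<equiv> A o\<^sub>L Q o\<^sub>L adj A"

abbreviation riccati_term ::
    "(real \<Rightarrow> ('a::real_normed_vector \<Rightarrow>\<^sub>L 'a)) \<Rightarrow> (real \<Rightarrow> ('a \<Rightarrow>\<^sub>L 'a)) \<Rightarrow> (real \<Rightarrow> ('a \<Rightarrow>\<^sub>L 'a)) \<Rightarrow> real \<Rightarrow> ('a \<Rightarrow>\<^sub>L 'a)" where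
  "riccati_term W G P \<equiv> \<lambda>s. W s - (P s o\<^sub>L G s o\<^sub>L P s)"

text \<open>If \<open>U\<close> is generated by \<open>A\<close>, this is the mild solution of the Lyapunov equation
  \<open>P' = A P + P A* + Q\<close> with \<open>P 0 = Q0\<close>.\<close>

definition lyap :: "(real \<Rightarrow> real \<Rightarrow> ('a::{real_inner,banach} \<Rightarrow>\<^sub>L 'a)) \<Rightarrow> ('a \<Rightarrow>\<^sub>L 'a) \<Rightarrow> (real \<Rightarrow> ('a \<Rightarrow>\<^sub>L 'a)) \<Rightarrow> real \<Rightarrow> ('a \<Rightarrow>\<^sub>L 'a)" where
  "lyap U Q0 Q t = conj_by (U t 0) Q0 + sint 0 t (\<lambda>s. conj_by (U t s) (Q s))"

lemma riccati_term_diff_le: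
  fixes P P' G W :: "real \<Rightarrow> ('a::real_normed_vector \<Rightarrow>\<^sub>L 'a)"
  assumes "norm (P s) \<le> m" "norm (P' s) \<le> m" "norm (G s) \<le> g" "norm (P s - P' s) \<le> c"
  shows "norm (riccati_term W G P s - riccati_term W G P' s) \<le> 2 * g * m * c"
proof -
  have "riccati_term W G P s - riccati_term W G P' s
      = - (((P s - P' s) o\<^sub>L G s o\<^sub>L P s) + (P' s o\<^sub>L G s o\<^sub>L (P s - P' s)))"
    by (rule blinfun_eqI) (simp add: blinfun.diff_left blinfun.diff_right blinfun.add_left blinfun.minus_left)
  moreover have "norm ((P s - P' s) o\<^sub>L G s o\<^sub>L P s) \<le> c * g * m"
    by (rule norm_compose3_le[OF assms(4,3,1)])
  moreover have "norm (P' s o\<^sub>L G s o\<^sub>L (P s - P' s)) \<le> m * g * c"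
    by (rule norm_compose3_le[OF assms(2,3,4)])
  ultimately have "norm (riccati_term W G P s - riccati_term W G P' s) \<le> c * g * m + m * g * c"
    by (simp only: norm_minus_cancel norm_triangle_mono)
  then show ?thesis by (simp add: algebra_simps)
qed

locale hilbert_evol =
  fixes tf :: real and U :: "real \<Rightarrow> real \<Rightarrow> ('a::{real_inner,banach} \<Rightarrow>\<^sub>L 'a)"
  assumes U: "evol tf U" and U': "joint_scont tf (\<lambda>t s. adj (U t s))"
begin

lemma adj_evol_apply:
  assumes "0 \<le> s" "s \<le> r" "r \<le> t" "t \<le> tf"
  shows "adj (U r s) (adj (U t r) w) = adj (U t s) w"
  using evolD(2)[OF U assms] by (metis adj_compose blinfun_apply_blinfun_compose)

lemma conj_scont:
  assumes Q: "scont {0..tf} Q" and "continuous_on Y f" "continuous_on Y g"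
    and Y: "\<And>y. y \<in> Y \<Longrightarrow> 0 \<le> g y \<and> g y \<le> f y \<and> f y \<le> tf"
  shows "scont Y (\<lambda>y. conj_by (U (f y) (g y)) (Q (g y)))"
proof -
  have "scont Y (\<lambda>y. Q (g y))"
    by (rule scont_reparam[OF Q assms(3)]) (use Y in fastforce)
  moreover have "scont Y (\<lambda>y. adj (U (f y) (g y)))"
    by (rule scont_tri[of tf "\<lambda>t s. adj (U t s)"]) (use assms U' in auto)
  ultimately show ?thesis
    by (intro scont_compose scont_tri[OF evolD(3)[OF U]] assms(2-)) auto
qed

lemma conj_kernel:
  assumes "scont {0..tf} Q" "0 \<le> s" "t \<le> tf"
  shows "scont {s..t} (\<lambda>r. conj_by (U t r) (Q r))"
  by (rule conj_scont[OF assms(1)]) (use assms in \<open>auto intro!: continuous_intros\<close>)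

lemma lyap_scont:
  assumes Q: "scont {0..tf} Q"
  shows "scont {0..tf} (lyap U Q0 Q)"
proof -
  have 1: "scont {0..tf} (\<lambda>t. conj_by (U t 0) Q0)"
    by (rule conj_scont[OF scont_const]) (auto intro!: continuous_intros)
  have 2: "scont {0..tf} (\<lambda>t. sint 0 t (\<lambda>s. conj_by (U t s) (Q s)))"
  proof (rule scont_sint[where l = tf])
    show "scont {(t, s). t \<in> {0..tf} \<and> 0 \<le> s \<and> s \<le> t}
        (\<lambda>p. conj_by (U (fst p) (snd p)) (Q (snd p)))"
      by (rule conj_scont[OF Q]) (auto intro!: continuous_intros)
  qed (auto intro!: continuous_intros)
  show ?thesis unfolding lyap_def[abs_def] by (rule scont_add[OF 1 2])
qed

lemma lyap_apply:
  assumes Q: "scont {0..tf} Q" and t: "t \<in> {0..tf}"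
  shows "lyap U Q0 Q t w = U t 0 (Q0 (adj (U t 0) w)) + integral {0..t} (\<lambda>s. U t s (Q s (adj (U t s) w)))"
  using t by (simp add: lyap_def blinfun.add_left sint_apply conj_kernel[OF Q])

lemma lyap_inner:
  assumes Q: "scont {0..tf} Q" and t: "t \<in> {0..tf}"
  shows "lyap U Q0 Q t w \<bullet> v = Q0 (adj (U t 0) w) \<bullet> adj (U t 0) v
      + integral {0..t} (\<lambda>s. Q s (adj (U t s) w) \<bullet> adj (U t s) v)"
proof -
  have "sint 0 t (\<lambda>s. conj_by (U t s) (Q s)) w \<bullet> v
      = integral {0..t} (\<lambda>s. Q s (adj (U t s) w) \<bullet> adj (U t s) v)"
    using t by (simp add: sint_inner conj_kernel[OF Q] adj_inner[of "U _ _"])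
  then show ?thesis by (simp add: lyap_def blinfun.add_left inner_add_left adj_inner[of "U _ _"])
qed

lemma lyap_inner_integrable:
  assumes Q: "scont {0..tf} Q" and t: "t \<in> {0..tf}"
  shows "(\<lambda>s. Q s (adj (U t s) w) \<bullet> adj (U t s) v) integrable_on {0..t}"
proof -
  have "continuous_on {0..t} (\<lambda>s. (conj_by (U t s) (Q s)) w \<bullet> v)"
    by (intro continuous_intros scont_cont conj_kernel[OF Q]) (use t in auto)
  then show ?thesis by (intro integrable_continuous_real) (simp add: adj_inner)
qed

lemma lyap_self_adjoint:
  assumes Q: "scont {0..tf} Q" and t: "t \<in> {0..tf}"
    and sa: "self_adjoint Q0" "\<And>s. s \<in> {0..t} \<Longrightarrow> self_adjoint (Q s)"
  shows "self_adjoint (lyap U Q0 Q t)"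
  unfolding self_adjoint_iff
proof (intro allI)
  fix w v
  have s0: "Q0 (adj (U t 0) w) \<bullet> adj (U t 0) v = Q0 (adj (U t 0) v) \<bullet> adj (U t 0) w"
    using sa(1) by (metis inner_commute self_adjoint_iff)
  have "integral {0..t} (\<lambda>s. Q s (adj (U t s) w) \<bullet> adj (U t s) v)
      = integral {0..t} (\<lambda>s. Q s (adj (U t s) v) \<bullet> adj (U t s) w)"
    by (rule integral_cong) (metis sa(2) inner_commute self_adjoint_iff)
  then have "lyap U Q0 Q t w \<bullet> v = lyap U Q0 Q t v \<bullet> w" by (simp add: lyap_inner[OF Q t] s0)
  then show "lyap U Q0 Q t w \<bullet> v = w \<bullet> lyap U Q0 Q t v" by (simp add: inner_commute)
qed

lemma lyap_mono:
  assumes Q: "scont {0..tf} Q" "scont {0..tf} Q'" and t: "t \<in> {0..tf}"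
    and le: "\<And>s x. s \<in> {0..t} \<Longrightarrow> Q s x \<bullet> x \<le> Q' s x \<bullet> x"
  shows "lyap U Q0 Q t x \<bullet> x \<le> lyap U Q0 Q' t x \<bullet> x"
  unfolding lyap_inner[OF Q(1) t] lyap_inner[OF Q(2) t]
  by (intro add_mono integral_le lyap_inner_integrable Q t le) auto

lemma lyap_nonneg:
  assumes Q: "scont {0..tf} Q" and t: "t \<in> {0..tf}"
    and pos: "\<And>x. 0 \<le> (Q0 :: 'a \<Rightarrow>\<^sub>L 'a) x \<bullet> x" "\<And>s x. s \<in> {0..t} \<Longrightarrow> 0 \<le> Q s x \<bullet> x"
  shows "0 \<le> lyap U Q0 Q t x \<bullet> x"
  unfolding lyap_inner[OF Q t]
  by (intro add_nonneg_nonneg integral_nonneg lyap_inner_integrable Q t pos)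

lemma lyap_norm_le:
  assumes Q: "scont {0..tf} Q" and t: "t \<in> {0..tf}"
    and k: "\<And>s t. 0 \<le> s \<Longrightarrow> s \<le> t \<Longrightarrow> t \<le> tf \<Longrightarrow> norm (U t s) \<le> k"
    and q: "norm Q0 \<le> q0" "\<And>s. s \<in> {0..tf} \<Longrightarrow> norm (Q s) \<le> q"
  shows "norm (lyap U Q0 Q t) \<le> k\<^sup>2 * (q0 + tf * q)"
proof -
  have k': "norm (adj (U t s)) \<le> k" if "0 \<le> s" "s \<le> t" "t \<le> tf" for s t
    using norm_adj_le k[OF that] order_trans by blast
  have q0: "0 \<le> q" using q(2)[OF t] norm_ge_zero order_trans by blast
  have "norm (conj_by (U t 0) Q0) \<le> k * q0 * k"
    by (rule norm_compose3_le) (use k k' q t in auto)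
  moreover have "norm (sint 0 t (\<lambda>s. conj_by (U t s) (Q s))) \<le> (k * q * k) * (t - 0)"
    by (rule sint_norm_le_const[OF conj_kernel[OF Q] norm_compose3_le]) (use k k' q t in auto)
  moreover have "(k * q * k) * (t - 0) \<le> (k * q * k) * tf"
  proof (rule mult_left_mono)
    show "0 \<le> k * q * k" using mult_nonneg_nonneg[OF q0 zero_le_square[of k]] by (simp add: mult_ac)
  qed (use t in auto)
  ultimately have "norm (lyap U Q0 Q t) \<le> k * q0 * k + (k * q * k) * tf"
    unfolding lyap_def by (intro norm_triangle_le) linarith
  then show ?thesis by (simp add: power2_eq_square algebra_simps)
qed

lemma lyap_transport:
  assumes Q: "scont {0..tf} Q" and st: "0 \<le> s" "s \<le> t" "t \<le> tf"
  shows "U t s (lyap U Q0 Q s (adj (U t s) w))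
    = U t 0 (Q0 (adj (U t 0) w)) + integral {0..s} (\<lambda>r. U t r (Q r (adj (U t r) w)))"
proof -
  have "(\<lambda>r. U s r (Q r (adj (U s r) (adj (U t s) w)))) integrable_on {0..s}"
    using scont_integrable[OF conj_kernel[OF Q, of 0 s] continuous_on_const, of "adj (U t s) w"] st by simp
  from integral_linear[OF this blinfun.bounded_linear_right[of "U t s"]]
  have "U t s (integral {0..s} (\<lambda>r. U s r (Q r (adj (U s r) (adj (U t s) w)))))
      = integral {0..s} (\<lambda>r. U t s (U s r (Q r (adj (U s r) (adj (U t s) w)))))" by (simp add: o_def)
  also have "\<dots> = integral {0..s} (\<lambda>r. U t r (Q r (adj (U t r) w)))"
    by (rule integral_cong) (use st in \<open>simp add: evol_apply[OF U] adj_evol_apply\<close>)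
  finally show ?thesis
    using st by (simp add: lyap_apply[OF Q] blinfun.add_right evol_apply[OF U] adj_evol_apply)
qed

lemma lyap_step:
  assumes Q: "scont {0..tf} Q" and st: "0 \<le> s" "s \<le> t" "t \<le> tf"
  shows "lyap U Q0 Q t w = U t s (lyap U Q0 Q s (adj (U t s) w))
    + integral {s..t} (\<lambda>r. U t r (Q r (adj (U t r) w)))"
proof -
  have "(\<lambda>r. U t r (Q r (adj (U t r) w))) integrable_on {0..t}"
    using scont_integrable[OF conj_kernel[OF Q, of 0 t] continuous_on_const, of w] st by simp
  from Henstock_Kurzweil_Integration.integral_combine[OF st(1,2) this]
  moreover have "t \<in> {0..tf}" using st by simp
  ultimately show ?thesis unfolding lyap_transport[OF Q st] lyap_apply[OF Q \<open>t \<in> {0..tf}\<close>] by simp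
qed

lemma conj_vector_continuous:
  assumes Q: "scont {0..tf} Q" and t: "t \<in> {0..tf}"
  shows "continuous_on {0..t} (\<lambda>s. U t s (Q s (adj (U t s) w)))"
  using scont_cont[OF conj_kernel[OF Q, of 0 t], of w] t by simp

text \<open>For a fixed final time \<open>t\<close> the curve \<open>s \<mapsto> U t s (P s (U t s)* w)\<close> satisfies an integral equation
  free of \<open>U\<close>, to which the scalar change of weight applies.\<close>

lemma lyap_exp_weight:
  fixes l :: real
  assumes P: "scont {0..tf} P" and Q: "scont {0..tf} Q"
  defines "L \<equiv> \<lambda>s. exp (l * s) *\<^sub>R (l *\<^sub>R P s + Q s)"
  shows lyap_exp_weight_scont: "scont {0..tf} L"
    and lyap_exp_weight_remove:
      "(\<And>s. s \<in> {0..tf} \<Longrightarrow> P s = exp (- l * s) *\<^sub>R lyap U Q0 L s) \<Longrightarrow> t \<in> {0..tf} \<Longrightarrow> P t = lyap U Q0 Q t"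
    and lyap_exp_weight_insert:
      "(\<And>s. s \<in> {0..tf} \<Longrightarrow> P s = lyap U Q0 Q s) \<Longrightarrow> t \<in> {0..tf} \<Longrightarrow> P t = exp (- l * t) *\<^sub>R lyap U Q0 L t"
proof -
  have "bounded ((\<lambda>s. exp (l * s)) ` {0..tf})"
    by (intro compact_imp_bounded compact_continuous_image continuous_intros) auto
  then obtain b where b: "\<And>s. s \<in> {0..tf} \<Longrightarrow> \<bar>exp (l * s)\<bar> \<le> b" unfolding bounded_iff by (metis image_eqI real_norm_def)
  show L: "scont {0..tf} L"
    unfolding L_def
    by (intro scont_scaleR scont_add P Q) (use b in \<open>auto intro!: continuous_intros\<close>)
  have tr: "U t s (lyap U Q0 L s (adj (U t s) w)) = U t 0 (Q0 (adj (U t 0) w)) + integral {0..s}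
      (\<lambda>r. exp (l * r) *\<^sub>R (l *\<^sub>R U t r (P r (adj (U t r) w)) + U t r (Q r (adj (U t r) w))))"
    if "0 \<le> s" "s \<le> t" "t \<le> tf" for s t w
    unfolding lyap_transport[OF L that]
    by (simp add: L_def blinfun.add_left blinfun.add_right blinfun.scaleR_left blinfun.scaleR_right)
  have U1: "U t t (X (adj (U t t) w)) = X w" if "t \<in> {0..tf}" for t w and X :: "'a \<Rightarrow>\<^sub>L 'a"
    using evolD(1)[OF U, of t] that by (simp add: adj_id)
  show "P t = lyap U Q0 Q t" if eq: "\<And>s. s \<in> {0..tf} \<Longrightarrow> P s = exp (- l * s) *\<^sub>R lyap U Q0 L s" and t: "t \<in> {0..tf}"
  proof (rule blinfun_eqI)
    fix w
    have "U t t (P t (adj (U t t) w)) = U t 0 (Q0 (adj (U t 0) w)) + integral {0..t} (\<lambda>r. U t r (Q r (adj (U t r) w)))"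
    proof (rule exp_weight_remove[where \<phi> = "\<lambda>s. U t s (P s (adj (U t s) w))" and l = l])
      fix s assume s: "s \<in> {0..t}"
      then have "U t s (P s (adj (U t s) w)) = exp (- l * s) *\<^sub>R U t s (lyap U Q0 L s (adj (U t s) w))"
        using eq[of s] t by (simp add: blinfun.scaleR_left blinfun.scaleR_right)
      then show "U t s (P s (adj (U t s) w)) = exp (- l * s) *\<^sub>R (U t 0 (Q0 (adj (U t 0) w)) + integral {0..s}
          (\<lambda>r. exp (l * r) *\<^sub>R (l *\<^sub>R U t r (P r (adj (U t r) w)) + U t r (Q r (adj (U t r) w)))))"
        using s t by (simp add: tr)
    qed (use t in \<open>auto intro!: conj_vector_continuous P Q\<close>)
    then show "P t w = lyap U Q0 Q t w" by (simp add: U1[OF t] lyap_apply[OF Q t])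
  qed
  show "P t = exp (- l * t) *\<^sub>R lyap U Q0 L t" if eq: "\<And>s. s \<in> {0..tf} \<Longrightarrow> P s = lyap U Q0 Q s" and t: "t \<in> {0..tf}"
  proof (rule blinfun_eqI)
    fix w
    have "U t t (P t (adj (U t t) w)) = exp (- l * t) *\<^sub>R (U t 0 (Q0 (adj (U t 0) w)) + integral {0..t}
          (\<lambda>r. exp (l * r) *\<^sub>R (l *\<^sub>R U t r (P r (adj (U t r) w)) + U t r (Q r (adj (U t r) w)))))"
    proof (rule exp_weight_insert[where \<phi> = "\<lambda>s. U t s (P s (adj (U t s) w))"])
      fix s assume s: "s \<in> {0..t}"
      show "U t s (P s (adj (U t s) w)) = U t 0 (Q0 (adj (U t 0) w)) + integral {0..s} (\<lambda>r. U t r (Q r (adj (U t r) w)))"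
        using s t eq[of s] by (simp add: lyap_transport[OF Q])
    qed (use t in \<open>auto intro!: conj_vector_continuous Q\<close>)
    then show "P t w = (exp (- l * t) *\<^sub>R lyap U Q0 L t) w"
      using tr[of t t w] t by (simp add: U1[OF t] blinfun.scaleR_left)
  qed
qed

text \<open>If \<open>0 \<le> P \<le> Pm\<close>, the quadratic forms of \<open>l P + W - P G P\<close> lie between those of \<open>0\<close> and
  \<open>l Pm + W\<close>, so the damped Picard map preserves this order interval, on which the quadratic term
  is Lipschitz.  Confinement rules out blow-up: one contraction covers all of \<open>[0, tf]\<close>.\<close>

lemma riccati_solution:
  assumes P0: "self_adjoint P0" "\<And>x. 0 \<le> P0 x \<bullet> x" "norm P0 \<le> p0"
    and W: "scont {0..tf} W" "\<And>t. t \<in> {0..tf} \<Longrightarrow> self_adjoint (W t)"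
      "\<And>t x. t \<in> {0..tf} \<Longrightarrow> 0 \<le> W t x \<bullet> x" "\<And>t. t \<in> {0..tf} \<Longrightarrow> norm (W t) \<le> b"
    and G: "scont {0..tf} G" "\<And>t. t \<in> {0..tf} \<Longrightarrow> self_adjoint (G t)"
      "\<And>t x. t \<in> {0..tf} \<Longrightarrow> 0 \<le> G t x \<bullet> x" "\<And>t. t \<in> {0..tf} \<Longrightarrow> norm (G t) \<le> g" "0 \<le> g"
    and k: "\<And>s t. 0 \<le> s \<Longrightarrow> s \<le> t \<Longrightarrow> t \<le> tf \<Longrightarrow> norm (U t s) \<le> k"
    and tf: "0 \<le> tf"
  shows "\<exists>P. scont {0..tf} P \<and> (\<forall>t\<in>{0..tf}. norm (P t) \<le> k\<^sup>2 * (p0 + tf * b)) \<and>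
      (\<forall>t\<in>{0..tf}. P t = lyap U P0 (riccati_term W G P) t)"
proof -
  define m where "m = k\<^sup>2 * (p0 + tf * b)"
  define Pm where "Pm = lyap U P0 W"
  define l where "l = g * m"
  have Pm: "scont {0..tf} Pm" unfolding Pm_def by (rule lyap_scont[OF W(1)])
  have Pm_norm: "norm (Pm t) \<le> m" if "t \<in> {0..tf}" for t
    unfolding Pm_def m_def by (rule lyap_norm_le[OF W(1) that k P0(3) W(4)])
  have m0: "0 \<le> m" using Pm_norm[of 0] tf norm_ge_zero[of "Pm 0"] by (meson atLeastAtMost_iff order_refl order_trans)
  have l0: "0 \<le> l" using m0 G(5) by (simp add: l_def)
  define S where "S = {P. scont {0..tf} P \<and> (\<forall>t\<in>{0..tf}. self_adjoint (P t) \<and>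
      (\<forall>x. 0 \<le> P t x \<bullet> x \<and> P t x \<bullet> x \<le> Pm t x \<bullet> x))}"
  have S: "scont {0..tf} P" "\<And>t. t \<in> {0..tf} \<Longrightarrow> self_adjoint (P t)"
      "\<And>t x. t \<in> {0..tf} \<Longrightarrow> 0 \<le> P t x \<bullet> x" "\<And>t x. t \<in> {0..tf} \<Longrightarrow> P t x \<bullet> x \<le> Pm t x \<bullet> x" if "P \<in> S" for P
    using that by (auto simp: S_def)
  have le_m: "P t x \<bullet> x \<le> m * (norm x)\<^sup>2" if "P \<in> S" "t \<in> {0..tf}" for P t x
  proof -
    have "Pm t x \<bullet> x \<le> norm (Pm t x) * norm x" by (rule norm_cauchy_schwarz)
    also have "\<dots> \<le> (m * norm x) * norm x"
      by (intro mult_right_mono order_trans[OF norm_blinfun] Pm_norm that norm_ge_zero)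
    finally show ?thesis using S(4)[OF that, of x] by (simp add: power2_eq_square mult.assoc)
  qed
  have S_norm: "norm (P t) \<le> m" if "P \<in> S" "t \<in> {0..tf}" for P t
    by (rule nonneg_operator_norm_le[OF S(2,3)[OF that] le_m[OF that] m0])
  define N where "N P s = W s - (P s o\<^sub>L G s o\<^sub>L P s)" for P :: "real \<Rightarrow> ('a \<Rightarrow>\<^sub>L 'a)" and s
  define L where "L P s = exp (l * s) *\<^sub>R (l *\<^sub>R P s + N P s)" for P s
  define \<Phi> where "\<Phi> P t = exp (- l * t) *\<^sub>R lyap U P0 (L P) t" for P t
  have N: "scont {0..tf} (N P)" if "P \<in> S" for P
    unfolding N_def[abs_def] by (intro scont_diff scont_compose W G S(1)[OF that])
  have L: "scont {0..tf} (L P)" if "P \<in> S" for P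
    unfolding L_def[abs_def] by (rule lyap_exp_weight_scont[OF S(1)[OF that] N[OF that]])
  have N_self: "self_adjoint (N P s)" if "P \<in> S" "s \<in> {0..tf}" for P s
  proof -
    have "\<And>x y. W s x \<bullet> y = x \<bullet> W s y" "\<And>x y. G s x \<bullet> y = x \<bullet> G s y" "\<And>x y. P s x \<bullet> y = x \<bullet> P s y"
      using W(2) G(2) S(2)[OF that(1)] that(2) by (auto simp: self_adjoint_iff)
    then show ?thesis unfolding self_adjoint_iff N_def
      by (simp add: blinfun.diff_left inner_diff_left inner_diff_right)
  qed
  have PGP: "(P s o\<^sub>L G s o\<^sub>L P s) x \<bullet> x = G s (P s x) \<bullet> P s x" if "P \<in> S" "s \<in> {0..tf}" for P s x
    using S(2)[OF that] by (simp add: self_adjoint_iff)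
  have L_self: "self_adjoint (L P s)" if "P \<in> S" "s \<in> {0..tf}" for P s
    using N_self[OF that] S(2)[OF that] unfolding self_adjoint_iff L_def
    by (simp add: blinfun.scaleR_left blinfun.add_left inner_add_left inner_add_right)
  \<comment> \<open>The shift \<open>l P\<close> dominates the quadratic term because \<open>0 \<le> P \<le> m\<close> gives \<open>P G P \<le> g m P\<close>.\<close>
  have L_pos: "0 \<le> L P s x \<bullet> x" if "P \<in> S" "s \<in> {0..tf}" for P s x
  proof -
    have "G s (P s x) \<bullet> P s x \<le> norm (G s (P s x)) * norm (P s x)" by (rule norm_cauchy_schwarz)
    also have "\<dots> \<le> (g * norm (P s x)) * norm (P s x)"
      by (intro mult_right_mono order_trans[OF norm_blinfun] G that norm_ge_zero)
    also have "\<dots> = g * (norm (P s x))\<^sup>2" by (simp add: power2_eq_square)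
    also have "\<dots> \<le> g * (m * (P s x \<bullet> x))"
      by (intro mult_left_mono nonneg_operator_square_le S le_m that G(5))
    finally have "0 \<le> l * (P s x \<bullet> x) + (W s x \<bullet> x - G s (P s x) \<bullet> P s x)"
      using W(3)[OF that(2), of x] by (simp add: l_def)
    then have "0 \<le> exp (l * s) * (l * (P s x \<bullet> x) + (W s x \<bullet> x - G s (P s x) \<bullet> P s x))" by simp
    then show ?thesis using PGP[OF that, of x]
      by (simp add: L_def N_def blinfun.scaleR_left blinfun.add_left blinfun.diff_left inner_add_left inner_diff_left)
  qed
  have Pm_eq: "Pm t = exp (- l * t) *\<^sub>R lyap U P0 (\<lambda>s. exp (l * s) *\<^sub>R (l *\<^sub>R Pm s + W s)) t" if "t \<in> {0..tf}" for t
    by (rule lyap_exp_weight_insert[OF Pm W(1) _ that]) (simp add: Pm_def)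
  have L_le: "L P s x \<bullet> x \<le> (exp (l * s) *\<^sub>R (l *\<^sub>R Pm s + W s)) x \<bullet> x" if "P \<in> S" "s \<in> {0..tf}" for P s x
  proof -
    have "l * (P s x \<bullet> x) + (W s x \<bullet> x - G s (P s x) \<bullet> P s x) \<le> l * (Pm s x \<bullet> x) + W s x \<bullet> x"
      using mult_left_mono[OF S(4)[OF that, of x] l0] G(3)[OF that(2), of "P s x"] by simp
    then have "exp (l * s) * (l * (P s x \<bullet> x) + (W s x \<bullet> x - G s (P s x) \<bullet> P s x))
        \<le> exp (l * s) * (l * (Pm s x \<bullet> x) + W s x \<bullet> x)" by simp
    then show ?thesis using PGP[OF that, of x]
      by (simp add: L_def N_def blinfun.scaleR_left blinfun.add_left blinfun.diff_left inner_add_left inner_diff_left)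
  qed
  have maps: "\<Phi> P \<in> S" if P: "P \<in> S" for P
  proof -
    have "scont {0..tf} (\<Phi> P)" unfolding \<Phi>_def[abs_def]
      by (rule scont_scaleR[OF lyap_scont[OF L[OF P]], where b = 1]) (use l0 in \<open>auto intro!: continuous_intros\<close>)
    moreover have "self_adjoint (\<Phi> P t)" if t: "t \<in> {0..tf}" for t
    proof -
      have "self_adjoint (lyap U P0 (L P) t)"
        by (rule lyap_self_adjoint[OF L[OF P] t P0(1) L_self[OF P]]) (use t in auto)
      then show ?thesis by (simp add: \<Phi>_def self_adjoint_iff blinfun.scaleR_left)
    qed
    moreover have "0 \<le> \<Phi> P t x \<bullet> x" if t: "t \<in> {0..tf}" for t x
    proof -
      have "0 \<le> lyap U P0 (L P) t x \<bullet> x"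
        by (rule lyap_nonneg[OF L[OF P] t P0(2) L_pos[OF P]]) (use t in auto)
      then show ?thesis by (simp add: \<Phi>_def blinfun.scaleR_left)
    qed
    moreover have "\<Phi> P t x \<bullet> x \<le> Pm t x \<bullet> x" if t: "t \<in> {0..tf}" for t x
    proof -
      have "lyap U P0 (L P) t x \<bullet> x \<le> lyap U P0 (\<lambda>s. exp (l * s) *\<^sub>R (l *\<^sub>R Pm s + W s)) t x \<bullet> x"
        by (rule lyap_mono[OF L[OF P] lyap_exp_weight_scont[OF Pm W(1)] t L_le[OF P]]) (use t in auto)
      then show ?thesis unfolding Pm_eq[OF t] by (simp add: \<Phi>_def blinfun.scaleR_left)
    qed
    ultimately show ?thesis by (simp add: S_def)
  qed
  define \<beta> where "\<beta> = k * (l + 2 * g * m) * k"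
  have \<beta>: "0 \<le> \<beta>" 
  proof -
    have "0 \<le> (l + 2 * g * m) * (k * k)" using l0 m0 G(5) by (intro mult_nonneg_nonneg[OF _ zero_le_square]) auto
    then show ?thesis by (simp add: \<beta>_def mult_ac)
  qed
  define \<kappa> where "\<kappa> = 2 * \<beta> + 1"
  have \<kappa>: "\<kappa> > 0" using \<beta> by (simp add: \<kappa>_def)
  have "\<exists>P\<in>S. \<forall>t\<in>{0..tf}. \<Phi> P t = P t"
  proof (rule weighted_fixed_point[where \<omega> = "\<lambda>t. exp (\<kappa> * t)" and \<Omega> = "exp (\<kappa> * tf)"])
    show "Pm \<in> S"
      using Pm lyap_self_adjoint[OF W(1) _ P0(1) W(2)] lyap_nonneg[OF W(1) _ P0(2) W(3)]
      unfolding S_def Pm_def by auto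
    show "exp (\<kappa> * t) \<le> exp (\<kappa> * tf)" if "t \<in> {0..tf}" for t using that \<kappa> by simp
    show "\<exists>b. \<forall>t\<in>{0..tf}. norm (P t - P' t) \<le> b * exp (\<kappa> * t)" if "P \<in> S" "P' \<in> S" for P P'
    proof -
      have "norm (P t - P' t) \<le> (2 * m) * exp (\<kappa> * t)" if t: "t \<in> {0..tf}" for t
      proof -
        have "norm (P t - P' t) \<le> 2 * m"
          using norm_triangle_ineq4[of "P t" "P' t"] S_norm[OF \<open>P \<in> S\<close> t] S_norm[OF \<open>P' \<in> S\<close> t] by linarith
        also have "2 * m * 1 \<le> 2 * m * exp (\<kappa> * t)" by (rule mult_left_mono) (use m0 \<kappa> t in auto)
        finally show ?thesis by simp
      qed
      then show ?thesis by blast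
    qed
    show "norm (\<Phi> P t - \<Phi> P' t) \<le> c / 2 * exp (\<kappa> * t)"
      if P: "P \<in> S" "P' \<in> S" and c: "0 \<le> c"
        and h: "\<And>t. t \<in> {0..tf} \<Longrightarrow> norm (P t - P' t) \<le> c * exp (\<kappa> * t)" and t: "t \<in> {0..tf}" for P P' c t
    proof -
      have ker: "scont {0..t} (\<lambda>s. conj_by (U t s) (L P s))" "scont {0..t} (\<lambda>s. conj_by (U t s) (L P' s))"
        using t by (auto intro!: conj_kernel L P)
      have "norm (sint 0 t (\<lambda>s. conj_by (U t s) (L P s) - conj_by (U t s) (L P' s)))
          \<le> (exp (l * t) * \<beta> * c) / \<kappa> * exp (\<kappa> * t)"
      proof (rule sint_norm_le_exp[OF scont_diff[OF ker] _ _ \<kappa>])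
        fix s assume s: "s \<in> {0..t}"
        then have s': "s \<in> {0..tf}" using t by simp
        have "norm (N P s - N P' s) \<le> 2 * g * m * (c * exp (\<kappa> * s))"
          unfolding N_def by (rule riccati_term_diff_le[where s = s and P = P and P' = P' and G = G and W = W,
              OF S_norm[OF P(1) s'] S_norm[OF P(2) s'] G(4)[OF s'] h[OF s']])
        moreover have "norm (l *\<^sub>R (P s - P' s)) \<le> l * (c * exp (\<kappa> * s))"
          using h[OF s'] l0 by (simp add: mult_left_mono)
        ultimately have "norm (l *\<^sub>R (P s - P' s) + (N P s - N P' s))
            \<le> l * (c * exp (\<kappa> * s)) + 2 * g * m * (c * exp (\<kappa> * s))"
          by (intro norm_triangle_mono)
        then have 1: "norm (l *\<^sub>R (P s - P' s) + (N P s - N P' s)) \<le> (l + 2 * g * m) * (c * exp (\<kappa> * s))"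
          by (simp add: algebra_simps)
        have "L P s - L P' s = exp (l * s) *\<^sub>R (l *\<^sub>R (P s - P' s) + (N P s - N P' s))"
          by (simp add: L_def algebra_simps)
        then have "norm (L P s - L P' s) = exp (l * s) * norm (l *\<^sub>R (P s - P' s) + (N P s - N P' s))" by simp
        also have "\<dots> \<le> exp (l * t) * ((l + 2 * g * m) * (c * exp (\<kappa> * s)))"
          by (rule mult_mono[OF _ 1]) (use s l0 in \<open>auto simp: mult_left_mono\<close>)
        finally have 2: "norm (L P s - L P' s) \<le> exp (l * t) * ((l + 2 * g * m) * (c * exp (\<kappa> * s)))" .
        have kts: "norm (U t s) \<le> k" using k s t by simp
        have "norm (conj_by (U t s) (L P s - L P' s))
            \<le> k * (exp (l * t) * ((l + 2 * g * m) * (c * exp (\<kappa> * s)))) * k"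
          by (rule norm_compose3_le[OF kts 2 order_trans[OF norm_adj_le kts]])
        moreover have "conj_by (U t s) (L P s) - conj_by (U t s) (L P' s)
            = conj_by (U t s) (L P s - L P' s)"
          by (rule blinfun_eqI) (simp add: blinfun.diff_left blinfun.diff_right)
        ultimately show "norm (conj_by (U t s) (L P s) - conj_by (U t s) (L P' s))
            \<le> exp (l * t) * \<beta> * c * exp (\<kappa> * s)"
          by (simp add: \<beta>_def mult_ac)
      qed (use t \<beta> c in auto)
      moreover have "\<Phi> P t - \<Phi> P' t = exp (- l * t) *\<^sub>R
          sint 0 t (\<lambda>s. conj_by (U t s) (L P s) - conj_by (U t s) (L P' s))"
        by (simp add: \<Phi>_def lyap_def sint_diff[OF ker, symmetric] algebra_simps)
      ultimately have "norm (\<Phi> P t - \<Phi> P' t) \<le> exp (- l * t) * ((exp (l * t) * \<beta> * c) / \<kappa> * exp (\<kappa> * t))"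
        by (simp only: norm_scaleR abs_exp_cancel) (rule mult_left_mono, auto)
      also have "\<dots> = \<beta> * c / \<kappa> * exp (\<kappa> * t)" by (simp add: exp_minus field_simps)
      also have "\<dots> \<le> c / 2 * exp (\<kappa> * t)"
        by (rule mult_right_mono) (use \<kappa> c \<beta> in \<open>auto simp: \<kappa>_def field_simps\<close>)
      finally show ?thesis .
    qed
    show "f \<in> S" if F: "\<And>n. F n \<in> S" and lim: "uniform_limit {0..tf} F f sequentially" for F f
    proof -
      have sc: "scont {0..tf} f" by (rule scont_uniform_limit[OF S(1)[OF F] lim])
      have lim1: "(\<lambda>n. F n t x \<bullet> y) \<longlonglongrightarrow> f t x \<bullet> y" if "t \<in> {0..tf}" for t x y
        by (intro tendsto_intros blinfun.tendsto tendsto_uniform_limitI[OF lim that])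
      have "self_adjoint (f t)" if t: "t \<in> {0..tf}" for t
        unfolding self_adjoint_iff
      proof (intro allI)
        fix x y
        have "(\<lambda>n. F n t x \<bullet> y) = (\<lambda>n. F n t y \<bullet> x)"
          using S(2)[OF F t] by (auto simp: self_adjoint_iff inner_commute)
        then have "f t x \<bullet> y = f t y \<bullet> x" using lim1[OF t, of x y] lim1[OF t, of y x] by (metis LIMSEQ_unique)
        then show "f t x \<bullet> y = x \<bullet> f t y" by (simp add: inner_commute)
      qed
      moreover have "0 \<le> f t x \<bullet> x" if "t \<in> {0..tf}" for t x
        by (rule LIMSEQ_le_const[OF lim1[OF that]]) (use S(3)[OF F that] in auto)
      moreover have "f t x \<bullet> x \<le> Pm t x \<bullet> x" if "t \<in> {0..tf}" for t x
        by (rule LIMSEQ_le_const2[OF lim1[OF that]]) (use S(4)[OF F that] in auto)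
      ultimately show ?thesis using sc by (simp add: S_def)
    qed
  qed (use maps in auto)
  then obtain P where P: "P \<in> S" "\<And>t. t \<in> {0..tf} \<Longrightarrow> P t = exp (- l * t) *\<^sub>R lyap U P0 (L P) t"
    unfolding \<Phi>_def by metis
  have "P t = lyap U P0 (N P) t" if "t \<in> {0..tf}" for t
    by (rule lyap_exp_weight_remove[OF S(1)[OF P(1)] N[OF P(1)] _ that])
      (use P(2) in \<open>simp add: L_def[abs_def]\<close>)
  then show ?thesis using S(1)[OF P(1)] S_norm[OF P(1)] unfolding N_def[abs_def] m_def by blast
qed

text \<open>The integrated equation involves \<open>U\<close> on both sides; replacing one factor by the closed-loop
  family \<open>V\<close> absorbs the quadratic term.  Along the adjoint trajectory \<open>x s\<close> ending in \<open>w\<close>,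
  the curve \<open>V t s (P s (x s))\<close> minus the integral of \<open>V t s (W s (x s))\<close> varies by
  \<open>o(b - a)\<close> over a step from \<open>a\<close> to \<open>b\<close>, hence is constant; this avoids interchanging integrals.\<close>

lemma closed_loop_form:
  assumes P: "scont {0..tf} P" and W: "scont {0..tf} W" and G: "scont {0..tf} G"
    and eq: "\<And>t. t \<in> {0..tf} \<Longrightarrow> P t = lyap U Q0 (riccati_term W G P) t"
    and V: "evol tf V"
    and Veq: "perturbed tf U (\<lambda>r. - (P r o\<^sub>L G r)) V"
    and t: "t \<in> {0..tf}"
  shows "P t w = V t 0 (Q0 (adj (U t 0) w)) + integral {0..t} (\<lambda>s. V t s (W s (adj (U t s) w)))"
    and "(\<lambda>s. V t s (W s (adj (U t s) w))) integrable_on {0..t}"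
proof -
  define K where "K r = - (P r o\<^sub>L G r)" for r
  have K: "scont {0..tf} K" unfolding K_def[abs_def] by (intro scont_minus scont_compose P G)
  define x where "x s = adj (U t s) w" for s
  define \<eta> where "\<eta> s = P s (x s)" for s
  define f where "f s = W s (x s)" for s
  define h where "h s = V t s (f s)" for s
  have sub: "scont {0..t} Q" if "scont {0..tf} Q" for Q :: "real \<Rightarrow> ('a \<Rightarrow>\<^sub>L 'a)"
    by (rule scont_subset[OF that]) (use t in auto)
  have xc: "continuous_on {0..t} x"
    unfolding x_def[abs_def]
    by (rule scont_cont[OF scont_tri[OF U']]) (use t in \<open>auto intro!: continuous_intros\<close>)
  have eta_c: "continuous_on {0..t} \<eta>" unfolding \<eta>_def[abs_def] by (rule scont_apply[OF sub[OF P] xc])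
  have fc: "continuous_on {0..t} f" unfolding f_def[abs_def] by (rule scont_apply[OF sub[OF W] xc])
  have Vt: "scont {0..t} (V t)"
    by (rule scont_tri[OF evolD(3)[OF V]]) (use t in \<open>auto intro!: continuous_intros\<close>)
  have hc: "continuous_on {0..t} h" unfolding h_def[abs_def] by (rule scont_apply[OF Vt fc])
  have tri_le: "tri t \<subseteq> tri tf" using t by (auto simp: tri_def)
  define d where "d s = V t s (\<eta> s) - integral {0..s} h" for s
  have step: "d b - d a = integral {a..b} (\<lambda>r. V t b (U b r (f r + K r (\<eta> r - V r a (\<eta> a)))) - h r)"
    and step_c: "continuous_on {a..b} (\<lambda>r. V t b (U b r (f r + K r (\<eta> r - V r a (\<eta> a)))) - h r)"
    if ab: "0 \<le> a" "a \<le> b" "b \<le> t" for a b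
  proof -
    have bt: "b \<le> tf" using ab t by simp
    have Ub: "scont {a..b} (U b)"
      by (rule scont_tri[OF evolD(3)[OF U]]) (use ab t in \<open>auto intro!: continuous_intros\<close>)
    have Va: "scont {a..b} (\<lambda>r. V r a)"
      by (rule scont_tri[OF evolD(3)[OF V]]) (use ab t in \<open>auto intro!: continuous_intros\<close>)
    have Kab: "scont {a..b} K" by (rule scont_subset[OF K]) (use ab t in auto)
    have cont: "continuous_on {a..b} \<eta>" "continuous_on {a..b} f" "continuous_on {a..b} h"
      using eta_c fc hc ab by (auto elim!: continuous_on_subset)
    have c1: "continuous_on {a..b} (\<lambda>r. U b r (f r + K r (\<eta> r)))"
      by (intro scont_apply[OF Ub] continuous_intros scont_apply[OF Kab] cont)
    have c2: "continuous_on {a..b} (\<lambda>r. U b r (K r (V r a (\<eta> a))))"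
      by (intro scont_apply[OF Ub] scont_apply[OF Kab] scont_cont[OF Va])
    have N: "scont {0..tf} (riccati_term W G P)" by (intro scont_diff scont_compose P W G)
    have "\<eta> b = U b a (P a (adj (U b a) (x b)))
        + integral {a..b} (\<lambda>r. U b r ((W r - (P r o\<^sub>L G r o\<^sub>L P r)) (adj (U b r) (x b))))"
      using lyap_step[OF N ab(1,2) bt, of Q0 "x b"] eq[of a] eq[of b] ab bt unfolding \<eta>_def by simp
    moreover have ax: "adj (U b r) (x b) = x r" if "r \<in> {a..b}" for r
      unfolding x_def using that ab t by (simp add: adj_evol_apply)
    moreover have "integral {a..b} (\<lambda>r. U b r ((W r - (P r o\<^sub>L G r o\<^sub>L P r)) (adj (U b r) (x b))))
        = integral {a..b} (\<lambda>r. U b r (f r + K r (\<eta> r)))"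
      by (rule integral_cong) (simp add: ax f_def K_def \<eta>_def blinfun.diff_left blinfun.minus_left)
    ultimately have 1: "\<eta> b = U b a (\<eta> a) + integral {a..b} (\<lambda>r. U b r (f r + K r (\<eta> r)))"
      using ab by (simp add: \<eta>_def)
    have 2: "V b a (\<eta> a) = U b a (\<eta> a) + integral {a..b} (\<lambda>r. U b r (K r (V r a (\<eta> a))))"
    proof -
      have "scont {a..b} (\<lambda>r. U b r o\<^sub>L K r o\<^sub>L V r a)" by (intro scont_compose Ub Kab Va)
      from sint_apply[OF this, of "\<eta> a"] show ?thesis
        using perturbedD[OF Veq ab(1,2) bt] by (simp add: blinfun.add_left K_def)
    qed
    have "\<eta> b - V b a (\<eta> a) = integral {a..b} (\<lambda>r. U b r (f r + K r (\<eta> r))) - integral {a..b} (\<lambda>r. U b r (K r (V r a (\<eta> a))))"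
      unfolding 1 2 by simp
    also have "\<dots> = integral {a..b} (\<lambda>r. U b r (f r + K r (\<eta> r)) - U b r (K r (V r a (\<eta> a))))"
      by (rule integral_diff[symmetric]) (intro integrable_continuous_real c1 c2)+
    also have "\<dots> = integral {a..b} (\<lambda>r. U b r (f r + K r (\<eta> r - V r a (\<eta> a))))"
      by (simp add: blinfun.diff_right blinfun.add_right add_diff_eq)
    finally have 3: "\<eta> b - V b a (\<eta> a) = integral {a..b} (\<lambda>r. U b r (f r + K r (\<eta> r - V r a (\<eta> a))))" .
    have c3: "continuous_on {a..b} (\<lambda>r. U b r (f r + K r (\<eta> r - V r a (\<eta> a))))"
      by (intro scont_apply[OF Ub] continuous_intros scont_apply[OF Kab] cont scont_cont[OF Va])
    have c4: "continuous_on {a..b} (\<lambda>r. V t b (U b r (f r + K r (\<eta> r - V r a (\<eta> a)))))"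
      by (rule continuous_on_compose2[OF linear_continuous_on[OF blinfun.bounded_linear_right, of UNIV] c3]) auto
    show "continuous_on {a..b} (\<lambda>r. V t b (U b r (f r + K r (\<eta> r - V r a (\<eta> a)))) - h r)"
      by (intro continuous_intros c4 cont)
    have "V t b (\<eta> b) - V t a (\<eta> a) = V t b (\<eta> b - V b a (\<eta> a))"
      using evol_apply[OF V, of a b t "\<eta> a"] ab t by (simp add: blinfun.diff_right)
    also have "\<dots> = integral {a..b} (\<lambda>r. V t b (U b r (f r + K r (\<eta> r - V r a (\<eta> a)))))"
      unfolding 3 using integral_linear[OF integrable_continuous_real[OF c3] blinfun.bounded_linear_right[of "V t b"]]
      by (simp add: o_def)
    finally have 4: "V t b (\<eta> b) - V t a (\<eta> a) = integral {a..b} (\<lambda>r. V t b (U b r (f r + K r (\<eta> r - V r a (\<eta> a)))))" .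
    have "h integrable_on {0..b}" by (rule integrable_continuous_real[OF continuous_on_subset[OF hc]]) (use ab in auto)
    from Henstock_Kurzweil_Integration.integral_combine[OF ab(1,2) this]
    have 5: "integral {0..b} h - integral {0..a} h = integral {a..b} h" by (simp add: algebra_simps)
    have "d b - d a = (V t b (\<eta> b) - V t a (\<eta> a)) - (integral {0..b} h - integral {0..a} h)"
      by (simp add: d_def)
    also have "\<dots> = integral {a..b} (\<lambda>r. V t b (U b r (f r + K r (\<eta> r - V r a (\<eta> a)))) - h r)"
      unfolding 4 5 by (rule integral_diff[symmetric]) (intro integrable_continuous_real c4 cont)+
    finally show "d b - d a = integral {a..b} (\<lambda>r. V t b (U b r (f r + K r (\<eta> r - V r a (\<eta> a)))) - h r)" .
  qed
  obtain kU where kU: "kU \<ge> 0" "\<And>p. p \<in> tri tf \<Longrightarrow> norm (U (fst p) (snd p)) \<le> kU" using scont_bound[OF evolD(3)[OF U]] by blast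
  obtain kV where kV: "kV \<ge> 0" "\<And>p. p \<in> tri tf \<Longrightarrow> norm (V (fst p) (snd p)) \<le> kV" using scont_bound[OF evolD(3)[OF V]] by blast
  obtain kK where kK: "kK \<ge> 0" "\<And>r. r \<in> {0..tf} \<Longrightarrow> norm (K r) \<le> kK" using scont_bound[OF K] by blast
  have loc: "\<exists>\<delta>>0. \<forall>a b. 0 \<le> a \<and> a \<le> b \<and> b \<le> t \<and> b - a < \<delta> \<longrightarrow> norm (d b - d a) \<le> e * (b - a)" if e: "e > 0" for e
  proof -
    define c where "c = kV * kU * kK + 1"
    have c: "c > 0" using kU kV kK by (simp add: c_def add_nonneg_pos)
    have id: "U s s = id_blinfun" "V s s = id_blinfun" if "0 \<le> s" "s \<le> t" for s
      using evolD(1)[OF U, of s] evolD(1)[OF V, of s] that t by auto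
    have cf: "continuous_on (tri t) (\<lambda>p. f (snd p))" "continuous_on (tri t) (\<lambda>p. \<eta> (fst p))" "continuous_on (tri t) (\<lambda>p. \<eta> (snd p))"
      by (rule continuous_on_compose2[OF fc] continuous_on_compose2[OF eta_c]; auto simp: tri_def intro!: continuous_intros)+
    have V1: "scont (tri t) (\<lambda>p. V t (fst p))" "scont (tri t) (\<lambda>p. V t (snd p))"
      by (rule scont_reparam[OF Vt]; auto simp: tri_def intro!: continuous_intros)+
    have "continuous_on (tri t) (\<lambda>p. V t (fst p) (U (fst p) (snd p) (f (snd p))) - V t (snd p) (f (snd p)))"
      by (intro continuous_on_diff scont_apply[OF V1(1)] scont_apply[OF V1(2)]
          scont_apply[OF scont_subset[OF evolD(3)[OF U] tri_le]] cf)
    from small_near_diagonal[OF this, of "e / 2"] obtain \<delta>1 where \<delta>1: "\<delta>1 > 0"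
      "\<And>b r. 0 \<le> r \<Longrightarrow> r \<le> b \<Longrightarrow> b \<le> t \<Longrightarrow> b - r < \<delta>1 \<Longrightarrow> norm (V t b (U b r (f r)) - V t r (f r)) < e / 2"
      using e id by auto
    have "continuous_on (tri t) (\<lambda>p. \<eta> (fst p) - V (fst p) (snd p) (\<eta> (snd p)))"
      by (intro continuous_on_diff scont_apply[OF scont_subset[OF evolD(3)[OF V] tri_le]] cf)
    from small_near_diagonal[OF this, of "e / (2 * c)"] obtain \<delta>2 where \<delta>2: "\<delta>2 > 0"
      "\<And>r a. 0 \<le> a \<Longrightarrow> a \<le> r \<Longrightarrow> r \<le> t \<Longrightarrow> r - a < \<delta>2 \<Longrightarrow> norm (\<eta> r - V r a (\<eta> a)) < e / (2 * c)"
      using e c id by auto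
    have "norm (d b - d a) \<le> e * (b - a)" if ab: "0 \<le> a" "a \<le> b" "b \<le> t" "b - a < min \<delta>1 \<delta>2" for a b
      unfolding step[OF ab(1-3)]
    proof (rule integral_norm_le_const[OF step_c[OF ab(1-3)] _ ab(2)])
      fix r assume r: "r \<in> {a..b}"
      let ?v = "\<eta> r - V r a (\<eta> a)"
      have 1: "norm (V t b (U b r (f r)) - h r) < e / 2" unfolding h_def by (rule \<delta>1) (use r ab in auto)
      have "norm (V t b (U b r (K r ?v))) \<le> norm (V t b o\<^sub>L U b r o\<^sub>L K r) * norm ?v"
        using norm_blinfun[of "V t b o\<^sub>L U b r o\<^sub>L K r" ?v] by simp
      also have "\<dots> \<le> (kV * kU * kK) * norm ?v"
        by (intro mult_right_mono norm_compose3_le norm_ge_zero)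
          (use kU(2)[of "(b, r)"] kV(2)[of "(t, b)"] kK r ab t in auto)
      also have "\<dots> \<le> c * norm ?v" by (rule mult_right_mono) (auto simp: c_def)
      also have "\<dots> \<le> e / 2"
      proof -
        have "norm ?v < e / (2 * c)" by (rule \<delta>2) (use r ab in auto)
        then show ?thesis using c by (simp add: field_simps)
      qed
      finally have 2: "norm (V t b (U b r (K r ?v))) \<le> e / 2" .
      have 3: "V t b (U b r (f r + K r ?v)) - h r = (V t b (U b r (f r)) - h r) + V t b (U b r (K r ?v))"
        by (simp add: blinfun.add_right)
      show "norm (V t b (U b r (f r + K r ?v)) - h r) \<le> e"
        unfolding 3 using 1 2 norm_triangle_ineq[of "V t b (U b r (f r)) - h r" "V t b (U b r (K r ?v))"] by linarith
    qed
    then show ?thesis using \<delta>1(1) \<delta>2(1) by (intro exI[of _ "min \<delta>1 \<delta>2"]) auto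
  qed
  have "(d has_derivative (\<lambda>_. 0)) (at s within {0..t})" if s: "s \<in> {0..t}" for s
    unfolding has_derivative_within_alt
  proof (intro conjI allI impI)
    fix e :: real assume e: "e > 0"
    obtain \<delta> where \<delta>: "\<delta> > 0" "\<And>a b. 0 \<le> a \<Longrightarrow> a \<le> b \<Longrightarrow> b \<le> t \<Longrightarrow> b - a < \<delta> \<Longrightarrow> norm (d b - d a) \<le> e * (b - a)"
      using loc[OF e] by blast
    have "norm (d y - d s - 0) \<le> e * norm (y - s)" if "y \<in> {0..t}" "norm (y - s) < \<delta>" for y
      using \<delta>(2)[of s y] \<delta>(2)[of y s] that s
      by (cases "s \<le> y") (auto simp: norm_minus_commute)
    then show "\<exists>\<delta>>0. \<forall>y\<in>{0..t}. norm (y - s) < \<delta> \<longrightarrow> norm (d y - d s - 0) \<le> e * norm (y - s)"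
      using \<delta>(1) by blast
  qed auto
  then have "\<exists>c. \<forall>s\<in>{0..t}. d s = c" by (rule has_derivative_zero_constant[OF convex_real_interval(5)])
  then have "d t = d 0" using t by auto
  moreover have "\<eta> 0 = Q0 (x 0)"
  proof -
    have N: "scont {0..tf} (riccati_term W G P)" by (intro scont_diff scont_compose P W G)
    have "0 \<in> {0..tf}" using t by auto
    then show ?thesis using eq[of 0] evolD(1)[OF U, of 0] unfolding \<eta>_def
      by (simp add: lyap_apply[OF N] adj_id)
  qed
  moreover have "\<eta> t = P t w" "V t t = id_blinfun"
    using evolD(1)[OF U, of t] evolD(1)[OF V, of t] t by (auto simp: \<eta>_def x_def adj_id)
  ultimately show "P t w = V t 0 (Q0 (adj (U t 0) w)) + integral {0..t} (\<lambda>s. V t s (W s (adj (U t s) w)))"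
    by (simp add: d_def h_def[abs_def] f_def x_def algebra_simps)
  show "(\<lambda>s. V t s (W s (adj (U t s) w))) integrable_on {0..t}"
    using integrable_continuous_real[OF hc] by (simp add: h_def[abs_def] f_def x_def)
qed

end

lemma norm_conj_diff_le:
  fixes A A' Q :: "'a::{real_inner,banach} \<Rightarrow>\<^sub>L 'a"
  assumes "norm A \<le> k" "norm A' \<le> k" "norm (A - A') \<le> e" "norm Q \<le> q"
  shows "norm (conj_by A Q - conj_by A' Q) \<le> 2 * k * e * q"
proof -
  have "conj_by A Q - conj_by A' Q
      = ((A - A') o\<^sub>L Q o\<^sub>L adj A) + (A' o\<^sub>L Q o\<^sub>L adj (A - A'))"
    by (rule blinfun_eqI) (simp add: adj_diff blinfun.diff_left blinfun.diff_right blinfun.add_left)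
  moreover have "norm ((A - A') o\<^sub>L Q o\<^sub>L adj A) \<le> e * q * k"
    by (rule norm_compose3_le[OF assms(3,4) order_trans[OF norm_adj_le assms(1)]])
  moreover have "norm (A' o\<^sub>L Q o\<^sub>L adj (A - A')) \<le> k * q * e"
    by (rule norm_compose3_le[OF assms(2,4) order_trans[OF norm_adj_le assms(3)]])
  ultimately have "norm (conj_by A Q - conj_by A' Q) \<le> e * q * k + k * q * e"
    by (simp only: norm_triangle_mono)
  then show ?thesis by (simp add: algebra_simps)
qed

text \<open>Both solutions are bounded by \<open>m\<close>, so the quadratic term feeds the difference back with factor
  \<open>2 g m k\<^sup>2 / \<kappa>\<close>, at most one half; the remaining terms come from the difference of the
  evolution operators.\<close>

lemma riccati_lipschitz:
  fixes U U' :: "real \<Rightarrow> real \<Rightarrow> ('a::{real_inner,banach} \<Rightarrow>\<^sub>L 'a)"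
  assumes U: "hilbert_evol tf U" "hilbert_evol tf U'"
    and k: "\<And>s t. 0 \<le> s \<Longrightarrow> s \<le> t \<Longrightarrow> t \<le> tf \<Longrightarrow> norm (U t s) \<le> k"
      "\<And>s t. 0 \<le> s \<Longrightarrow> s \<le> t \<Longrightarrow> t \<le> tf \<Longrightarrow> norm (U' t s) \<le> k" "0 \<le> k"
    and e: "\<And>s t. 0 \<le> s \<Longrightarrow> s \<le> t \<Longrightarrow> t \<le> tf \<Longrightarrow> norm (U t s - U' t s) \<le> e * exp (\<kappa> * t)" "0 \<le> e"
    and P: "scont {0..tf} P" "scont {0..tf} P'"
      "\<And>t. t \<in> {0..tf} \<Longrightarrow> norm (P t) \<le> m" "\<And>t. t \<in> {0..tf} \<Longrightarrow> norm (P' t) \<le> m"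
    and P0: "norm P0 \<le> p0"
    and W: "scont {0..tf} W" "\<And>t. t \<in> {0..tf} \<Longrightarrow> norm (W t) \<le> b"
    and G: "scont {0..tf} G" "\<And>t. t \<in> {0..tf} \<Longrightarrow> norm (G t) \<le> g"
    and eq: "\<And>t. t \<in> {0..tf} \<Longrightarrow> P t = lyap U P0 (riccati_term W G P) t"
    and eq': "\<And>t. t \<in> {0..tf} \<Longrightarrow> P' t = lyap U' P0 (riccati_term W G P') t"
    and \<kappa>: "0 < \<kappa>" "4 * k\<^sup>2 * g * m \<le> \<kappa>" and t: "t \<in> {0..tf}"
  shows "norm (P t - P' t) \<le> 2 * (2 * k * e * (p0 + tf * (b + m * g * m))) * exp (\<kappa> * t)"
proof (rule weighted_bound[where I = "{0..tf}" and f = "\<lambda>t. norm (P t - P' t)" and i = t and b = "2 * m"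
      and \<omega> = "\<lambda>t. exp (\<kappa> * t)"])
  note nn = order_trans[OF norm_ge_zero]
  have m0: "0 \<le> m" by (rule nn[OF P(3)[OF t]])
  have g0: "0 \<le> g" by (rule nn[OF G(2)[OF t]])
  have b0: "0 \<le> b" by (rule nn[OF W(2)[OF t]])
  have p00: "0 \<le> p0" by (rule nn[OF P0])
  define n where "n = b + m * g * m"
  have n0: "0 \<le> n" using m0 g0 b0 by (simp add: n_def)
  show "0 \<le> 2 * k * e * (p0 + tf * (b + m * g * m))"
    using k(3) e(2) p00 n0 t by (auto simp: n_def[symmetric])
  show "norm (P r - P' r) \<le> 2 * m * exp (\<kappa> * r)" if r: "r \<in> {0..tf}" for r
  proof -
    have "norm (P r - P' r) \<le> 2 * m * 1"
      using norm_triangle_ineq4[of "P r" "P' r"] P(3)[OF r] P(4)[OF r] by linarith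
    also have "\<dots> \<le> 2 * m * exp (\<kappa> * r)" by (rule mult_left_mono) (use \<kappa> r m0 in auto)
    finally show ?thesis .
  qed
  fix c r assume c: "0 \<le> c" and h: "\<And>i. i \<in> {0..tf} \<Longrightarrow> norm (P i - P' i) \<le> c * exp (\<kappa> * i)"
    and r: "r \<in> {0..tf}"
  define N where "N s = W s - (P s o\<^sub>L G s o\<^sub>L P s)" for s
  define N' where "N' s = W s - (P' s o\<^sub>L G s o\<^sub>L P' s)" for s
  have N: "scont {0..tf} N" "scont {0..tf} N'"
    unfolding N_def[abs_def] N'_def[abs_def] by (intro scont_diff scont_compose W G P)+
  have Nn: "norm (N s) \<le> n" if s: "s \<in> {0..tf}" for s
    unfolding N_def n_def
    using norm_triangle_ineq4[of "W s" "P s o\<^sub>L G s o\<^sub>L P s"] W(2)[OF s]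
      norm_compose3_le[OF P(3)[OF s] G(2)[OF s] P(3)[OF s]] by linarith
  let ?E = "exp (\<kappa> * r)"
  have ker: "scont {0..r} (\<lambda>s. conj_by (U r s) (N s))" "scont {0..r} (\<lambda>s. conj_by (U' r s) (N s))"
    "scont {0..r} (\<lambda>s. conj_by (U' r s) (N' s))"
    using r by (auto intro!: hilbert_evol.conj_kernel U N)
  have split: "P r - P' r = (conj_by (U r 0) P0 - conj_by (U' r 0) P0)
     + (sint 0 r (\<lambda>s. conj_by (U r s) (N s) - conj_by (U' r s) (N s))
     + sint 0 r (\<lambda>s. conj_by (U' r s) (N s) - conj_by (U' r s) (N' s)))"
    unfolding sint_diff[OF ker(1,2), symmetric] sint_diff[OF ker(2,3), symmetric] eq[OF r] eq'[OF r]
    by (simp add: lyap_def N_def[symmetric] N'_def[symmetric])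
  have 1: "norm (conj_by (U r 0) P0 - conj_by (U' r 0) P0) \<le> 2 * k * (e * ?E) * p0"
    by (rule norm_conj_diff_le[OF k(1) k(2) e(1) P0]) (use r in auto)
  have "norm (sint 0 r (\<lambda>s. conj_by (U r s) (N s) - conj_by (U' r s) (N s))) \<le> (2 * k * (e * ?E) * n) * (r - 0)"
  proof (rule sint_norm_le_const[OF scont_diff[OF ker(1,2)]])
    show "norm (conj_by (U r s) (N s) - conj_by (U' r s) (N s)) \<le> 2 * k * (e * ?E) * n"
      if "s \<in> {0..r}" for s
      by (rule norm_conj_diff_le[OF k(1) k(2) e(1) Nn]) (use r that in auto)
  qed (use r in auto)
  also have "\<dots> \<le> (2 * k * (e * ?E) * n) * tf"
    by (rule mult_left_mono) (use r k(3) e(2) n0 in auto)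
  finally have 2: "norm (sint 0 r (\<lambda>s. conj_by (U r s) (N s) - conj_by (U' r s) (N s)))
      \<le> (2 * k * (e * ?E) * n) * tf" .
  have 3: "norm (sint 0 r (\<lambda>s. conj_by (U' r s) (N s) - conj_by (U' r s) (N' s)))
      \<le> (k * (2 * g * m * c) * k) / \<kappa> * ?E"
  proof (rule sint_norm_le_exp[OF scont_diff[OF ker(2,3)] _ _ \<kappa>(1)])
    fix s assume s: "s \<in> {0..r}"
    then have s': "s \<in> {0..tf}" using r by simp
    have NN: "norm (N s - N' s) \<le> 2 * g * m * c * exp (\<kappa> * s)"
      using riccati_term_diff_le[where s = s and P = P and P' = P' and G = G and W = W,
          OF P(3)[OF s'] P(4)[OF s'] G(2)[OF s'] h[OF s']]
      by (simp add: N_def N'_def mult.assoc)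
    have kts: "norm (U' r s) \<le> k" using k s r by simp
    have "norm (conj_by (U' r s) (N s - N' s)) \<le> k * (2 * g * m * c * exp (\<kappa> * s)) * k"
      by (rule norm_compose3_le[OF kts NN order_trans[OF norm_adj_le kts]])
    moreover have "conj_by (U' r s) (N s) - conj_by (U' r s) (N' s)
        = conj_by (U' r s) (N s - N' s)"
      by (rule blinfun_eqI) (simp add: blinfun.diff_left blinfun.diff_right)
    ultimately show "norm (conj_by (U' r s) (N s) - conj_by (U' r s) (N' s))
        \<le> (k * (2 * g * m * c) * k) * exp (\<kappa> * s)"
      by (simp add: mult_ac)
  qed (use r k(3) g0 m0 c in auto)
  have 4: "(k * (2 * g * m * c) * k) / \<kappa> \<le> c / 2"
  proof -
    have "4 * k\<^sup>2 * g * m * c \<le> \<kappa> * c" by (rule mult_right_mono[OF \<kappa>(2) c])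
    then show ?thesis using \<kappa>(1) by (simp add: field_simps power2_eq_square)
  qed
  have "norm (P r - P' r) \<le> 2 * k * (e * ?E) * p0 + ((2 * k * (e * ?E) * n) * tf + (k * (2 * g * m * c) * k) / \<kappa> * ?E)"
    unfolding split by (intro norm_triangle_mono 1 2 3)
  also have "\<dots> \<le> 2 * k * (e * ?E) * p0 + ((2 * k * (e * ?E) * n) * tf + c / 2 * ?E)"
    by (intro add_mono order_refl mult_right_mono 4) simp
  also have "\<dots> = (2 * k * e * (p0 + tf * (b + m * g * m)) + c / 2) * ?E"
    by (simp add: n_def algebra_simps)
  finally show "norm (P r - P' r) \<le> (2 * k * e * (p0 + tf * (b + m * g * m)) + c / 2) * exp (\<kappa> * r)" .
qed (use t in auto)

section \<open>The data of the filter\<close>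

text \<open>Strong continuity of the inverse follows from
  \<open>S t v - S t0 v = S t ((R t0 - R t) (S t0 v))\<close> and the bound \<open>1 / d\<close>.\<close>

lemma coercive_inverse_family:
  fixes R :: "real \<Rightarrow> ((real^'p) \<Rightarrow>\<^sub>L (real^'p))"
  assumes R: "strongly_continuous_on I R" and sa: "\<And>t. t \<in> I \<Longrightarrow> self_adjoint (R t)"
    and d: "d > 0" "\<And>t w. t \<in> I \<Longrightarrow> d * (norm w)\<^sup>2 \<le> w \<bullet> R t w"
  shows "\<exists>S. scont I S \<and> (\<forall>t\<in>I. blinfun_apply (S t) = inv (R t) \<and> self_adjoint (S t)
      \<and> (\<forall>v. 0 \<le> S t v \<bullet> v) \<and> norm (S t) \<le> 1 / d)"
proof -
  define S where "S t = Blinfun (inv (blinfun_apply (R t)))" for t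
  have low: "d * norm w \<le> norm (R t w)" if t: "t \<in> I" for t w
  proof (cases "w = 0")
    case False
    have "d * norm w * norm w \<le> norm w * norm (R t w)"
      using d(2)[OF t, of w] norm_cauchy_schwarz[of w "R t w"] by (simp add: power2_eq_square mult.assoc)
    then show ?thesis using False by (simp add: mult.commute[of "norm w"])
  qed simp
  have inj: "inj (blinfun_apply (R t))" if t: "t \<in> I" for t
  proof (rule injI)
    fix x y assume "R t x = R t y"
    then have "R t (x - y) = 0" by (simp add: blinfun.diff_right)
    then have "d * norm (x - y) \<le> 0" using low[OF t, of "x - y"] by simp
    then show "x = y" using d(1) by (simp add: mult_le_0_iff)
  qed
  have lin: "linear (blinfun_apply (R t))" for t
    by (simp add: blinfun.bounded_linear_right bounded_linear.linear)
  have surj: "surj (blinfun_apply (R t))" if "t \<in> I" for t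
    by (rule linear_injective_imp_surjective[OF lin inj[OF that]]) (rule refl)
  have RS: "R t (inv (R t) v) = v" if "t \<in> I" for t v
    by (rule surj_f_inv_f[OF surj[OF that]])
  have bl: "bounded_linear (inv (blinfun_apply (R t)))" if t: "t \<in> I" for t
    unfolding linear_conv_bounded_linear[symmetric]
    by (rule linearI; rule injD[OF inj[OF t]]) (simp_all add: blinfun.add_right blinfun.scaleR_right RS[OF t])
  have S: "blinfun_apply (S t) = inv (R t)" if "t \<in> I" for t
    unfolding S_def by (rule bounded_linear_Blinfun_apply[OF bl[OF that]])
  have RSv: "R t (S t v) = v" if "t \<in> I" for t v using RS[OF that] by (simp add: S[OF that])
  have SR: "S t (R t v) = v" if "t \<in> I" for t v using inv_f_f[OF inj[OF that]] by (simp add: S[OF that])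
  have nrm: "norm (S t v) \<le> 1 / d * norm v" if t: "t \<in> I" for t v
    using low[OF t, of "S t v"] d(1) by (simp add: RSv[OF t] field_simps)
  have nS: "norm (S t) \<le> 1 / d" if t: "t \<in> I" for t
    by (rule norm_blinfun_bound[OF _ nrm[OF t]]) (use d in simp)
  have Ssa: "self_adjoint (S t)" if t: "t \<in> I" for t
    unfolding self_adjoint_iff
  proof (intro allI)
    fix x y
    have "S t x \<bullet> R t (S t y) = R t (S t x) \<bullet> S t y" using sa[OF t] by (simp add: self_adjoint_iff)
    then show "S t x \<bullet> y = x \<bullet> S t y" by (simp add: RSv[OF t])
  qed
  have Spos: "0 \<le> S t v \<bullet> v" if t: "t \<in> I" for t v
  proof -
    have "0 \<le> d * (norm (S t v))\<^sup>2" using d(1) by simp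
    also have "\<dots> \<le> S t v \<bullet> R t (S t v)" by (rule d(2)[OF t])
    finally show ?thesis by (simp only: RSv[OF t])
  qed
  have "continuous_on I (\<lambda>t. S t v)" for v
    unfolding continuous_on_def
  proof
    fix t0 assume t0: "t0 \<in> I"
    have "((\<lambda>t. S t v - S t0 v) \<longlongrightarrow> 0) (at t0 within I)"
    proof (rule Lim_null_comparison)
      have "eventually (\<lambda>t. t \<in> I) (at t0 within I)" by (simp add: eventually_at_filter)
      then show "eventually (\<lambda>t. norm (S t v - S t0 v) \<le> 1 / d * norm (R t0 (S t0 v) - R t (S t0 v))) (at t0 within I)"
      proof eventually_elim
        case (elim t)
        have "S t v - S t0 v = S t (R t0 (S t0 v) - R t (S t0 v))"
          by (simp add: blinfun.diff_right RSv[OF t0] SR[OF elim])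
        then show ?case using nrm[OF elim] by simp
      qed
      have "((\<lambda>t. R t (S t0 v)) \<longlongrightarrow> R t0 (S t0 v)) (at t0 within I)"
        using R t0 by (auto simp: strongly_continuous_on_def continuous_on_def)
      then have "((\<lambda>t. 1 / d * norm (R t0 (S t0 v) - R t (S t0 v))) \<longlongrightarrow> 1 / d * norm (R t0 (S t0 v) - R t0 (S t0 v))) (at t0 within I)"
        by (intro tendsto_mult tendsto_norm tendsto_diff tendsto_const)
      then show "((\<lambda>t. 1 / d * norm (R t0 (S t0 v) - R t (S t0 v))) \<longlongrightarrow> 0) (at t0 within I)" by simp
    qed
    then show "((\<lambda>t. S t v) \<longlongrightarrow> S t0 v) (at t0 within I)" by (simp add: LIM_zero_iff)
  qed
  then have "scont I S" using nS by (intro scontI)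
  then show ?thesis using S Ssa Spos nS by blast
qed

lemma continuous_on_lipschitz_family:
  fixes f :: "'a::real_normed_vector \<Rightarrow> 'x::topological_space \<Rightarrow> 'b::real_normed_vector"
  assumes z: "continuous_on X z" and f: "\<And>x. continuous_on X (f x)"
    and lip: "\<And>x y t. t \<in> X \<Longrightarrow> norm (f x t - f y t) \<le> L * norm (x - y)"
  shows "continuous_on X (\<lambda>t. f (z t) t)"
  unfolding continuous_on_def
proof
  fix t0 assume t0: "t0 \<in> X"
  have zl: "(z \<longlongrightarrow> z t0) (at t0 within X)" using z t0 by (auto simp: continuous_on_def)
  have "((\<lambda>t. f (z t) t - f (z t0) t) \<longlongrightarrow> 0) (at t0 within X)"
  proof (rule Lim_null_comparison)
    have "eventually (\<lambda>t. t \<in> X) (at t0 within X)" by (simp add: eventually_at_filter)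
    then show "eventually (\<lambda>t. norm (f (z t) t - f (z t0) t) \<le> L * norm (z t - z t0)) (at t0 within X)"
      by eventually_elim (rule lip)
    have "((\<lambda>t. L * norm (z t - z t0)) \<longlongrightarrow> L * norm (z t0 - z t0)) (at t0 within X)"
      by (intro tendsto_intros zl)
    then show "((\<lambda>t. L * norm (z t - z t0)) \<longlongrightarrow> 0) (at t0 within X)" by simp
  qed
  moreover have "(f (z t0) \<longlongrightarrow> f (z t0) t0) (at t0 within X)" using f t0 by (auto simp: continuous_on_def)
  ultimately have "((\<lambda>t. (f (z t) t - f (z t0) t) + f (z t0) t) \<longlongrightarrow> 0 + f (z t0) t0) (at t0 within X)"
    by (rule tendsto_add)
  then show "((\<lambda>t. f (z t) t) \<longlongrightarrow> f (z t0) t0) (at t0 within X)" by simp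
qed

text \<open>Continuity in time is hypothesized for \<open>F\<close> only.  Since the derivative is Lipschitz in its
  base point uniformly in time, it is a uniform limit in time of difference quotients of \<open>F\<close>.\<close>

lemma derivative_continuous_in_parameter:
  fixes F :: "'a::real_normed_vector \<Rightarrow> 'x::topological_space \<Rightarrow> 'b::real_normed_vector"
    and DF :: "'a \<Rightarrow> 'x \<Rightarrow> ('a \<Rightarrow>\<^sub>L 'b)"
  assumes F: "\<And>x. continuous_on X (F x)"
    and deriv: "\<And>t x. t \<in> X \<Longrightarrow> ((\<lambda>v. F v t) has_derivative DF x t) (at x)"
    and lip: "\<And>x y t. t \<in> X \<Longrightarrow> norm (DF x t - DF y t) \<le> L * norm (x - y)" and L: "0 \<le> L"
  shows "continuous_on X (\<lambda>t. blinfun_apply (DF x t) w)"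
proof -
  have est: "norm (F (x + h) t - F x t - DF x t h) \<le> L * norm h * norm h" if t: "t \<in> X" for t h
  proof -
    have "norm ((F (x + h) t - DF x t (x + h)) - (F x t - DF x t x)) \<le> (L * norm h) * norm ((x + h) - x)"
    proof (rule differentiable_bound[where S = "cball x (norm h)" and f = "\<lambda>v. F v t - DF x t v"
          and f' = "\<lambda>v. blinfun_apply (DF v t - DF x t)"])
      show "((\<lambda>v. F v t - DF x t v) has_derivative blinfun_apply (DF v t - DF x t)) (at v within cball x (norm h))"
        if "v \<in> cball x (norm h)" for v
      proof -
        have "((\<lambda>v. F v t - DF x t v) has_derivative (\<lambda>u. DF v t u - DF x t u)) (at v)"
          by (intro has_derivative_diff deriv[OF t] bounded_linear_imp_has_derivative blinfun.bounded_linear_right)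
        then show ?thesis by (simp add: blinfun.diff_left[abs_def, symmetric] has_derivative_at_withinI fun_eq_iff
            blinfun.diff_left)
      qed
      show "onorm (blinfun_apply (DF v t - DF x t)) \<le> L * norm h" if "v \<in> cball x (norm h)" for v
      proof -
        have "norm (DF v t - DF x t) \<le> L * norm (v - x)" by (rule lip[OF t])
        also have "\<dots> \<le> L * norm h" by (rule mult_left_mono) (use that L in \<open>auto simp: dist_norm norm_minus_commute\<close>)
        finally show ?thesis by (simp add: norm_blinfun.rep_eq)
      qed
    qed (auto simp: dist_norm)
    then show ?thesis by (simp add: blinfun.add_right algebra_simps)
  qed
  have lim: "uniform_limit X (\<lambda>n t. real (Suc n) *\<^sub>R (F (x + (1 / real (Suc n)) *\<^sub>R w) t - F x t)) (\<lambda>t. DF x t w) sequentially"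
    unfolding uniform_limit_iff
  proof (intro allI impI)
    fix e :: real assume e: "e > 0"
    have "(\<lambda>n. L * norm w * norm w * (1 / real (Suc n))) \<longlonglongrightarrow> L * norm w * norm w * 0"
      by (intro tendsto_intros lim_inverse_n'[THEN LIMSEQ_Suc])
    then have "eventually (\<lambda>n. L * norm w * norm w * (1 / real (Suc n)) < e) sequentially"
      by (rule order_tendstoD(2)) (use e in simp)
    then show "\<forall>\<^sub>F n in sequentially. \<forall>t\<in>X. dist (real (Suc n) *\<^sub>R (F (x + (1 / real (Suc n)) *\<^sub>R w) t - F x t)) (DF x t w) < e"
    proof eventually_elim
      case (elim n)
      show ?case
      proof
        fix t assume t: "t \<in> X"
        let ?n = "real (Suc n)"
        have "?n *\<^sub>R (F (x + (1 / ?n) *\<^sub>R w) t - F x t) - DF x t w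
            = ?n *\<^sub>R (F (x + (1 / ?n) *\<^sub>R w) t - F x t - DF x t ((1 / ?n) *\<^sub>R w))"
          by (simp only: scaleR_diff_right blinfun.scaleR_right scaleR_scaleR) simp
        then have "norm (?n *\<^sub>R (F (x + (1 / ?n) *\<^sub>R w) t - F x t) - DF x t w)
            = ?n * norm (F (x + (1 / ?n) *\<^sub>R w) t - F x t - DF x t ((1 / ?n) *\<^sub>R w))" by simp
        also have "\<dots> \<le> ?n * (L * norm ((1 / ?n) *\<^sub>R w) * norm ((1 / ?n) *\<^sub>R w))"
          by (rule mult_left_mono[OF est[OF t]]) simp
        also have "\<dots> = L * norm w * norm w * (1 / ?n)"
        proof -
          have "N * (L * (x / N) * (x / N)) = L * x * x * (1 / N)" if "N > 0" for N x :: real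
            using that by (simp add: field_simps)
          from this[of ?n "norm w"] show ?thesis by simp
        qed
        finally show "dist (?n *\<^sub>R (F (x + (1 / ?n) *\<^sub>R w) t - F x t)) (DF x t w) < e"
          using elim by (simp add: dist_norm)
      qed
    qed
  qed
  show ?thesis
    by (rule uniform_limit_theorem[OF _ lim]) (auto intro!: always_eventually continuous_intros F)
qed

lemma convolution_continuous:
  fixes T :: "real \<Rightarrow> ('a::banach \<Rightarrow>\<^sub>L 'a)"
  assumes T: "scont {0..tf} T" and v: "continuous_on {0..tf} v"
  shows "continuous_on {0..tf} (\<lambda>t. integral {0..t} (\<lambda>s. T (t - s) (v s)))"
    and "\<And>t. t \<in> {0..tf} \<Longrightarrow> continuous_on {0..t} (\<lambda>s. T (t - s) (v s))"
proof -
  let ?X = "{(t, s). t \<in> {0..tf} \<and> 0 \<le> s \<and> s \<le> t}"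
  have vX: "continuous_on ?X (\<lambda>p. v (snd p))"
    by (rule continuous_on_compose2[OF v]) (auto intro!: continuous_intros)
  have TX: "scont ?X (\<lambda>p. T (fst p - snd p))"
    by (rule scont_reparam[OF T]) (auto intro!: continuous_intros)
  show "continuous_on {0..tf} (\<lambda>t. integral {0..t} (\<lambda>s. T (t - s) (v s)))"
    by (rule integral_continuous_moving)
      (use scont_apply[OF TX vX] in \<open>auto intro!: continuous_intros simp: case_prod_unfold\<close>)
  fix t assume t: "t \<in> {0..tf}"
  have "continuous_on {0..t} v" by (rule continuous_on_subset[OF v]) (use t in auto)
  moreover have "scont {0..t} (\<lambda>s. T (t - s))"
    by (rule scont_reparam[OF T]) (use t in \<open>auto intro!: continuous_intros\<close>)
  ultimately show "continuous_on {0..t} (\<lambda>s. T (t - s) (v s))" by (intro scont_apply)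
qed

section \<open>The coupled system\<close>

theorem mainTheorem1:
  fixes tf :: real
    and D_A :: "'h::{real_inner,banach} set" and A :: "'h \<Rightarrow> 'h"
    and T :: "real \<Rightarrow> ('h \<Rightarrow>\<^sub>L 'h)"
    and B :: "'k::{real_inner,banach} \<Rightarrow>\<^sub>L 'h"
    and C :: "'h \<Rightarrow>\<^sub>L (real^'p)"
    and F :: "'h \<Rightarrow> real \<Rightarrow> 'h" and DF :: "'h \<Rightarrow> real \<Rightarrow> ('h \<Rightarrow>\<^sub>L 'h)"
    and P0 :: "'h \<Rightarrow>\<^sub>L 'h" and W :: "real \<Rightarrow> ('h \<Rightarrow>\<^sub>L 'h)"
    and R :: "real \<Rightarrow> ((real^'p) \<Rightarrow>\<^sub>L (real^'p))"
    and u :: "real \<Rightarrow> 'k" and y :: "real \<Rightarrow> real^'p" and z0 :: 'h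
  assumes tf_pos: "tf > 0"
    and A_generates: "generates D_A A T"
    and F_cont: "\<forall>x. continuous_on {0..tf} (\<lambda>t. F x t)"
    and F_zero: "\<forall>t\<in>{0..tf}. F 0 t = 0"
    and F_deriv: "\<forall>t\<in>{0..tf}. \<forall>x. ((\<lambda>v. F v t) has_derivative DF x t) (at x)"
    and DF_bounded: "\<exists>d>0. \<forall>x. \<forall>t\<in>{0..tf}. norm (DF x t) \<le> d"
    and DF_lipschitz: "\<forall>d>0. \<exists>l>0. \<forall>x v. norm (x - v) < d \<longrightarrow>
          (\<forall>t\<in>{0..tf}. norm (DF x t - DF v t) \<le> l * norm (x - v))"
    and P0_self_adjoint: "self_adjoint P0"
    and P0_pos: "\<forall>v. v \<noteq> 0 \<longrightarrow> v \<bullet> P0 v > 0"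
    and W_cont: "strongly_continuous_on {0..tf} W"
    and W_self_adjoint: "\<forall>t\<in>{0..tf}. self_adjoint (W t)"
    and W_nonneg: "\<forall>t\<in>{0..tf}. \<forall>v. v \<bullet> W t v \<ge> 0"
    and R_cont: "strongly_continuous_on {0..tf} R"
    and R_self_adjoint: "\<forall>t\<in>{0..tf}. self_adjoint (R t)"
    and R_coercive: "\<exists>d>0. \<forall>t\<in>{0..tf}. \<forall>w. w \<bullet> R t w \<ge> d * (norm w)\<^sup>2"
    and u_cont: "continuous_on {0..tf} u"
    and y_cont: "continuous_on {0..tf} y"
  shows "\<exists>(z :: real \<Rightarrow> 'h) (P :: real \<Rightarrow> ('h \<Rightarrow>\<^sub>L 'h)) U UP.
           continuous_on {0..tf} z \<and>
           strongly_continuous_on {0..tf} P \<and>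
           evolution_operator tf U \<and>
           evolution_operator tf UP \<and>
           estimator_equation tf T F B C R u y z0 P z \<and>
           covariance_equation tf P0 W U UP P \<and>
           linearized_evolution_equation tf T DF z U \<and>
           closed_loop_evolution_equation tf C R P U UP"
proof -
  have T_sg: "C0_semigroup T" using A_generates by (simp add: generates_def)
  note Tsc = C0_semigroup_scont[OF T_sg, of tf]
  note evT = evol_semigroup[OF T_sg, of tf]
  obtain M where M: "M \<ge> 0" "\<And>t. t \<in> {0..tf} \<Longrightarrow> norm (T t) \<le> M" using scont_bound[OF Tsc] by blast
  have MT: "norm (T (t - s)) \<le> M" if "0 \<le> s" "s \<le> t" "t \<le> tf" for s t using M(2) that by simp
  obtain \<delta> where \<delta>: "\<delta> > 0" "\<And>x t. t \<in> {0..tf} \<Longrightarrow> norm (DF x t) \<le> \<delta>" using DF_bounded by blast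
  obtain l1 where l1: "l1 > 0" "\<And>x v t. norm (x - v) < 1 \<Longrightarrow> t \<in> {0..tf} \<Longrightarrow> norm (DF x t - DF v t) \<le> l1 * norm (x - v)"
    using DF_lipschitz[rule_format, of 1] by auto
  \<comment> \<open>The bound on \<open>DF\<close> takes care of points at distance at least \<open>1\<close>.\<close>
  define L where "L = l1 + 2 * \<delta>"
  have L: "L \<ge> 0" using l1 \<delta> by (simp add: L_def)
  have DF_lip: "norm (DF x t - DF v t) \<le> L * norm (x - v)" if t: "t \<in> {0..tf}" for x v t
  proof (cases "norm (x - v) < 1")
    case True
    have "l1 * norm (x - v) \<le> L * norm (x - v)" using \<delta> by (intro mult_right_mono) (auto simp: L_def)
    then show ?thesis using l1(2)[OF True t] by simp
  next
    case False
    have "norm (DF x t - DF v t) \<le> 2 * \<delta> * 1"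
      using norm_triangle_ineq4[of "DF x t" "DF v t"] \<delta>(2)[OF t, of x] \<delta>(2)[OF t, of v] by linarith
    also have "\<dots> \<le> L * norm (x - v)" using False l1 \<delta> by (intro mult_mono) (auto simp: L_def)
    finally show ?thesis .
  qed
  have F_lip: "norm (F x t - F v t) \<le> \<delta> * norm (x - v)" if t: "t \<in> {0..tf}" for x v t
    by (rule differentiable_bound[where S = UNIV and f = "\<lambda>v. F v t" and f' = "\<lambda>v. blinfun_apply (DF v t)"])
      (use F_deriv t \<delta>(2)[OF t] in \<open>auto simp: norm_blinfun.rep_eq[symmetric]\<close>)
  have DF_cont: "continuous_on {0..tf} (\<lambda>t. DF x t w)" for x w
    by (rule derivative_continuous_in_parameter[where F = F, OF _ _ DF_lip L]) (use F_cont F_deriv in auto)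
  have D_scont: "scont {0..tf} (\<lambda>r. DF (z r) r)" if z: "continuous_on {0..tf} z" for z
  proof (rule scontI[where k = \<delta>])
    show "continuous_on {0..tf} (\<lambda>r. DF (z r) r w)" for w
    proof (rule continuous_on_lipschitz_family[OF z, where f = "\<lambda>x t. DF x t w" and L = "L * norm w"])
      show "norm (DF x t w - DF v t w) \<le> L * norm w * norm (x - v)" if "t \<in> {0..tf}" for x v t
        using order_trans[OF norm_blinfun[of "DF x t - DF v t" w] mult_right_mono[OF DF_lip[OF that] norm_ge_zero]]
        by (simp add: blinfun.diff_left mult_ac)
    qed (rule DF_cont)
  qed (rule \<delta>(2))
  have Fz_cont: "continuous_on {0..tf} (\<lambda>s. F (z s) s)" if "continuous_on {0..tf} z" for z
    by (rule continuous_on_lipschitz_family[OF that _ F_lip]) (use F_cont in auto)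
  obtain dR where dR: "dR > 0" "\<And>t w. t \<in> {0..tf} \<Longrightarrow> dR * (norm w)\<^sup>2 \<le> w \<bullet> R t w" using R_coercive by blast
  obtain S where S: "scont {0..tf} S" "\<And>t. t \<in> {0..tf} \<Longrightarrow> blinfun_apply (S t) = inv (R t)"
      "\<And>t. t \<in> {0..tf} \<Longrightarrow> self_adjoint (S t)" "\<And>t v. t \<in> {0..tf} \<Longrightarrow> 0 \<le> S t v \<bullet> v"
      "\<And>t. t \<in> {0..tf} \<Longrightarrow> norm (S t) \<le> 1 / dR"
    using coercive_inverse_family[OF R_cont _ dR] R_self_adjoint by metis
  define H where "H t = adj C o\<^sub>L S t" for t
  define G where "G t = H t o\<^sub>L C" for t
  have H: "scont {0..tf} H" unfolding H_def[abs_def] by (intro scont_compose scont_const S(1))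
  have G: "scont {0..tf} G" unfolding G_def[abs_def] by (intro scont_compose scont_const H)
  have G_self: "self_adjoint (G t)" if "t \<in> {0..tf}" for t
  proof -
    have "G t x \<bullet> y = S t (C x) \<bullet> C y" for x y by (simp add: G_def H_def adj_inner')
    moreover have "S t (C x) \<bullet> C y = S t (C y) \<bullet> C x" for x y
      using S(3)[OF that] by (metis inner_commute self_adjoint_iff)
    ultimately show ?thesis unfolding self_adjoint_iff by (metis inner_commute)
  qed
  have G_pos: "0 \<le> G t x \<bullet> x" if "t \<in> {0..tf}" for t x
    using S(4)[OF that] by (simp add: G_def H_def adj_inner')
  obtain hb where hb: "hb \<ge> 0" "\<And>t. t \<in> {0..tf} \<Longrightarrow> norm (H t) \<le> hb" using scont_bound[OF H] by blast
  obtain g where g: "g \<ge> 0" "\<And>t. t \<in> {0..tf} \<Longrightarrow> norm (G t) \<le> g" using scont_bound[OF G] by blast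
  have W: "scont {0..tf} W"
    by (rule scont_of_compact) (use W_cont in \<open>auto simp: strongly_continuous_on_def\<close>)
  obtain b where b: "b \<ge> 0" "\<And>t. t \<in> {0..tf} \<Longrightarrow> norm (W t) \<le> b" using scont_bound[OF W] by blast
  have W_pos: "0 \<le> W t x \<bullet> x" if "t \<in> {0..tf}" for t x using W_nonneg that by (simp add: inner_commute)
  have P0_nonneg: "0 \<le> P0 x \<bullet> x" for x
    using P0_pos by (cases "x = 0") (auto simp: inner_commute less_imp_le)
  define k where "k = 2 * M * exp ((2 * M * \<delta> + 1) * tf)"
  have k0: "k \<ge> 0" using M by (simp add: k_def)
  define m where "m = k\<^sup>2 * (norm P0 + tf * b)"
  have m0: "m \<ge> 0" using b tf_pos by (simp add: m_def)
  define sol where "sol z U P \<longleftrightarrow> hilbert_evol tf U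
      \<and> perturbed tf (\<lambda>t s. T (t - s)) (\<lambda>r. DF (z r) r) U
      \<and> (\<forall>s t. 0 \<le> s \<and> s \<le> t \<and> t \<le> tf \<longrightarrow> norm (U t s) \<le> k)
      \<and> scont {0..tf} P \<and> (\<forall>t\<in>{0..tf}. norm (P t) \<le> m)
      \<and> (\<forall>t\<in>{0..tf}. P t = lyap U P0 (riccati_term W G P) t)"
    for z :: "real \<Rightarrow> 'h" and U :: "real \<Rightarrow> real \<Rightarrow> ('h \<Rightarrow>\<^sub>L 'h)" and P :: "real \<Rightarrow> ('h \<Rightarrow>\<^sub>L 'h)"
  have sol_ex: "\<exists>U P. sol z U P" if z: "continuous_on {0..tf} z" for z
  proof -
    obtain U where U: "evol tf U" "perturbed tf (\<lambda>t s. T (t - s)) (\<lambda>r. DF (z r) r) U"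
      using evol_perturbation[OF evT D_scont[OF z]] by blast
    have Uk: "norm (U t s) \<le> k" if "0 \<le> s" "s \<le> t" "t \<le> tf" for s t
      unfolding k_def
      by (rule perturbation_bound[OF evolD(3)[OF evT] D_scont[OF z] evolD(3)[OF U(1)] M(1) MT _ \<delta>(2) U(2) that])
        (use \<delta> in auto)
    obtain c where c: "c \<ge> 0" "\<And>s t. 0 \<le> s \<Longrightarrow> s \<le> t \<Longrightarrow> t \<le> tf \<Longrightarrow> norm (U t s - T (t - s)) \<le> c * (t - s)"
      using perturbation_close[OF evolD(3)[OF evT] D_scont[OF z] evolD(3)[OF U(1)] U(2)] by blast
    have "joint_scont tf (\<lambda>t s. adj (U t s))"
      by (rule scont_adj_perturbation[OF _ scont_adj_semigroup[OF T_sg] U(1) c]) (use evolD(1)[OF evT] in auto)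
    then have he: "hilbert_evol tf U" using U(1) by unfold_locales
    have "\<exists>P. scont {0..tf} P \<and> (\<forall>t\<in>{0..tf}. norm (P t) \<le> m) \<and>
        (\<forall>t\<in>{0..tf}. P t = lyap U P0 (riccati_term W G P) t)"
      unfolding m_def
      by (rule hilbert_evol.riccati_solution[OF he P0_self_adjoint P0_nonneg order_refl W _ W_pos b(2) G G_self G_pos g(2,1) Uk])
        (use W_self_adjoint tf_pos in auto)
    then show ?thesis using U(2) Uk he unfolding sol_def by blast
  qed
  define UU where "UU z = (SOME U. \<exists>P. sol z U P)" for z
  define PP where "PP z = (SOME P. sol z (UU z) P)" for z
  have sol: "sol z (UU z) (PP z)" if "continuous_on {0..tf} z" for z
  proof -
    have "\<exists>P. sol z (UU z) P" unfolding UU_def by (rule someI_ex[OF sol_ex[OF that]])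
    then show ?thesis unfolding PP_def by (rule someI_ex)
  qed
  obtain ub where ub: "ub \<ge> 0" "\<And>t. t \<in> {0..tf} \<Longrightarrow> norm (u t) \<le> ub"
    using compact_imp_bounded[OF compact_continuous_image[OF u_cont compact_Icc]] unfolding bounded_pos
    by (metis image_eqI less_imp_le)
  obtain yb where yb: "yb \<ge> 0" "\<And>t. t \<in> {0..tf} \<Longrightarrow> norm (y t) \<le> yb"
    using compact_imp_bounded[OF compact_continuous_image[OF y_cont compact_Icc]] unfolding bounded_pos
    by (metis image_eqI less_imp_le)
  define src where "src z s = F (z s) s + B (u s) + PP z s (H s (y s - C (z s)))" for z s
  define \<Psi> where "\<Psi> z t = T t z0 + integral {0..t} (\<lambda>s. T (t - s) (src z s))" for z t
  have inn_cont: "continuous_on {0..tf} (\<lambda>s. PP z s (H s (y s - C (z s))))" if z: "continuous_on {0..tf} z" for z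
    using sol[OF z] unfolding sol_def
    by (intro scont_apply[of _ "PP z"] scont_apply[OF H] continuous_on_diff y_cont scont_apply[OF scont_const z]) auto
  have Bu_cont: "continuous_on {0..tf} (\<lambda>s. B (u s))" by (rule scont_apply[OF scont_const u_cont])
  have src_cont: "continuous_on {0..tf} (src z)" if z: "continuous_on {0..tf} z" for z
    unfolding src_def[abs_def] by (intro continuous_on_add Fz_cont[OF z] Bu_cont inn_cont[OF z])
  define c1 where "c1 = norm B * ub + m * (hb * yb)"
  define c2 where "c2 = \<delta> + m * (hb * norm C)"
  have c1: "c1 \<ge> 0" and c2: "c2 \<ge> 0" using ub yb hb m0 \<delta> by (auto simp: c1_def c2_def)
  have PH: "norm (PP z s (H s v)) \<le> m * (hb * norm v)" if "continuous_on {0..tf} z" "s \<in> {0..tf}" for z s v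
  proof -
    have "norm (PP z s (H s v)) \<le> norm (PP z s) * norm (H s v)" by (rule norm_blinfun)
    also have "\<dots> \<le> m * (hb * norm v)"
    proof (rule mult_mono)
      show "norm (PP z s) \<le> m" using sol[OF that(1)] that(2) unfolding sol_def by blast
      show "norm (H s v) \<le> hb * norm v"
        by (rule order_trans[OF norm_blinfun mult_right_mono[OF hb(2)[OF that(2)] norm_ge_zero]])
    qed (use m0 in auto)
    finally show ?thesis .
  qed
  have src_bound: "norm (src z s) \<le> c1 + c2 * norm (z s)" if z: "continuous_on {0..tf} z" and s: "s \<in> {0..tf}" for z s
  proof -
    have 1: "norm (F (z s) s) \<le> \<delta> * norm (z s)" using F_lip[OF s, of "z s" 0] F_zero s by simp
    have 2: "norm (B (u s)) \<le> norm B * ub"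
      by (rule order_trans[OF norm_blinfun mult_left_mono[OF ub(2)[OF s] norm_ge_zero]])
    have "norm (y s - C (z s)) \<le> yb + norm C * norm (z s)"
      by (rule order_trans[OF norm_triangle_ineq4]) (intro add_mono yb(2)[OF s] norm_blinfun)
    then have "m * (hb * norm (y s - C (z s))) \<le> m * (hb * (yb + norm C * norm (z s)))"
      by (intro mult_left_mono hb m0)
    with PH[OF z s, of "y s - C (z s)"]
    have 3: "norm (PP z s (H s (y s - C (z s)))) \<le> m * (hb * (yb + norm C * norm (z s)))" by linarith
    have "norm (src z s) \<le> \<delta> * norm (z s) + norm B * ub + m * (hb * (yb + norm C * norm (z s)))"
      unfolding src_def by (intro norm_triangle_mono 1 2 3)
    then show ?thesis by (simp add: c1_def c2_def algebra_simps)
  qed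
  \<comment> \<open>The linear growth of the source makes the exponential envelope \<open>a exp (e t)\<close> invariant.\<close>
  define e where "e = 2 * (M * c2) + 1"
  define a where "a = 2 * (M * norm z0 + M * c1)"
  have e0: "e > 0" using M c2 by (simp add: e_def add_nonneg_pos)
  have a0: "a \<ge> 0" using M c1 by (simp add: a_def)
  define Z :: "(real \<Rightarrow> 'h) set" where "Z = {z. continuous_on {0..tf} z \<and> (\<forall>t\<in>{0..tf}. norm (z t) \<le> a * exp (e * t))}"
  have Zc: "continuous_on {0..tf} z" and Zb: "\<And>t. t \<in> {0..tf} \<Longrightarrow> norm (z t) \<le> a * exp (e * t)" if "z \<in> Z" for z
    using that by (auto simp: Z_def)
  have ge1: "1 \<le> exp (c * t)" if "0 \<le> c" "0 \<le> t" for c t :: real using that by simp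
  have maps: "\<Psi> z \<in> Z" if z: "z \<in> Z" for z
  proof -
    note conv = convolution_continuous[OF Tsc src_cont[OF Zc[OF z]]]
    have "continuous_on {0..tf} (\<Psi> z)"
      unfolding \<Psi>_def[abs_def] by (intro continuous_on_add scont_cont[OF Tsc] conv(1))
    moreover have "norm (\<Psi> z t) \<le> a * exp (e * t)" if t: "t \<in> {0..tf}" for t
    proof -
      have "norm (integral {0..t} (\<lambda>s. T (t - s) (src z s))) \<le> (M * (c1 + c2 * a)) / e * exp (e * t)"
      proof (rule integral_norm_le_exp[OF conv(2)[OF t] _ _ e0])
        fix s assume s: "s \<in> {0..t}"
        then have s': "s \<in> {0..tf}" using t by simp
        have "norm (src z s) \<le> c1 + c2 * (a * exp (e * s))"
          using src_bound[OF Zc[OF z] s'] mult_left_mono[OF Zb[OF z s'] c2] by linarith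
        also have "\<dots> \<le> c1 * exp (e * s) + c2 * (a * exp (e * s))"
          using mult_left_mono[OF ge1[of e s] c1] e0 s by simp
        finally have 1: "norm (src z s) \<le> (c1 + c2 * a) * exp (e * s)" by (simp add: algebra_simps)
        have "norm (T (t - s) (src z s)) \<le> norm (T (t - s)) * norm (src z s)" by (rule norm_blinfun)
        also have "\<dots> \<le> M * ((c1 + c2 * a) * exp (e * s))"
          by (rule mult_mono[OF MT 1]) (use s t M in auto)
        finally show "norm (T (t - s) (src z s)) \<le> M * (c1 + c2 * a) * exp (e * s)" by (simp add: mult_ac)
      qed (use t M c1 c2 a0 in auto)
      moreover have "norm (T t z0) \<le> M * norm z0 * exp (e * t)"
      proof -
        have "norm (T t z0) \<le> M * norm z0"
          by (rule order_trans[OF norm_blinfun mult_right_mono[OF M(2)[OF t] norm_ge_zero]])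
        also have "\<dots> * 1 \<le> M * norm z0 * exp (e * t)"
          by (rule mult_left_mono[OF ge1]) (use e0 t M in auto)
        finally show ?thesis by simp
      qed
      ultimately have "norm (\<Psi> z t) \<le> M * norm z0 * exp (e * t) + (M * (c1 + c2 * a)) / e * exp (e * t)"
        unfolding \<Psi>_def by (intro norm_triangle_mono)
      also have "\<dots> = (M * norm z0 + (M * (c1 + c2 * a)) / e) * exp (e * t)" by (simp add: algebra_simps)
      also have "\<dots> \<le> a * exp (e * t)"
      proof (rule mult_right_mono)
        have "M * c1 \<le> M * c1 * e" using mult_left_mono[of 1 e "M * c1"] M c1 c2 by (simp add: e_def)
        moreover have "2 * (M * c2) * a \<le> e * a" by (rule mult_right_mono) (auto simp: e_def a0)
        ultimately have "(M * (c1 + c2 * a)) / e \<le> M * c1 + a / 2" using e0 by (simp add: field_simps)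
        moreover have "a / 2 = M * norm z0 + M * c1" by (simp add: a_def)
        ultimately show "M * norm z0 + (M * (c1 + c2 * a)) / e \<le> a" by linarith
      qed simp
      finally show ?thesis .
    qed
    ultimately show ?thesis by (simp add: Z_def)
  qed
  define \<rho> where "\<rho> = a * exp (e * tf)"
  have \<rho>: "\<rho> \<ge> 0" using a0 by (simp add: \<rho>_def)
  have Z\<rho>: "norm (z t) \<le> \<rho>" if "z \<in> Z" "t \<in> {0..tf}" for z t
  proof -
    have "a * exp (e * t) \<le> \<rho>" unfolding \<rho>_def by (rule mult_left_mono) (use that e0 a0 in auto)
    then show ?thesis using Zb[OF that] by linarith
  qed
  \<comment> \<open>\<open>\<beta> / \<kappa>\<close> is the Lipschitz constant of \<open>z \<mapsto> P\<close>, and \<open>hy\<close> bounds the innovation that a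
    difference of gains multiplies.  The summands of \<open>\<kappa>\<close> are what the estimates for \<open>U\<close>, for
    \<open>P\<close> and for \<open>z\<close> require in turn.\<close>
  define \<beta> where "\<beta> = 2 * (2 * k * (2 * (M * k * L)) * (norm P0 + tf * (b + m * g * m)))"
  have \<beta>: "\<beta> \<ge> 0" unfolding \<beta>_def using k0 M L b m0 g tf_pos by (intro mult_nonneg_nonneg add_nonneg_nonneg) auto
  define hy where "hy = hb * (yb + norm C * \<rho>)"
  have hy: "hy \<ge> 0" using hb yb \<rho> by (simp add: hy_def)
  define \<kappa> where "\<kappa> = 1 + 2 * M * \<delta> + 4 * k\<^sup>2 * g * m + 2 * (M * (c2 + \<beta> * hy))"
  have nn: "0 \<le> 2 * M * \<delta>" "0 \<le> 4 * k\<^sup>2 * g * m" "0 \<le> 2 * (M * (c2 + \<beta> * hy))"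
    using M \<delta> k0 g m0 c2 \<beta> hy by auto
  then have \<kappa>: "\<kappa> \<ge> 1" "2 * M * \<delta> \<le> \<kappa>" "4 * k\<^sup>2 * g * m \<le> \<kappa>" "2 * (M * (c2 + \<beta> * hy)) \<le> \<kappa>"
    by (auto simp: \<kappa>_def)
  then have \<kappa>0: "\<kappa> > 0" by simp
  have contr: "norm (\<Psi> z t - \<Psi> z' t) \<le> c / 2 * exp (\<kappa> * t)"
    if z: "z \<in> Z" "z' \<in> Z" and c: "0 \<le> c" and h: "\<And>s. s \<in> {0..tf} \<Longrightarrow> norm (z s - z' s) \<le> c * exp (\<kappa> * s)"
      and t: "t \<in> {0..tf}" for z z' c t
  proof -
    note s1 = sol[OF Zc[OF z(1)], unfolded sol_def] and s2 = sol[OF Zc[OF z(2)], unfolded sol_def]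
    have U1: "evol tf (UU z)" "evol tf (UU z')" using s1 s2 by (auto simp: hilbert_evol_def)
    have Ud: "norm (UU z t s - UU z' t s) \<le> 2 * (M * k * (L * c) / \<kappa>) * exp (\<kappa> * t)"
      if "0 \<le> s" "s \<le> t" "t \<le> tf" for s t
    proof (rule perturbation_lipschitz[OF evolD(3)[OF evT] D_scont[OF Zc[OF z(1)]] D_scont[OF Zc[OF z(2)]]
          evolD(3)[OF U1(1)] evolD(3)[OF U1(2)] M(1) MT _ \<delta>(2) k0])
      show "norm (DF (z r) r - DF (z' r) r) \<le> L * c * exp (\<kappa> * r)" if "0 \<le> r" "r \<le> tf" for r
        using order_trans[OF DF_lip mult_left_mono[OF h L], of r r] that by (simp add: mult_ac)
    qed (use s1 s2 \<delta> L c \<kappa> \<kappa>0 that in auto)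
    have Pd: "norm (PP z s - PP z' s) \<le> \<beta> * c * exp (\<kappa> * s)" if s: "s \<in> {0..tf}" for s
    proof -
      have "norm (PP z s - PP z' s)
          \<le> 2 * (2 * k * (2 * (M * k * (L * c) / \<kappa>)) * (norm P0 + tf * (b + m * g * m))) * exp (\<kappa> * s)"
        by (rule riccati_lipschitz[OF _ _ _ _ k0 Ud _ _ _ _ _ order_refl W b(2) G g(2) _ _ \<kappa>0 \<kappa>(3) s])
          (use s1 s2 M k0 L c \<kappa>0 in auto)
      also have "\<dots> = (\<beta> * c) / \<kappa> * exp (\<kappa> * s)" by (simp add: \<beta>_def)
      also have "\<dots> \<le> \<beta> * c * exp (\<kappa> * s)"
      proof (rule mult_right_mono)
        show "\<beta> * c / \<kappa> \<le> \<beta> * c" 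
          using mult_left_mono[OF \<kappa>(1) mult_nonneg_nonneg[OF \<beta> c]] \<kappa>0 by (simp add: field_simps)
      qed simp
      finally show ?thesis .
    qed
    have srcd: "norm (src z s - src z' s) \<le> (c2 + \<beta> * hy) * c * exp (\<kappa> * s)" if s: "s \<in> {0..tf}" for s
    proof -
      let ?E = "c * exp (\<kappa> * s)"
      have eq: "src z s - src z' s = (F (z s) s - F (z' s) s)
          + ((PP z s - PP z' s) (H s (y s - C (z s))) + PP z' s (H s (C (z' s - z s))))"
        by (simp add: src_def blinfun.diff_left blinfun.diff_right algebra_simps)
      have 1: "norm (F (z s) s - F (z' s) s) \<le> \<delta> * ?E"
        using F_lip[OF s, of "z s" "z' s"] mult_left_mono[OF h[OF s], of \<delta>] \<delta> by linarith
      have "norm (y s - C (z s)) \<le> yb + norm C * \<rho>"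
        by (rule order_trans[OF norm_triangle_ineq4])
          (intro add_mono yb(2)[OF s] order_trans[OF norm_blinfun mult_left_mono[OF Z\<rho>[OF z(1) s] norm_ge_zero]])
      then have "norm (H s (y s - C (z s))) \<le> hy"
        unfolding hy_def using hb by (intro order_trans[OF norm_blinfun] mult_mono hb(2)[OF s]) auto
      then have "norm (PP z s - PP z' s) * norm (H s (y s - C (z s))) \<le> (\<beta> * c * exp (\<kappa> * s)) * hy"
        by (intro mult_mono Pd[OF s]) (use \<beta> c in auto)
      then have 2: "norm ((PP z s - PP z' s) (H s (y s - C (z s)))) \<le> (\<beta> * ?E) * hy"
        using norm_blinfun[of "PP z s - PP z' s" "H s (y s - C (z s))"] by (simp add: mult_ac)
      have "norm (C (z' s - z s)) \<le> norm C * ?E"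
        using norm_blinfun[of C "z' s - z s"] mult_left_mono[OF h[OF s] norm_ge_zero[of C]]
        by (simp add: norm_minus_commute)
      then have 3: "norm (PP z' s (H s (C (z' s - z s)))) \<le> m * (hb * (norm C * ?E))"
        using PH[OF Zc[OF z(2)] s, of "C (z' s - z s)"] m0 hb
        by (meson mult_left_mono order_trans)
      have "norm (src z s - src z' s) \<le> \<delta> * ?E + ((\<beta> * ?E) * hy + m * (hb * (norm C * ?E)))"
        unfolding eq by (intro norm_triangle_mono 1 2 3)
      then show ?thesis by (simp add: c2_def algebra_simps)
    qed
    have cv: "continuous_on {0..t} (\<lambda>s. T (t - s) (src z s))" "continuous_on {0..t} (\<lambda>s. T (t - s) (src z' s))"
      by (rule convolution_continuous(2)[OF Tsc src_cont[OF Zc[OF z(1)]] t]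
          convolution_continuous(2)[OF Tsc src_cont[OF Zc[OF z(2)]] t])+
    have "\<Psi> z t - \<Psi> z' t = integral {0..t} (\<lambda>s. T (t - s) (src z s) - T (t - s) (src z' s))"
      unfolding \<Psi>_def by (subst integral_diff) (auto intro: integrable_continuous_real cv)
    also have "norm \<dots> \<le> (M * ((c2 + \<beta> * hy) * c)) / \<kappa> * exp (\<kappa> * t)"
    proof (rule integral_norm_le_exp[OF continuous_on_diff[OF cv] _ _ \<kappa>0])
      fix s assume s: "s \<in> {0..t}"
      have "norm (T (t - s) (src z s) - T (t - s) (src z' s)) \<le> norm (T (t - s)) * norm (src z s - src z' s)"
        using norm_blinfun[of "T (t - s)" "src z s - src z' s"] by (simp add: blinfun.diff_right)
      also have "\<dots> \<le> M * ((c2 + \<beta> * hy) * c * exp (\<kappa> * s))"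
        by (rule mult_mono[OF MT srcd]) (use s t M in auto)
      finally show "norm (T (t - s) (src z s) - T (t - s) (src z' s)) \<le> M * ((c2 + \<beta> * hy) * c) * exp (\<kappa> * s)"
        by (simp add: mult_ac)
    qed (use t M c2 \<beta> hy c in auto)
    also have "\<dots> \<le> c / 2 * exp (\<kappa> * t)"
    proof (rule mult_right_mono)
      have "2 * (M * (c2 + \<beta> * hy)) * c \<le> \<kappa> * c" by (rule mult_right_mono[OF \<kappa>(4) c])
      then show "(M * ((c2 + \<beta> * hy) * c)) / \<kappa> \<le> c / 2" using \<kappa>0 by (simp add: field_simps)
    qed simp
    finally show ?thesis .
  qed
  have "\<exists>z\<in>Z. \<forall>t\<in>{0..tf}. \<Psi> z t = z t"
  proof (rule weighted_fixed_point[where \<omega> = "\<lambda>t. exp (\<kappa> * t)" and \<Omega> = "exp (\<kappa> * tf)"])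
    show "(\<lambda>_. 0) \<in> Z" using a0 by (simp add: Z_def)
    show "exp (\<kappa> * t) \<le> exp (\<kappa> * tf)" if "t \<in> {0..tf}" for t using that \<kappa>0 by simp
    show "\<exists>b. \<forall>t\<in>{0..tf}. norm (z t - z' t) \<le> b * exp (\<kappa> * t)" if z: "z \<in> Z" "z' \<in> Z" for z z'
    proof (intro exI ballI)
      fix t assume t: "t \<in> {0..tf}"
      have "norm (z t - z' t) \<le> 2 * \<rho> * 1"
        using norm_triangle_ineq4[of "z t" "z' t"] Z\<rho>[OF z(1) t] Z\<rho>[OF z(2) t] by linarith
      also have "\<dots> \<le> 2 * \<rho> * exp (\<kappa> * t)" by (rule mult_left_mono[OF ge1]) (use \<kappa>0 t \<rho> in auto)
      finally show "norm (z t - z' t) \<le> 2 * \<rho> * exp (\<kappa> * t)" .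
    qed
    show "f \<in> Z" if F: "\<And>n. F n \<in> Z" and lim: "uniform_limit {0..tf} F f sequentially" for F f
    proof -
      have "continuous_on {0..tf} f"
        by (rule uniform_limit_theorem[OF _ lim]) (use Zc[OF F] in auto)
      moreover have "norm (f t) \<le> a * exp (e * t)" if t: "t \<in> {0..tf}" for t
        by (rule LIMSEQ_le_const2[OF tendsto_norm[OF tendsto_uniform_limitI[OF lim t]]])
          (use Zb[OF F t] in auto)
      ultimately show ?thesis by (simp add: Z_def)
    qed
  qed (use maps contr in auto)
  then obtain z where z: "z \<in> Z" "\<And>t. t \<in> {0..tf} \<Longrightarrow> z t = \<Psi> z t" by metis
  note zc = Zc[OF z(1)]
  define U where "U = UU z"
  define P where "P = PP z"
  have "sol z U P" unfolding U_def P_def by (rule sol[OF zc])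
  then have he: "hilbert_evol tf U" and P: "scont {0..tf} P"
    and Ueq: "perturbed tf (\<lambda>t s. T (t - s)) (\<lambda>r. DF (z r) r) U"
    and Peq: "\<And>t. t \<in> {0..tf} \<Longrightarrow> P t = lyap U P0 (riccati_term W G P) t"
    by (auto simp: sol_def)
  interpret hilbert_evol tf U by (rule he)
  have KP: "scont {0..tf} (\<lambda>r. - (P r o\<^sub>L G r))" by (intro scont_minus scont_compose P G)
  obtain V where V: "evol tf V" and Veq: "perturbed tf U (\<lambda>r. - (P r o\<^sub>L G r)) V"
    using evol_perturbation[OF U KP] by blast
  have Happ: "H r v = adjoint C (inv (R r) v)" if "r \<in> {0..tf}" for r v
    by (simp add: H_def adj_apply(1) S(2)[OF that])
  have est: "estimator_equation tf T F B C R u y z0 P z"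
    unfolding estimator_equation_def
  proof (intro ballI)
    fix t assume t: "t \<in> {0..tf}"
    let ?f = "\<lambda>s. T (t - s) (F (z s) s + B (u s))"
    let ?g = "\<lambda>s. T (t - s) (P s (adjoint C (inv (R s) (y s - C (z s)))))"
    have f: "?f integrable_on {0..t}"
      by (rule integrable_continuous_real, rule convolution_continuous(2)[OF Tsc _ t])
        (intro continuous_on_add Fz_cont[OF zc] Bu_cont)
    have "(\<lambda>s. T (t - s) (P s (H s (y s - C (z s))))) integrable_on {0..t}"
      unfolding P_def by (rule integrable_continuous_real, rule convolution_continuous(2)[OF Tsc inn_cont[OF zc] t])
    then have g: "?g integrable_on {0..t}"
      by (rule integrable_eq) (use t in \<open>simp add: Happ\<close>)
    have "integral {0..t} (\<lambda>s. T (t - s) (src z s)) = integral {0..t} (\<lambda>s. ?f s + ?g s)"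
      by (rule integral_cong) (use t in \<open>simp add: src_def P_def Happ blinfun.add_right\<close>)
    also have "\<dots> = integral {0..t} ?f + integral {0..t} ?g" by (rule integral_add[OF f g])
    finally show "?f integrable_on {0..t} \<and> ?g integrable_on {0..t} \<and>
        z t = T t z0 + integral {0..t} ?f + integral {0..t} ?g"
      using f g z(2)[OF t] by (simp add: \<Psi>_def)
  qed
  have cov: "covariance_equation tf P0 W U V P"
    unfolding covariance_equation_def adj_apply(1)[symmetric]
    using closed_loop_form[OF P W G Peq V Veq] by blast
  have lin: "linearized_evolution_equation tf T DF z U"
    unfolding linearized_evolution_equation_def
  proof (intro allI impI)
    fix w s t assume "0 \<le> s \<and> s \<le> t \<and> t \<le> tf"
    then have st: "0 \<le> s" "s \<le> t" "t \<le> tf" by auto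
    have ker: "scont {s..t} (\<lambda>r. T (t - r) o\<^sub>L DF (z r) r o\<^sub>L U r s)"
      using scont_section_kernel[OF evolD(3)[OF evT] D_scont[OF zc] evolD(3)[OF U] st(1,3)] .
    show "(\<lambda>r. T (t - r) (DF (z r) r (U r s w))) integrable_on {s..t} \<and>
        U t s w = T (t - s) w + integral {s..t} (\<lambda>r. T (t - r) (DF (z r) r (U r s w)))"
      using scont_integrable[OF ker continuous_on_const, of w] sint_apply[OF ker, of w] perturbedD[OF Ueq st]
      by (simp add: blinfun.add_left)
  qed
  have clo: "closed_loop_evolution_equation tf C R P U V"
    unfolding closed_loop_evolution_equation_def
  proof (intro allI impI)
    fix w s t assume "0 \<le> s \<and> s \<le> t \<and> t \<le> tf"
    then have st: "0 \<le> s" "s \<le> t" "t \<le> tf" by auto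
    let ?f = "\<lambda>r. U t r (P r (adjoint C (inv (R r) (C (V r s w)))))"
    have ker: "scont {s..t} (\<lambda>r. U t r o\<^sub>L (- (P r o\<^sub>L G r)) o\<^sub>L V r s)"
      using scont_section_kernel[OF evolD(3)[OF U] KP evolD(3)[OF V] st(1,3)] .
    have app: "(U t r o\<^sub>L (- (P r o\<^sub>L G r)) o\<^sub>L V r s) w = - ?f r" if "r \<in> {s..t}" for r
      using that st by (simp add: G_def Happ blinfun.minus_left blinfun.minus_right)
    have "(\<lambda>r. (U t r o\<^sub>L (- (P r o\<^sub>L G r)) o\<^sub>L V r s) w) integrable_on {s..t}"
      by (rule scont_integrable[OF ker continuous_on_const])
    then have "(\<lambda>r. - ?f r) integrable_on {s..t}" by (rule integrable_eq) (rule app)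
    then have i: "?f integrable_on {s..t}" using integrable_neg[of "\<lambda>r. - ?f r"] by simp
    have "sint s t (\<lambda>r. U t r o\<^sub>L (- (P r o\<^sub>L G r)) o\<^sub>L V r s) w = integral {s..t} (\<lambda>r. - ?f r)"
      unfolding sint_apply[OF ker] by (rule integral_cong) (rule app)
    then have "V t s w = U t s w - integral {s..t} ?f"
      using perturbedD[OF Veq st] by (simp add: blinfun.add_left)
    then show "?f integrable_on {s..t} \<and> V t s w = U t s w - integral {s..t} ?f" using i by blast
  qed
  have "strongly_continuous_on {0..tf} P"
    using scont_cont[OF P] by (simp add: strongly_continuous_on_def)
  then show ?thesis
    using zc evol_evolution_operator[OF U] evol_evolution_operator[OF V] est cov lin clo by blast
qed

end
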